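(* Let $\Omega$ be a bounded Lipschitz domain in $\mathbb{R}^n$, $n\ge2$, let $1<p<q<\infty$, $\varkappa>0$, and let $a:\Omega\to[0,\infty)$ be such that $a\in\mathcal{Z}^\varkappa(\Omega)$. Then the following hold. (i) If $\varkappa\ge q-p$, then for every $\varphi\in W(\Omega)$ there exists a sequence $(\varphi_\delta)_\delta\subset C_c^\infty(\Omega)$ such that $\varphi_\delta\to\varphi$ in $W(\Omega)$ (as $\delta\to0$). (ii) Let $\gamma\in(0,1]$. If $\varkappa\ge(q-p)(1-\gamma)$, then for every $\varphi\in W(\Omega)\cap C^{0,\gamma}(\Omega)$ there exists a sequence $(\varphi_\delta)_\delta\subset C_c^\infty(\Omega)$ such that $\varphi_\delta\to\varphi$ in $W(\Omega)$ (as $\delta\to 0$). Moreover, in both cases there is a constant $c=c(\Omega)>0$, depending only on $\Omega$, such that if $\varphi\in L^\infty(\Omega)$, then the approximating sequence can be taken with $\|\varphi_\delta\|_{L^\infty(\Omega)}\le c\,\|\varphi\|_{L^\infty(\Omega)}$ for all $\delta$.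
   Context: For $\varkappa\in(0,\infty)$, the class $\mathcal{Z}^\varkappa(\Omega)$ consists of all (Lebesgue measurable) functions $a:\Omega\to[0,\infty)$ for which there is a constant $C>0$ such that $a(x)\le C\,(a(y)+|x-y|^\varkappa)$ for all $x,y\in\Omega$. Put $M(x,t)=t^p+a(x)t^q$. The energy space is $W(\Omega)=\{\varphi\in W^{1,1}_0(\Omega):\int_\Omega M(x,|\nabla\varphi(x)|)\,dx<\infty\}$ with norm $\|v\|_{W(\Omega)}=\|v\|_{L^1(\Omega)}+\|\nabla v\|_{L_M(\Omega)}$, where $\|\xi\|_{L_M(\Omega)}=\inf\{\lambda>0:\int_\Omega M(x,|\xi(x)|/\lambda)\,dx\le1\}$. Convergence $v_k\to v$ in $W(\Omega)$ is equivalent to $v_k\to v$ in $L^1(\Omega)$ together with $\int_\Omega M(x,|\nabla v_k-\nabla v|)\,dx\to0$. $C^{0,\gamma}(\Omega)$ is the space of functions $f$ on $\Omega$ with $\sup_{x\ne y\in\Omega}|f(x)-f(y)|/|x-y|^\gamma<\infty$. *)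

theory Defs
  imports "HOL-Analysis.Analysis" "HOL-Probability.Essential_Supremum"
begin

text \<open>Functions on \<open>\<Omega>\<close> are modelled as total functions whose values outside \<open>\<Omega>\<close> are irrelevant,
  except for test functions, which vanish there.\<close>

text \<open>The hyperplane coordinate \<open>x'\<close> of \<open>x\<close> in the rotated system with last axis \<open>\<nu>\<close> is
  \<open>x - (x \<bullet> \<nu>) *\<^sub>R \<nu>\<close>, so \<open>\<Omega>\<close> is required to be locally the epigraph of a Lipschitz function.\<close>

definition lipschitz_domain :: "'a::euclidean_space set \<Rightarrow> bool" where
  "lipschitz_domain \<Omega> \<longleftrightarrow> open \<Omega> \<and> connected \<Omega> \<and> \<Omega> \<noteq> {} \<and>
    (\<forall>z\<in>frontier \<Omega>. \<exists>\<nu> r L h. norm \<nu> = 1 \<and> r > 0 \<and> L-lipschitz_on {y. y \<bullet> \<nu> = 0} h \<and>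
      (\<forall>x\<in>ball z r. x \<in> \<Omega> \<longleftrightarrow> h (x - (x \<bullet> \<nu>) *\<^sub>R \<nu>) < x \<bullet> \<nu>))"

primrec Ck :: "nat \<Rightarrow> ('a::euclidean_space \<Rightarrow> real) \<Rightarrow> bool" where
  "Ck 0 f \<longleftrightarrow> continuous_on UNIV f"
| "Ck (Suc k) f \<longleftrightarrow> (\<forall>x. f differentiable (at x)) \<and> (\<forall>v. Ck k (\<lambda>x. frechet_derivative f (at x) v))"

text \<open>Elements of \<open>C\<^sub>c\<^sup>\<infinity>(\<Omega>)\<close> are identified with their extensions by zero to the whole space.\<close>

definition Cc_infinity :: "'a::euclidean_space set \<Rightarrow> ('a \<Rightarrow> real) set" where
  "Cc_infinity \<Omega> = {f. (\<forall>k. Ck k f) \<and> compact (closure {x. f x \<noteq> 0}) \<and> closure {x. f x \<noteq> 0} \<subseteq> \<Omega>}"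

definition has_weak_grad ::
    "'a::euclidean_space set \<Rightarrow> ('a \<Rightarrow> real) \<Rightarrow> ('a \<Rightarrow> 'a) \<Rightarrow> bool" where
  "has_weak_grad \<Omega> u g \<longleftrightarrow>
    (\<forall>K. compact K \<and> K \<subseteq> \<Omega> \<longrightarrow> u absolutely_integrable_on K \<and> g absolutely_integrable_on K) \<and>
    (\<forall>\<psi>\<in>Cc_infinity \<Omega>. \<forall>i\<in>Basis.
      (\<integral>x. u x * frechet_derivative \<psi> (at x) i \<partial>lebesgue_on \<Omega>) =
      - (\<integral>x. (g x \<bullet> i) * \<psi> x \<partial>lebesgue_on \<Omega>))"

text \<open>A weak gradient is unique only up to null sets, and meaningful only when one exists.\<close>

definition weak_grad :: "'a::euclidean_space set \<Rightarrow> ('a \<Rightarrow> real) \<Rightarrow> 'a \<Rightarrow> 'a" where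
  "weak_grad \<Omega> u = (SOME g. has_weak_grad \<Omega> u g)"

definition L1_norm :: "'a::euclidean_space set \<Rightarrow> ('a \<Rightarrow> 'b::real_normed_vector) \<Rightarrow> ennreal" where
  "L1_norm \<Omega> f = (\<integral>\<^sup>+x. ennreal (norm (f x)) \<partial>lebesgue_on \<Omega>)"

definition Linf_norm :: "'a::euclidean_space set \<Rightarrow> ('a \<Rightarrow> real) \<Rightarrow> ennreal" where
  "Linf_norm \<Omega> f = esssup (lebesgue_on \<Omega>) (\<lambda>x. ennreal \<bar>f x\<bar>)"

definition Linf :: "'a::euclidean_space set \<Rightarrow> ('a \<Rightarrow> real) set" where
  "Linf \<Omega> = {f. f \<in> borel_measurable (lebesgue_on \<Omega>) \<and> Linf_norm \<Omega> f < \<infinity>}"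

definition W11 :: "'a::euclidean_space set \<Rightarrow> ('a \<Rightarrow> real) set" where
  "W11 \<Omega> = {u. integrable (lebesgue_on \<Omega>) u \<and>
    (\<exists>g. has_weak_grad \<Omega> u g \<and> integrable (lebesgue_on \<Omega>) g)}"

definition W11_norm :: "'a::euclidean_space set \<Rightarrow> ('a \<Rightarrow> real) \<Rightarrow> ennreal" where
  "W11_norm \<Omega> u = L1_norm \<Omega> u + L1_norm \<Omega> (weak_grad \<Omega> u)"

definition W11_0 :: "'a::euclidean_space set \<Rightarrow> ('a \<Rightarrow> real) set" where
  "W11_0 \<Omega> = {u \<in> W11 \<Omega>. \<exists>\<psi>::nat \<Rightarrow> 'a \<Rightarrow> real. (\<forall>k. \<psi> k \<in> Cc_infinity \<Omega>) \<and>
    (\<lambda>k. W11_norm \<Omega> (\<lambda>x. \<psi> k x - u x)) \<longlonglongrightarrow> 0}"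

definition Zclass :: "real \<Rightarrow> 'a::euclidean_space set \<Rightarrow> ('a \<Rightarrow> real) set" where
  "Zclass \<kappa> \<Omega> = {a. a \<in> borel_measurable (lebesgue_on \<Omega>) \<and> (\<forall>x\<in>\<Omega>. 0 \<le> a x) \<and>
    (\<exists>C>0. \<forall>x\<in>\<Omega>. \<forall>y\<in>\<Omega>. a x \<le> C * (a y + norm (x - y) powr \<kappa>))}"

definition double_phase :: "real \<Rightarrow> real \<Rightarrow> ('a \<Rightarrow> real) \<Rightarrow> 'a \<Rightarrow> real \<Rightarrow> real" where
  "double_phase p q a x t = t powr p + a x * t powr q"

definition luxemburg_norm ::
    "'a::euclidean_space set \<Rightarrow> real \<Rightarrow> real \<Rightarrow> ('a \<Rightarrow> real) \<Rightarrow> ('a \<Rightarrow> 'a) \<Rightarrow> ennreal" where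
  "luxemburg_norm \<Omega> p q a \<xi> =
    Inf {ennreal l | l. l > 0 \<and>
      (\<integral>\<^sup>+x. ennreal (double_phase p q a x (norm (\<xi> x) / l)) \<partial>lebesgue_on \<Omega>) \<le> 1}"

definition energy_space ::
    "'a::euclidean_space set \<Rightarrow> real \<Rightarrow> real \<Rightarrow> ('a \<Rightarrow> real) \<Rightarrow> ('a \<Rightarrow> real) set" where
  "energy_space \<Omega> p q a = {\<phi> \<in> W11_0 \<Omega>.
    (\<integral>\<^sup>+x. ennreal (double_phase p q a x (norm (weak_grad \<Omega> \<phi> x))) \<partial>lebesgue_on \<Omega>) < \<infinity>}"

definition energy_norm ::
    "'a::euclidean_space set \<Rightarrow> real \<Rightarrow> real \<Rightarrow> ('a \<Rightarrow> real) \<Rightarrow> ('a \<Rightarrow> real) \<Rightarrow> ennreal" where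
  "energy_norm \<Omega> p q a v = L1_norm \<Omega> v + luxemburg_norm \<Omega> p q a (weak_grad \<Omega> v)"

definition converges_in_energy_space ::
    "'a::euclidean_space set \<Rightarrow> real \<Rightarrow> real \<Rightarrow> ('a \<Rightarrow> real) \<Rightarrow>
     (nat \<Rightarrow> 'a \<Rightarrow> real) \<Rightarrow> ('a \<Rightarrow> real) \<Rightarrow> bool" where
  "converges_in_energy_space \<Omega> p q a v w \<longleftrightarrow>
    (\<forall>k. v k \<in> energy_space \<Omega> p q a) \<and> w \<in> energy_space \<Omega> p q a \<and>
    (\<lambda>k. energy_norm \<Omega> p q a (\<lambda>x. v k x - w x)) \<longlonglongrightarrow> 0"

definition holder_space :: "'a::euclidean_space set \<Rightarrow> real \<Rightarrow> ('a \<Rightarrow> real) set" where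
  "holder_space \<Omega> \<gamma> = {f. bdd_above
    {\<bar>f x - f y\<bar> / norm (x - y) powr \<gamma> | x y. x \<in> \<Omega> \<and> y \<in> \<Omega> \<and> x \<noteq> y}}"

end

theory Submission
  imports Defs
begin

text \<open>Extend \<open>\<phi>\<close> by zero, split it by a partition of unity, and mollify each piece with a kernel of size
  \<open>\<delta>\<close> that is shifted by \<open>\<delta>\<close> into the domain, along the local graph direction; the result lies in
  \<open>C\<^sub>c\<^sup>\<infinity>(\<Omega>)\<close>. The mollified gradient \<open>F\<close> has size at most a multiple of \<open>\<delta> powr (\<gamma> - 1)\<close>, where \<open>\<gamma> = 0\<close> for a
  bounded function, and the weight oscillates by at most a multiple of \<open>\<delta> powr \<kappa>\<close> on the support of the kernel. Since
  \<open>\<kappa> \<ge> (q - p) * (1 - \<gamma>)\<close>, the oscillation times \<open>\<bar>F\<bar> powr q\<close> is at most a multiple of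
  \<open>\<bar>F\<bar> powr p\<close>, and Jensen's inequality bounds the energy density of \<open>F\<close> by the mollified energy
  density of \<open>\<phi>\<close>, which converges in \<open>L\<^sup>1\<close>; dominated convergence then gives convergence of the energies.
  In (i) the function is truncated first. In (ii) the zero extension has to be Hoelder continuous across
  the boundary, which holds because a jump there would give an indicator function with vanishing gradient.\<close>

section \<open>Smooth bump functions and gradients\<close>

text \<open>The weighted part of the energy is evaluated at \<open>x\<close>, while the mollified
  gradient averages values at other points, and a kernel shifted away from the boundary cannot be
  centred at \<open>x\<close>. Shift and kernel radius are therefore kept proportional to the same
  \<delta>, so that the weight is compared over distances of order \<delta> only. The gradient bound
  comes from the fact that the gradient of a kernel has mean zero and hence sees only the
  oscillation of the function. Localisation creates the extra gradient terms
  \<open>u x *\<^sub>R D i x\<close>. Boundedness of \<open>u\<close> makes their energy finite, a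
  second reason for truncating in (i); in (ii) boundedness follows from the Hoelder estimate. These
  terms cancel in the sum, because the cutoffs add up to 1 on \<Omega>. Zero boundary values enter
  through approximation by test functions: the gradient of the zero extension is then the zero
  extension of the gradient. The constant for the supremum norms counts the balls of a cover chosen
  from \<Omega> alone, each piece being bounded by the norm of the function.\<close>

definition flat :: "nat \<Rightarrow> real \<Rightarrow> real" where
  "flat n t = (if 0 < t then exp (- (1 / t)) / t ^ n else 0)"

lemma flat_nonneg: "0 \<le> flat n t"
  by (simp add: flat_def)

lemma flat_pos_iff: "0 < flat n t \<longleftrightarrow> 0 < t"
  by (simp add: flat_def)

lemma power_le_fact_exp:
  fixes x :: real
  assumes "0 \<le> x"
  shows "x ^ n \<le> fact n * exp x"
proof -
  have "(\<Sum>k\<in>{n}. x ^ k /\<^sub>R fact k) \<le> exp x"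
    unfolding exp_def using assms by (intro sum_le_suminf summable_exp_generic) auto
  then show ?thesis
    by (simp add: field_simps)
qed

text \<open>One more power than \<open>n\<close> is spent on the exponential bound at
  \<open>1 / t\<close>; the surplus leaves the factor \<open>\<bar>t\<bar>\<close>, which gives the
  limit at 0.\<close>

lemma flat_le: "flat n t \<le> fact (Suc n) * \<bar>t\<bar>"
proof (cases "0 < t")
  case True
  then have "(1 / t) ^ Suc n \<le> fact (Suc n) * exp (1 / t)"
    by (intro power_le_fact_exp) auto
  then show ?thesis
    using True by (simp add: flat_def exp_minus field_simps del: fact_Suc)
next
  case False
  then have "flat n t = 0"
    by (simp add: flat_def)
  then show ?thesis
    by (simp only: mult_nonneg_nonneg abs_ge_zero fact_ge_zero)
qed

lemma flat_tendsto_0: "(flat n \<longlongrightarrow> 0) (at 0)"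
proof (rule Lim_null_comparison)
  show "\<forall>\<^sub>F t in at 0. norm (flat n t) \<le> fact (Suc n) * \<bar>t\<bar>"
    using flat_le flat_nonneg by (auto intro!: always_eventually)
  have "((\<lambda>t::real. fact (Suc n) * \<bar>t\<bar>) \<longlongrightarrow> fact (Suc n) * \<bar>0\<bar>) (at 0)"
    by (intro tendsto_intros)
  then show "((\<lambda>t::real. fact (Suc n) * \<bar>t\<bar>) \<longlongrightarrow> 0) (at 0)"
    by simp
qed

text \<open>Differentiation raises the power of \<open>1 / t\<close>. This is why the whole family
  is introduced instead of \<open>flat 0\<close> alone: its linear combinations are stable under
  differentiation.\<close>

lemma flat_has_real_derivative:
  "(flat n has_real_derivative flat (n + 2) t - real n * flat (Suc n) t) (at t)"
proof -
  consider "t < 0" | "t = 0" | "0 < t" by linarith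
  then show ?thesis
  proof cases
    case 1
    have "((\<lambda>t. 0) has_real_derivative flat (n + 2) t - real n * flat (Suc n) t) (at t)"
      using 1 by (simp add: flat_def)
    then show ?thesis
      by (rule has_field_derivative_transform_within_open[where S = "{..<0}"])
         (use 1 in \<open>auto simp: flat_def\<close>)
  next
    case 2
    \<comment> \<open>The difference quotient at 0 is \<open>flat (Suc n)\<close>, a member of the
      same family, so the limit known for every index applies.\<close>
    have "(flat n has_real_derivative 0) (at 0)"
      unfolding has_field_derivative_iff
    proof (rule Lim_transform_eventually[OF flat_tendsto_0[of "Suc n"]])
      show "\<forall>\<^sub>F x in at 0. flat (Suc n) x = (flat n x - flat n 0) / (x - 0)"
        by (auto simp: flat_def eventually_at_filter)
    qed
    then show ?thesis
      using 2 by (simp add: flat_def)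
  next
    case 3
    have "((\<lambda>t. exp (- (1 / t)) / t ^ n) has_real_derivative
        flat (n + 2) t - real n * flat (Suc n) t) (at t)"
    proof -
      have n: "real n * t ^ (n - Suc 0) = real n * t ^ n / t"
        using 3 by (cases n) auto
      have "((\<lambda>t. exp (- (1 / t)) / t ^ n) has_real_derivative
          (exp (- (1 / t)) * (1 / t\<^sup>2) * t ^ n - exp (- (1 / t)) * (real n * t ^ n / t)) / (t ^ n * t ^ n)) (at t)"
        using 3 by (auto intro!: derivative_eq_intros simp: n power2_eq_square)
      also have "(exp (- (1 / t)) * (1 / t\<^sup>2) * t ^ n - exp (- (1 / t)) * (real n * t ^ n / t)) / (t ^ n * t ^ n)
          = flat (n + 2) t - real n * flat (Suc n) t"
        using 3 by (simp add: flat_def field_simps power2_eq_square)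
      finally show ?thesis .
    qed
    then show ?thesis
      by (rule has_field_derivative_transform_within_open[where S = "{0<..}"])
         (use 3 in \<open>auto simp: flat_def\<close>)
  qed
qed

text \<open>A syntactic class closed under directional derivatives. Induction on the expression
  replaces any formula for higher derivatives: one differentiation step gives \<open>Ck\<close> of
  every order.\<close>

inductive smooth_expr :: "('a::euclidean_space \<Rightarrow> real) \<Rightarrow> bool" where
  const: "smooth_expr (\<lambda>x. c)"
| inner: "smooth_expr (\<lambda>x. x \<bullet> v)"
| add: "smooth_expr f \<Longrightarrow> smooth_expr g \<Longrightarrow> smooth_expr (\<lambda>x. f x + g x)"
| mult: "smooth_expr f \<Longrightarrow> smooth_expr g \<Longrightarrow> smooth_expr (\<lambda>x. f x * g x)"
| comp: "smooth_expr f \<Longrightarrow> smooth_expr (\<lambda>x. flat n (f x))"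

lemma smooth_expr_derivative:
  assumes "smooth_expr f"
  shows "\<exists>f'. (\<forall>x. (f has_derivative f' x) (at x)) \<and> (\<forall>v. smooth_expr (\<lambda>x. f' x v))"
  using assms
proof induction
  case (const c)
  then show ?case
    by (intro exI[of _ "\<lambda>x v. 0"]) (auto intro: smooth_expr.const)
next
  case (inner w)
  then show ?case
    by (intro exI[of _ "\<lambda>x v. v \<bullet> w"]) (auto intro!: smooth_expr.const derivative_eq_intros)
next
  case (add f g)
  then obtain f' g' where "\<forall>x. (f has_derivative f' x) (at x)" "\<forall>v. smooth_expr (\<lambda>x. f' x v)"
    "\<forall>x. (g has_derivative g' x) (at x)" "\<forall>v. smooth_expr (\<lambda>x. g' x v)"
    by blast
  then show ?case
    by (intro exI[of _ "\<lambda>x v. f' x v + g' x v"]) (auto intro!: smooth_expr.add derivative_intros)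
next
  case (mult f g)
  then obtain f' g' where "\<forall>x. (f has_derivative f' x) (at x)" "\<forall>v. smooth_expr (\<lambda>x. f' x v)"
    "\<forall>x. (g has_derivative g' x) (at x)" "\<forall>v. smooth_expr (\<lambda>x. g' x v)"
    by blast
  then show ?case using mult.hyps
    by (intro exI[of _ "\<lambda>x v. f x * g' x v + f' x v * g x"])
      (auto intro!: smooth_expr.add smooth_expr.mult has_derivative_mult)
next
  case (comp f n)
  then obtain f' where f': "\<forall>x. (f has_derivative f' x) (at x)" "\<forall>v. smooth_expr (\<lambda>x. f' x v)"
    by blast
  have "((\<lambda>x. flat n (f x)) has_derivative
      (\<lambda>v. f' x v * (flat (n + 2) (f x) + (- real n) * flat (Suc n) (f x)))) (at x)" for x
    using has_derivative_compose[OF f'(1)[rule_format, of x]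
        flat_has_real_derivative[THEN has_field_derivative_imp_has_derivative, of n]]
    by (simp add: mult.commute)
  moreover have "smooth_expr (\<lambda>x. f' x v * (flat (n + 2) (f x) + (- real n) * flat (Suc n) (f x)))" for v
    using comp.hyps f'(2) by (intro smooth_expr.intros) auto
  ultimately show ?case
    by (intro exI[of _ "\<lambda>x v. f' x v * (flat (n + 2) (f x) + (- real n) * flat (Suc n) (f x))"]) simp
qed

lemma smooth_expr_Ck:
  assumes "smooth_expr f"
  shows "Ck k f"
  using assms
proof (induction k arbitrary: f)
  case 0
  then obtain f' where "\<forall>x. (f has_derivative f' x) (at x)"
    using smooth_expr_derivative by blast
  then show ?case
    by (auto intro!: continuous_at_imp_continuous_on dest: has_derivative_continuous)
next
  case (Suc k)
  obtain f' where f': "\<forall>x. (f has_derivative f' x) (at x)" "\<forall>v. smooth_expr (\<lambda>x. f' x v)"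
    using smooth_expr_derivative Suc.prems by blast
  then have "frechet_derivative f (at x) = f' x" for x
    by (metis frechet_derivative_at)
  with f' Suc.IH show ?case
    by (auto simp: differentiable_def)
qed

lemma smooth_expr_scaleR:
  assumes "smooth_expr f"
  shows "smooth_expr (\<lambda>x. f (t *\<^sub>R x))"
  using assms
proof induction
  case (inner v)
  then show ?case
    using smooth_expr.inner[of "t *\<^sub>R v"] by simp
qed (auto intro: smooth_expr.intros)

lemma smooth_expr_sum:
  assumes "finite I" "\<And>i. i \<in> I \<Longrightarrow> smooth_expr (f i)"
  shows "smooth_expr (\<lambda>x. \<Sum>i\<in>I. f i x)"
  using assms by (induction I) (auto intro: smooth_expr.intros)

lemma smooth_expr_bump:
  fixes c :: "'a::euclidean_space"
  shows "smooth_expr (\<lambda>x. flat 0 (r\<^sup>2 - (norm (x - c))\<^sup>2))"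
proof -
  \<comment> \<open>The squared norm is expanded in coordinates, since the class is generated by
    inner products with fixed vectors.\<close>
  have *: "r\<^sup>2 - (norm (x - c))\<^sup>2 =
      (r\<^sup>2 - c \<bullet> c) + ((\<Sum>b\<in>Basis. (- 1) * ((x \<bullet> b) * (x \<bullet> b))) + 2 * (x \<bullet> c))" for x
  proof -
    have "(\<Sum>b\<in>Basis. (- 1) * ((x \<bullet> b) * (x \<bullet> b))) = - (x \<bullet> x)"
      by (simp add: sum_negf euclidean_inner[of x x])
    then show ?thesis
      by (simp add: dot_square_norm[symmetric] inner_diff inner_commute)
  qed
  show ?thesis
    unfolding *
    by (intro smooth_expr.intros smooth_expr_sum finite_Basis)
qed

section \<open>Continuously differentiable functions with their gradients as vector fields\<close>

definition C1 :: "('a::euclidean_space \<Rightarrow> real) \<Rightarrow> ('a \<Rightarrow> 'a) \<Rightarrow> bool" where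
  "C1 f D \<longleftrightarrow> (\<forall>x. (f has_derivative (\<lambda>h. D x \<bullet> h)) (at x)) \<and> continuous_on UNIV D"

definition C1c :: "('a::euclidean_space \<Rightarrow> real) \<Rightarrow> ('a \<Rightarrow> 'a) \<Rightarrow> bool" where
  "C1c f D \<longleftrightarrow> C1 f D \<and> (\<exists>R. \<forall>x. R < norm x \<longrightarrow> f x = 0)"

definition grad :: "('a::euclidean_space \<Rightarrow> real) \<Rightarrow> 'a \<Rightarrow> 'a" where
  "grad f x = (\<Sum>b\<in>Basis. frechet_derivative f (at x) b *\<^sub>R b)"

lemma has_derivative_imp_grad:
  assumes "(f has_derivative (\<lambda>h. d \<bullet> h)) (at x)"
  shows "grad f x = d"
proof -
  have "frechet_derivative f (at x) = (\<lambda>h. d \<bullet> h)"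
    using assms by (metis frechet_derivative_at)
  then show ?thesis
    by (simp add: grad_def euclidean_representation)
qed

lemma C1_grad:
  assumes "C1 f D"
  shows "grad f = D"
  using assms has_derivative_imp_grad unfolding C1_def by blast

lemma differentiable_imp_grad:
  assumes "f differentiable (at x)"
  shows "(f has_derivative (\<lambda>h. grad f x \<bullet> h)) (at x)"
proof -
  have f: "(f has_derivative frechet_derivative f (at x)) (at x)"
    using assms frechet_derivative_works by blast
  then interpret bounded_linear "frechet_derivative f (at x)"
    by (rule has_derivative_bounded_linear)
  have "frechet_derivative f (at x) h = grad f x \<bullet> h" for h
  proof -
    have "frechet_derivative f (at x) h = frechet_derivative f (at x) (\<Sum>b\<in>Basis. (h \<bullet> b) *\<^sub>R b)"
      by (simp add: euclidean_representation)
    also have "\<dots> = grad f x \<bullet> h"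
      by (simp add: sum scaleR grad_def inner_sum_right inner_commute mult.commute)
    finally show ?thesis .
  qed
  then show ?thesis
    using f by presburger
qed

lemma Ck_imp_C1:
  assumes "Ck (Suc 0) f"
  shows "C1 f (grad f)"
proof -
  have "continuous_on UNIV (\<lambda>x. \<Sum>b\<in>Basis. frechet_derivative f (at x) b *\<^sub>R b)"
    using assms by (intro continuous_intros) auto
  then have "continuous_on UNIV (grad f)"
    unfolding grad_def .
  then show ?thesis
    using assms differentiable_imp_grad unfolding C1_def by auto
qed

lemma C1_continuous: "C1 f D \<Longrightarrow> continuous_on UNIV f"
  unfolding C1_def by (auto intro!: continuous_at_imp_continuous_on dest: has_derivative_continuous)

lemma has_derivative_zero_outside_closed:
  assumes "(f has_derivative (\<lambda>h. d \<bullet> h)) (at x)" "closed S" "\<And>y. y \<notin> S \<Longrightarrow> f y = 0" "x \<notin> S"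
  shows "d = 0"
proof -
  have "((\<lambda>x. 0) has_derivative (\<lambda>h. d \<bullet> h)) (at x)"
    by (rule has_derivative_transform_within_open[OF assms(1), of "- S"]) (use assms in auto)
  then have "(\<lambda>h. d \<bullet> h) = (\<lambda>h. 0)"
    using has_derivative_unique has_derivative_const by blast
  then show ?thesis
    by (metis inner_eq_zero_iff)
qed

lemma C1_zero_outside_closed:
  assumes "C1 f D" "closed S" "\<And>y. y \<notin> S \<Longrightarrow> f y = 0" "x \<notin> S"
  shows "D x = 0"
  using assms has_derivative_zero_outside_closed[of f "D x" x S] unfolding C1_def by auto

lemma C1cE:
  assumes "C1c f D"
  obtains R where "0 < R" "\<And>x. x \<notin> cball 0 R \<Longrightarrow> f x = 0" "\<And>x. x \<notin> cball 0 R \<Longrightarrow> D x = 0"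
proof -
  obtain R where "\<forall>x. R < norm x \<longrightarrow> f x = 0"
    using assms unfolding C1c_def by auto
  then have *: "x \<notin> cball 0 (max R 1) \<Longrightarrow> f x = 0" for x
    by auto
  show ?thesis
  proof
    show "x \<notin> cball 0 (max R 1) \<Longrightarrow> D x = 0" for x
      by (rule C1_zero_outside_closed[of f D "cball 0 (max R 1)"]) (use assms * in \<open>auto simp: C1c_def\<close>)
  qed (use * in auto)
qed

lemma C1cI:
  fixes f :: "'a::euclidean_space \<Rightarrow> real"
  assumes "C1 f D" "\<And>x. x \<notin> cball z R \<Longrightarrow> f x = 0"
  shows "C1c f D"
  unfolding C1c_def
proof (intro conjI exI allI impI)
  fix x :: 'a assume "norm z + R < norm x"
  then have "x \<notin> cball z R"
    using norm_triangle_ineq[of z "x - z"] by (auto simp: dist_norm norm_minus_commute)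
  then show "f x = 0"
    by (rule assms(2))
qed (fact assms(1))

lemma Cc_infinity_C1c:
  assumes "f \<in> Cc_infinity \<Omega>"
  shows "C1c f (grad f)"
proof -
  have "bounded (closure {x. f x \<noteq> 0})"
    using assms compact_imp_bounded unfolding Cc_infinity_def by auto
  then obtain R where "\<forall>x\<in>closure {x. f x \<noteq> 0}. norm x \<le> R"
    by (auto simp: bounded_iff)
  then have "x \<notin> cball 0 R \<Longrightarrow> f x = 0" for x
    using closure_subset[of "{x. f x \<noteq> 0}"] by auto
  moreover have "C1 f (grad f)"
    using assms Ck_imp_C1[of f] unfolding Cc_infinity_def by blast
  ultimately show ?thesis
    by (rule C1cI[rotated])
qed

lemma Cc_infinityI:
  assumes "\<And>k. Ck k f" "compact K" "K \<subseteq> \<Omega>" "\<And>x. x \<notin> K \<Longrightarrow> f x = 0"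
  shows "f \<in> Cc_infinity \<Omega>"
proof -
  have "closure {x. f x \<noteq> 0} \<subseteq> K"
    using assms by (intro closure_minimal) (auto simp: compact_imp_closed)
  moreover from this have "compact (closure {x. f x \<noteq> 0})"
    using assms(2) compact_Int_closed[of K "closure {x. f x \<noteq> 0}"] by (simp add: Int_absorb1)
  ultimately show ?thesis
    using assms by (auto simp: Cc_infinity_def)
qed

lemma Cc_infinity_zero_outside:
  assumes "f \<in> Cc_infinity \<Omega>" "x \<notin> \<Omega>"
  shows "f x = 0" "grad f x = 0"
proof -
  define S where "S = closure {x. f x \<noteq> 0}"
  have zero: "f y = 0" if "y \<notin> S" for y
    using that closure_subset[of "{x. f x \<noteq> 0}"] unfolding S_def by auto
  have x: "x \<notin> S"
    using assms unfolding Cc_infinity_def S_def by auto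
  have f: "C1 f (grad f)"
    using Cc_infinity_C1c[OF assms(1)] by (simp add: C1c_def)
  have S: "closed S"
    unfolding S_def by (rule closed_closure)
  show "f x = 0"
    by (rule zero[OF x])
  show "grad f x = 0"
    by (rule C1_zero_outside_closed[OF f S zero x])
qed

lemma C1c_bounded:
  assumes "C1c f D"
  obtains B where "0 < B" "\<And>x. \<bar>f x\<bar> \<le> B" "\<And>x. norm (D x) \<le> B"
proof -
  obtain R where R: "0 < R" "\<And>x. x \<notin> cball 0 R \<Longrightarrow> f x = 0" "\<And>x. x \<notin> cball 0 R \<Longrightarrow> D x = 0"
    using C1cE[OF assms] by blast
  have "compact (f ` cball 0 R)" "compact (D ` cball 0 R)"
    using assms C1_continuous[of f D] unfolding C1c_def C1_def
    by (auto intro!: compact_continuous_image intro: continuous_on_subset)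
  then obtain B1 B2 where "\<forall>x\<in>cball 0 R. norm (f x) \<le> B1" "\<forall>x\<in>cball 0 R. norm (D x) \<le> B2"
    by (auto dest!: compact_imp_bounded simp: bounded_iff)
  with R(2,3) have "\<bar>f x\<bar> \<le> max 1 (max B1 B2)" "norm (D x) \<le> max 1 (max B1 B2)" for x
    by (cases "x \<in> cball 0 R"; auto simp: le_max_iff_disj simp del: mem_cball)+
  then show ?thesis
    using that[of "max 1 (max B1 B2)"] by auto
qed

lemma integrable_continuous_compact_support:
  fixes f :: "'a::euclidean_space \<Rightarrow> 'b::euclidean_space"
  assumes "continuous_on UNIV f" "\<And>x. x \<notin> cball 0 R \<Longrightarrow> f x = 0"
  shows "integrable lborel f"
proof -
  have "integrable lborel (\<lambda>x. indicator (cball 0 R) x *\<^sub>R f x)"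
    by (intro borel_integrable_compact continuous_on_subset[OF assms(1)]) auto
  also have "(\<lambda>x. indicator (cball 0 R) x *\<^sub>R f x) = f"
    using assms(2) by (auto simp: indicator_def fun_eq_iff)
  finally show ?thesis .
qed

lemma C1c_integrable:
  assumes "C1c f D"
  shows "integrable lborel f" "integrable lborel D"
proof -
  obtain R where R: "\<And>x. x \<notin> cball 0 R \<Longrightarrow> f x = 0" "\<And>x. x \<notin> cball 0 R \<Longrightarrow> D x = 0"
    using C1cE[OF assms] by metis
  have c: "continuous_on UNIV f" "continuous_on UNIV D"
    using assms C1_continuous[of f D] by (simp_all add: C1c_def C1_def)
  show "integrable lborel f"
    by (rule integrable_continuous_compact_support[OF c(1) R(1)])
  show "integrable lborel D"
    by (rule integrable_continuous_compact_support[OF c(2) R(2)])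
qed

lemma C1c_measurable:
  assumes "C1c f D"
  shows "f \<in> borel_measurable borel" "D \<in> borel_measurable borel"
  using C1c_integrable[OF assms] by (auto dest: borel_measurable_integrable)

lemma C1_mult:
  assumes "C1 f D" "C1 g E"
  shows "C1 (\<lambda>x. f x * g x) (\<lambda>x. f x *\<^sub>R E x + g x *\<^sub>R D x)"
  unfolding C1_def
proof (intro conjI allI)
  fix x
  have "((\<lambda>x. f x * g x) has_derivative (\<lambda>h. f x * (E x \<bullet> h) + D x \<bullet> h * g x)) (at x)"
    using assms unfolding C1_def by (intro has_derivative_mult) auto
  then show "((\<lambda>x. f x * g x) has_derivative (\<lambda>h. (f x *\<^sub>R E x + g x *\<^sub>R D x) \<bullet> h)) (at x)"
    by (simp add: inner_add_left mult.commute)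
  show "continuous_on UNIV (\<lambda>x. f x *\<^sub>R E x + g x *\<^sub>R D x)"
    using assms C1_continuous[OF assms(1)] C1_continuous[OF assms(2)] unfolding C1_def
    by (intro continuous_intros) auto
qed

lemma C1_add:
  assumes "C1 f D" "C1 g E"
  shows "C1 (\<lambda>x. f x + g x) (\<lambda>x. D x + E x)"
  unfolding C1_def
proof (intro conjI allI)
  fix x
  have "((\<lambda>x. f x + g x) has_derivative (\<lambda>h. D x \<bullet> h + E x \<bullet> h)) (at x)"
    using assms unfolding C1_def by (intro has_derivative_add) auto
  then show "((\<lambda>x. f x + g x) has_derivative (\<lambda>h. (D x + E x) \<bullet> h)) (at x)"
    by (simp only: inner_add_left)
  show "continuous_on UNIV (\<lambda>x. D x + E x)"
    using assms unfolding C1_def by (intro continuous_intros) auto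
qed

lemma C1_const: "C1 (\<lambda>x. c) (\<lambda>x. 0)"
  by (auto simp: C1_def)

lemma C1_compose:
  assumes "C1 f D" "\<And>t. (T has_real_derivative T' t) (at t)" "continuous_on UNIV T'"
  shows "C1 (\<lambda>x. T (f x)) (\<lambda>x. T' (f x) *\<^sub>R D x)"
  unfolding C1_def
proof (intro conjI allI)
  fix x
  show "((\<lambda>x. T (f x)) has_derivative (\<lambda>h. T' (f x) *\<^sub>R D x \<bullet> h)) (at x)"
    using has_derivative_compose[OF _ assms(2)[THEN has_field_derivative_imp_has_derivative],
        of f "\<lambda>h. D x \<bullet> h" x UNIV] assms(1)
    unfolding C1_def by (simp add: mult.commute)
  have "continuous_on UNIV (\<lambda>x. T' (f x))"
    using continuous_on_compose2[OF assms(3) C1_continuous[OF assms(1)]] by auto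
  then show "continuous_on UNIV (\<lambda>x. T' (f x) *\<^sub>R D x)"
    using assms(1) unfolding C1_def by (intro continuous_intros) auto
qed

lemma C1c_mult:
  assumes "C1 f D" "C1c g E"
  shows "C1c (\<lambda>x. f x * g x) (\<lambda>x. f x *\<^sub>R E x + g x *\<^sub>R D x)"
  using C1_mult[OF assms(1)] assms(2) unfolding C1c_def by auto

lemma C1c_compose:
  assumes "C1c f D" "\<And>t. (T has_real_derivative T' t) (at t)" "continuous_on UNIV T'" "T 0 = 0"
  shows "C1c (\<lambda>x. T (f x)) (\<lambda>x. T' (f x) *\<^sub>R D x)"
  using assms(1,4) C1_compose[of f D T T', OF _ assms(2,3)] unfolding C1c_def by (metis (lifting))

section \<open>Convolution\<close>

lemma lborel_integral_affine:
  fixes f :: "'a::euclidean_space \<Rightarrow> 'b::euclidean_space"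
  assumes f: "f \<in> borel_measurable borel" and "c \<noteq> 0"
  shows "(\<integral>x. f (t + c *\<^sub>R x) \<partial>lborel) = (\<integral>x. f x \<partial>lborel) /\<^sub>R \<bar>c\<bar> ^ DIM('a)"
proof -
  note f[measurable]
  have "(\<integral>x. f x \<partial>lborel) =
      (\<integral>x. f x \<partial>density (distr lborel borel (\<lambda>x. t + c *\<^sub>R x)) (\<lambda>_. ennreal (\<bar>c\<bar> ^ DIM('a))))"
    by (subst lborel_affine[OF \<open>c \<noteq> 0\<close>, of t]) simp
  also have "\<dots> = \<bar>c\<bar> ^ DIM('a) *\<^sub>R (\<integral>x. f (t + c *\<^sub>R x) \<partial>lborel)"
    by (simp add: integral_density integral_distr)
  finally show ?thesis
    using \<open>c \<noteq> 0\<close> by simp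
qed

lemma lborel_integrable_affine:
  fixes f :: "'a::euclidean_space \<Rightarrow> 'b::euclidean_space"
  assumes f: "f \<in> borel_measurable borel" and "c \<noteq> 0"
  shows "integrable lborel (\<lambda>x. f (t + c *\<^sub>R x)) \<longleftrightarrow> integrable lborel f"
proof -
  note f[measurable]
  have "integrable lborel f \<longleftrightarrow>
      integrable (density (distr lborel borel (\<lambda>x. t + c *\<^sub>R x)) (\<lambda>_. ennreal (\<bar>c\<bar> ^ DIM('a)))) f"
    by (subst lborel_affine[OF \<open>c \<noteq> 0\<close>, of t]) simp
  also have "\<dots> \<longleftrightarrow> integrable lborel (\<lambda>x. f (t + c *\<^sub>R x))"
  proof -
    have "integrable lborel (\<lambda>x. f (t + c *\<^sub>R x))"
      if "integrable lborel (\<lambda>x. \<bar>c\<bar> ^ DIM('a) *\<^sub>R f (t + c *\<^sub>R x))"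
      using integrable_scaleR_right[OF that, of "inverse (\<bar>c\<bar> ^ DIM('a))"] \<open>c \<noteq> 0\<close> by simp
    then show ?thesis
      using \<open>c \<noteq> 0\<close> by (auto simp: integrable_density integrable_distr_eq)
  qed
  finally show ?thesis by simp
qed

lemma lborel_integral_reflect:
  fixes f :: "'a::euclidean_space \<Rightarrow> 'b::euclidean_space"
  assumes "f \<in> borel_measurable borel"
  shows "(\<integral>y. f (x - y) \<partial>lborel) = (\<integral>y. f y \<partial>lborel)"
  using lborel_integral_affine[OF assms, of "-1" x] by simp

lemma lborel_integral_translate:
  fixes f :: "'a::euclidean_space \<Rightarrow> 'b::euclidean_space"
  assumes "f \<in> borel_measurable borel"
  shows "(\<integral>x. f (x - y) \<partial>lborel) = (\<integral>x. f x \<partial>lborel)"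
  using lborel_integral_affine[OF assms, of 1 "- y"] by (simp add: add.commute)

lemma lborel_integrable_translate:
  fixes f :: "'a::euclidean_space \<Rightarrow> 'b::euclidean_space"
  assumes "integrable lborel f"
  shows "integrable lborel (\<lambda>x. f (x - y))"
  using lborel_integrable_affine[of f 1 "- y"] assms borel_measurable_integrable[OF assms]
  by (simp add: add.commute)

lemma lborel_integrable_reflect:
  fixes f :: "'a::euclidean_space \<Rightarrow> 'b::euclidean_space"
  assumes "integrable lborel f"
  shows "integrable lborel (\<lambda>y. f (x - y))"
  using lborel_integrable_affine[of f "- 1" x] assms borel_measurable_integrable[OF assms]
  by simp

lemma integrable_bounded_scaleR:
  fixes f :: "'a \<Rightarrow> 'b::euclidean_space"
  assumes "integrable M f" and [measurable]: "k \<in> borel_measurable M" and "\<And>x. \<bar>k x\<bar> \<le> B"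
  shows "integrable M (\<lambda>x. k x *\<^sub>R f x)"
proof (rule Bochner_Integration.integrable_bound)
  show "integrable M (\<lambda>x. B *\<^sub>R norm (f x))"
    using assms(1) by simp
  show "(\<lambda>x. k x *\<^sub>R f x) \<in> borel_measurable M"
    using borel_measurable_integrable[OF assms(1)] by measurable
  have "\<bar>k x\<bar> * norm (f x) \<le> \<bar>B * norm (f x)\<bar>" for x
    using mult_right_mono[OF assms(3)[of x] norm_ge_zero[of "f x"]] by linarith
  then show "AE x in M. norm (k x *\<^sub>R f x) \<le> norm (B *\<^sub>R norm (f x))"
    by (intro AE_I2) simp
qed

lemma integrable_scaleR_bounded:
  fixes f :: "'a \<Rightarrow> 'b::euclidean_space"
  assumes "integrable M k" and [measurable]: "f \<in> borel_measurable M" and "\<And>x. norm (f x) \<le> B"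
  shows "integrable M (\<lambda>x. k x *\<^sub>R f x)"
proof (rule Bochner_Integration.integrable_bound)
  show "integrable M (\<lambda>x. B *\<^sub>R \<bar>k x\<bar>)"
    using assms(1) by simp
  show "(\<lambda>x. k x *\<^sub>R f x) \<in> borel_measurable M"
    using borel_measurable_integrable[OF assms(1)] by measurable
  have "\<bar>k x\<bar> * norm (f x) \<le> \<bar>B * \<bar>k x\<bar>\<bar>" for x
    using mult_right_mono[OF assms(3)[of x], of "\<bar>k x\<bar>"] by (simp add: mult.commute)
  then show "AE x in M. norm (k x *\<^sub>R f x) \<le> norm (B *\<^sub>R \<bar>k x\<bar>)"
    by (intro AE_I2) simp
qed

text \<open>The kernel is scalar and the argument may be vector valued, so that the same operator
  mollifies a function and its gradient field.\<close>

definition conv :: "('a::euclidean_space \<Rightarrow> real) \<Rightarrow> ('a \<Rightarrow> 'b::euclidean_space) \<Rightarrow> 'a \<Rightarrow> 'b" where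
  "conv k f x = (\<integral>y. k (x - y) *\<^sub>R f y \<partial>lborel)"

section \<open>Differentiation of convolutions and integration by parts\<close>

lemma uniformly_continuous_compact_support:
  fixes D :: "'a::euclidean_space \<Rightarrow> 'b::real_normed_vector"
  assumes c: "continuous_on UNIV D" and R: "\<And>x. x \<notin> cball 0 R \<Longrightarrow> D x = 0"
  shows "uniformly_continuous_on UNIV D"
proof -
  have u: "uniformly_continuous_on (cball 0 (R + 1)) D"
    by (intro compact_uniformly_continuous continuous_on_subset[OF c]) auto
  show ?thesis
    unfolding uniformly_continuous_on_def
  proof (intro allI impI)
    fix e :: real assume "0 < e"
    then obtain d where d: "0 < d"
      "\<And>x y. x \<in> cball 0 (R + 1) \<Longrightarrow> y \<in> cball 0 (R + 1) \<Longrightarrow> dist y x < d \<Longrightarrow> dist (D y) (D x) < e"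
      using u unfolding uniformly_continuous_on_def by metis
    show "\<exists>d>0. \<forall>x\<in>UNIV. \<forall>x'\<in>UNIV. dist x' x < d \<longrightarrow> dist (D x') (D x) < e"
    proof (intro exI[of _ "min d 1"] conjI ballI impI)
      fix x y :: 'a assume xy: "dist y x < min d 1"
      show "dist (D y) (D x) < e"
      proof (cases "x \<in> cball 0 (R + 1) \<and> y \<in> cball 0 (R + 1)")
        case True
        then show ?thesis using d(2) xy by simp
      next
        case False
        have "R < norm x \<and> R < norm y"
        proof -
          have "norm x \<le> norm y + dist y x" "norm y \<le> norm x + dist y x"
            using norm_triangle_ineq2[of x y] norm_triangle_ineq2[of y x]
            by (auto simp: dist_norm norm_minus_commute)
          then show ?thesis using False xy by auto
        qed
        then show ?thesis using R \<open>0 < e\<close> by auto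
      qed
    qed (use d in auto)
  qed
qed

lemma C1c_uniformly_continuous:
  assumes "C1c f D"
  shows "uniformly_continuous_on UNIV D"
proof -
  obtain R where "\<And>x. x \<notin> cball 0 R \<Longrightarrow> D x = 0"
    using C1cE[OF assms] by metis
  moreover have "continuous_on UNIV D"
    using assms by (simp add: C1c_def C1_def)
  ultimately show ?thesis
    by (rule uniformly_continuous_compact_support[rotated])
qed

text \<open>Uniform continuity of \<open>D\<close> makes the remainder small uniformly in
  \<open>x\<close>; this uniformity allows the expansion to be integrated.\<close>

lemma C1c_uniform_taylor:
  assumes "C1c f D" "0 < e"
  obtains d where "0 < d" "\<And>x h. norm h < d \<Longrightarrow> \<bar>f (x + h) - f x - D x \<bullet> h\<bar> \<le> e * norm h"
proof -
  obtain d where d: "0 < d" "\<And>x y. dist y x < d \<Longrightarrow> dist (D y) (D x) < e"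
    using C1c_uniformly_continuous[OF assms(1)] assms(2) unfolding uniformly_continuous_on_def
    by (metis UNIV_I)
  show ?thesis
  proof (rule that[OF d(1)])
    fix x h :: 'a assume h: "norm h < d"
    have "norm (f (x + h) - f x - D x \<bullet> ((x + h) - x)) \<le> norm ((x + h) - x) * e"
    proof (rule differentiable_bound_linearization[where S = "ball x d" and f' = "\<lambda>y h. D y \<bullet> h"])
      fix t :: real assume "t \<in> {0..1}"
      then have "norm (t *\<^sub>R h) \<le> norm h"
        by (simp add: mult_left_le_one_le)
      then show "x + t *\<^sub>R (x + h - x) \<in> ball x d"
        using h by (simp add: dist_norm)
    next
      fix y
      show "(f has_derivative (\<lambda>h. D y \<bullet> h)) (at y within ball x d)"
        using assms(1) unfolding C1c_def C1_def by (auto intro: has_derivative_at_withinI)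
    next
      fix y assume "y \<in> ball x d"
      then have "norm (D y - D x) \<le> e"
        using d(2)[of y x] by (simp add: dist_norm norm_minus_commute)
      have "onorm ((\<lambda>h. D y \<bullet> h) - (\<lambda>h. D x \<bullet> h)) \<le> norm (D y - D x)"
        by (rule onorm_le) (simp add: inner_diff_left[symmetric] Cauchy_Schwarz_ineq2)
      then show "onorm ((\<lambda>h. D y \<bullet> h) - (\<lambda>h. D x \<bullet> h)) \<le> e"
        using \<open>norm (D y - D x) \<le> e\<close> by simp
    qed (use d in auto)
    then show "\<bar>f (x + h) - f x - D x \<bullet> h\<bar> \<le> e * norm h"
      by (simp add: mult.commute)
  qed
qed

lemma abs_integral_le_of_bound:
  fixes f :: "'a::euclidean_space \<Rightarrow> 'b::euclidean_space"
  assumes "\<And>x. norm (f x) \<le> B" "\<And>x. x \<notin> cball 0 R \<Longrightarrow> f x = 0"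
  shows "norm (\<integral>x. f x \<partial>lborel) \<le> B * measure lborel (cball (0::'a) R)"
proof -
  have "norm (\<integral>x. f x \<partial>lborel) \<le> (\<integral>x. norm (f x) \<partial>lborel)"
    by (rule integral_norm_bound)
  also have "\<dots> \<le> (\<integral>x. B * indicator (cball (0::'a) R) x \<partial>lborel)"
  proof (rule integral_mono')
    show "integrable lborel (\<lambda>x. B * indicator (cball (0::'a) R) x)"
      using emeasure_compact_finite[of "cball (0::'a) R"] by (auto intro!: integrable_real_indicator)
    show "norm (f x) \<le> B * indicator (cball 0 R) x" for x
      using assms[of x] by (cases "x \<in> cball 0 R") auto
    show "0 \<le> B * indicator (cball (0::'a) R) x" for x :: 'a
      using order_trans[OF norm_ge_zero assms(1)[of x]] by simp
  qed
  also have "\<dots> = B * measure lborel (cball (0::'a) R)"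
    by simp
  finally show ?thesis .
qed

text \<open>The integral of \<open>f\<close> is invariant under translation by \<open>h\<close>.
  Integrating the uniform first-order expansion therefore shows that the integral of
  \<open>D\<close>, paired with \<open>h\<close>, is smaller than any fixed multiple of
  \<open>norm h\<close>; taking \<open>h\<close> parallel to that integral forces it to
  vanish.\<close>

lemma C1c_integral_gradient:
  assumes "C1c f D"
  shows "(\<integral>x. D x \<partial>lborel) = 0"
proof (rule ccontr)
  define w where "w = (\<integral>x. D x \<partial>lborel)"
  assume "(\<integral>x. D x \<partial>lborel) \<noteq> 0"
  then have w: "w \<noteq> 0" by (simp add: w_def)
  obtain R where R: "0 < R" "\<And>x. x \<notin> cball 0 R \<Longrightarrow> f x = 0" "\<And>x. x \<notin> cball 0 R \<Longrightarrow> D x = 0"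
    using C1cE[OF assms] by metis
  define V where "V = measure lborel (cball (0::'a) (R + 1))"
  have "0 \<le> V" by (simp add: V_def)
  \<comment> \<open>Small enough that the Taylor error, integrated over the ball of radius
    \<open>R + 1\<close>, stays below the first-order term. This ball contains the supports of
    \<open>f\<close> and of its translate, since \<open>norm h \<le> 1\<close>.\<close>
  define e where "e = norm w / (2 * (V + 1))"
  have e: "0 < e" "e * V < norm w"
    using w \<open>0 \<le> V\<close> by (auto simp: e_def divide_simps algebra_simps add_nonneg_pos)
  obtain d where d: "0 < d" "\<And>x h. norm h < d \<Longrightarrow> \<bar>f (x + h) - f x - D x \<bullet> h\<bar> \<le> e * norm h"
    using C1c_uniform_taylor[OF assms e(1)] by metis
  \<comment> \<open>Parallel to \<open>w\<close>, so that the inner product with \<open>w\<close> is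
    the full product of the norms.\<close>
  define h where "h = (min d 1 / (2 * norm w)) *\<^sub>R w"
  have h: "norm h < d" "norm h \<le> 1" "0 < norm h"
    using w d(1) by (auto simp: h_def)
  have hw: "w \<bullet> h = norm w * norm h"
    using w d(1) by (simp add: h_def dot_square_norm power2_eq_square)
  note int = C1c_integrable[OF assms] and meas = C1c_measurable[OF assms]
  have int_shift: "integrable lborel (\<lambda>x. f (x + h))" "(\<integral>x. f (x + h) \<partial>lborel) = (\<integral>x. f x \<partial>lborel)"
    using lborel_integrable_translate[OF int(1), of "- h"] lborel_integral_translate[OF meas(1), of "- h"]
    by simp_all
  have "norm (\<integral>x. f (x + h) - f x - D x \<bullet> h \<partial>lborel) \<le> (e * norm h) * V"
    unfolding V_def
  proof (rule abs_integral_le_of_bound)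
    show "norm (f (x + h) - f x - D x \<bullet> h) \<le> e * norm h" for x
      using d(2)[OF h(1), of x] by simp
    fix x :: 'a assume x: "x \<notin> cball 0 (R + 1)"
    have "norm x \<le> norm (x + h) + norm h"
      using norm_triangle_ineq4[of "x + h" h] by simp
    then show "f (x + h) - f x - D x \<bullet> h = 0"
      using x h R(2)[of "x + h"] R(2)[of x] R(3)[of x] by simp
  qed
  moreover have "(\<integral>x. f (x + h) - f x - D x \<bullet> h \<partial>lborel) = - (w \<bullet> h)"
    using int int_shift by (simp add: w_def)
  ultimately have "norm w * norm h \<le> e * V * norm h"
    using hw by (simp add: mult_ac)
  then show False
    using h(3) e(2) by simp
qed

lemma C1c_by_parts:
  assumes "C1c f D" "C1c g E"
  shows "(\<integral>x. f x *\<^sub>R E x \<partial>lborel) = - (\<integral>x. g x *\<^sub>R D x \<partial>lborel)"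
proof -
  have f: "C1 f D"
    using assms(1) by (simp add: C1c_def)
  obtain B where B: "\<And>x. \<bar>f x\<bar> \<le> B" "\<And>x. norm (D x) \<le> B"
    using C1c_bounded[OF assms(1)] by metis
  have "integrable lborel (\<lambda>x. f x *\<^sub>R E x)"
    using C1c_integrable[OF assms(2)] C1c_measurable[OF assms(1)] B
    by (intro integrable_bounded_scaleR[where B = B]) auto
  moreover have "integrable lborel (\<lambda>x. g x *\<^sub>R D x)"
    using C1c_integrable[OF assms(2)] C1c_measurable[OF assms(1)] B
    by (intro integrable_scaleR_bounded[where B = B]) auto
  ultimately show ?thesis
    using C1c_integral_gradient[OF C1c_mult[OF f assms(2)]]
    by (simp add: eq_neg_iff_add_eq_0)
qed

lemma conv_integrable:
  fixes f :: "'a::euclidean_space \<Rightarrow> 'b::euclidean_space"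
  assumes "C1c k D" "integrable lborel f"
  shows "integrable lborel (\<lambda>y. k (x - y) *\<^sub>R f y)"
proof -
  obtain B where B: "\<And>x. \<bar>k x\<bar> \<le> B"
    using C1c_bounded[OF assms(1)] by metis
  have [measurable]: "k \<in> borel_measurable borel"
    by (rule C1c_measurable[OF assms(1)])
  show ?thesis
    by (rule integrable_bounded_scaleR[where B = B]) (use B assms in auto)
qed

lemma conv_grad_integrable:
  fixes f :: "'a::euclidean_space \<Rightarrow> real"
  assumes "C1c k D" "integrable lborel f"
  shows "integrable lborel (\<lambda>y. f y *\<^sub>R D (x - y))"
proof -
  obtain B where B: "\<And>x. norm (D x) \<le> B"
    using C1c_bounded[OF assms(1)] by metis
  have [measurable]: "D \<in> borel_measurable borel"
    by (rule C1c_measurable[OF assms(1)])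
  show ?thesis
    by (rule integrable_scaleR_bounded[where B = B]) (use B assms in auto)
qed

text \<open>The derivative is put on the kernel, since \<open>f\<close> is merely integrable; the
  error of the uniform expansion of the kernel is integrated against
  \<open>\<bar>f y\<bar>\<close>.\<close>

lemma C1_conv:
  fixes f :: "'a::euclidean_space \<Rightarrow> real"
  assumes "C1c k D" "integrable lborel f"
  shows "C1 (conv k f) (\<lambda>x. \<integral>y. f y *\<^sub>R D (x - y) \<partial>lborel)"
proof -
  \<comment> \<open>The added 1 makes \<open>F\<close> a positive divisor even if \<open>f\<close>
    vanishes almost everywhere.\<close>
  define F where "F = (\<integral>y. \<bar>f y\<bar> \<partial>lborel) + 1"
  have F: "0 < F" "(\<integral>y. \<bar>f y\<bar> \<partial>lborel) \<le> F"
    by (auto simp: F_def intro: add_nonneg_pos)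
  note intk = conv_integrable[OF assms] and intD = conv_grad_integrable[OF assms]
  have intf: "integrable lborel (\<lambda>y. \<bar>f y\<bar>)"
    using assms(2) by (rule integrable_abs)
  have "(conv k f has_derivative (\<lambda>h. (\<integral>y. f y *\<^sub>R D (x - y) \<partial>lborel) \<bullet> h)) (at x)" for x
    unfolding has_derivative_at_alt
  proof (intro conjI allI impI)
    show "bounded_linear (\<lambda>h. (\<integral>y. f y *\<^sub>R D (x - y) \<partial>lborel) \<bullet> h)"
      by (rule bounded_linear_inner_right)
    fix e :: real assume "0 < e"
    then have "0 < e / F" using F(1) by simp
    then obtain d where d: "0 < d"
      "\<And>x h. norm h < d \<Longrightarrow> \<bar>k (x + h) - k x - D x \<bullet> h\<bar> \<le> (e / F) * norm h"
      using C1c_uniform_taylor[OF assms(1)] by metis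
    have "norm (conv k f z - conv k f x - (\<integral>y. f y *\<^sub>R D (x - y) \<partial>lborel) \<bullet> (z - x))
        \<le> e * norm (z - x)" if z: "norm (z - x) < d" for z
    proof -
      have "conv k f z - conv k f x - (\<integral>y. f y *\<^sub>R D (x - y) \<partial>lborel) \<bullet> (z - x) =
          (\<integral>y. k (z - y) *\<^sub>R f y - k (x - y) *\<^sub>R f y - (f y *\<^sub>R D (x - y)) \<bullet> (z - x) \<partial>lborel)"
      proof -
        have "(\<integral>y. f y *\<^sub>R D (x - y) \<partial>lborel) \<bullet> (z - x) = (\<integral>y. (f y *\<^sub>R D (x - y)) \<bullet> (z - x) \<partial>lborel)"
          by (rule integral_inner_left[symmetric]) (rule intD)
        moreover have "(\<integral>y. k (z - y) *\<^sub>R f y - k (x - y) *\<^sub>R f y \<partial>lborel) = conv k f z - conv k f x"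
          unfolding conv_def by (intro Bochner_Integration.integral_diff intk)
        moreover have "integrable lborel (\<lambda>y. k (z - y) *\<^sub>R f y - k (x - y) *\<^sub>R f y)"
          by (intro Bochner_Integration.integrable_diff intk)
        moreover have "integrable lborel (\<lambda>y. (f y *\<^sub>R D (x - y)) \<bullet> (z - x))"
          by (intro integrable_inner_left intD)
        ultimately show ?thesis
          by (simp only: Bochner_Integration.integral_diff)
      qed
      also have "norm \<dots> \<le> (\<integral>y. (e / F * norm (z - x)) * \<bar>f y\<bar> \<partial>lborel)"
      proof (rule Bochner_Integration.integral_norm_bound_integral)
        show "integrable lborel (\<lambda>y. (e / F * norm (z - x)) * \<bar>f y\<bar>)"
          using intf by simp
        show "integrable lborel (\<lambda>y. k (z - y) *\<^sub>R f y - k (x - y) *\<^sub>R f y - (f y *\<^sub>R D (x - y)) \<bullet> (z - x))"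
          by (intro Bochner_Integration.integrable_diff integrable_inner_left intk intD)
        fix y
        have "norm (k (z - y) *\<^sub>R f y - k (x - y) *\<^sub>R f y - (f y *\<^sub>R D (x - y)) \<bullet> (z - x))
            = \<bar>k ((x - y) + (z - x)) - k (x - y) - D (x - y) \<bullet> (z - x)\<bar> * \<bar>f y\<bar>"
            by (simp add: abs_mult[symmetric] right_diff_distrib mult.commute)
        also have "\<dots> \<le> (e / F * norm (z - x)) * \<bar>f y\<bar>"
          by (intro mult_right_mono d z) auto
        finally show "norm (k (z - y) *\<^sub>R f y - k (x - y) *\<^sub>R f y - (f y *\<^sub>R D (x - y)) \<bullet> (z - x))
            \<le> (e / F * norm (z - x)) * \<bar>f y\<bar>" .
      qed
      also have "\<dots> = e / F * norm (z - x) * (\<integral>y. \<bar>f y\<bar> \<partial>lborel)"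
        by simp
      also have "\<dots> \<le> e / F * norm (z - x) * F"
        using \<open>0 < e\<close> F by (intro mult_left_mono) auto
      finally show ?thesis
        using F(1) by simp
    qed
    then show "\<exists>d>0. \<forall>z. norm (z - x) < d \<longrightarrow>
        norm (conv k f z - conv k f x - (\<integral>y. f y *\<^sub>R D (x - y) \<partial>lborel) \<bullet> (z - x)) \<le> e * norm (z - x)"
      using d(1) by (intro exI[of _ d]) simp
  qed
  moreover have "continuous_on UNIV (\<lambda>x. \<integral>y. f y *\<^sub>R D (x - y) \<partial>lborel)"
    unfolding continuous_on_iff
  proof (intro ballI allI impI)
    fix x :: 'a and e :: real assume "0 < e"
    then have "0 < e / (2 * F)" using F(1) by simp
    then obtain d where d: "0 < d" "\<And>x y. dist y x < d \<Longrightarrow> dist (D y) (D x) < e / (2 * F)"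
      using C1c_uniformly_continuous[OF assms(1)] unfolding uniformly_continuous_on_def
      by (metis UNIV_I)
    have "dist (\<integral>y. f y *\<^sub>R D (z - y) \<partial>lborel) (\<integral>y. f y *\<^sub>R D (x - y) \<partial>lborel) < e" if z: "dist z x < d" for z
    proof -
      have "dist (\<integral>y. f y *\<^sub>R D (z - y) \<partial>lborel) (\<integral>y. f y *\<^sub>R D (x - y) \<partial>lborel)
          = norm (\<integral>y. f y *\<^sub>R D (z - y) - f y *\<^sub>R D (x - y) \<partial>lborel)"
        unfolding dist_norm by (subst Bochner_Integration.integral_diff[OF intD intD]) (rule refl)
      also have "\<dots> \<le> (\<integral>y. (e / (2 * F)) * \<bar>f y\<bar> \<partial>lborel)"
      proof (rule Bochner_Integration.integral_norm_bound_integral)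
        show "integrable lborel (\<lambda>y. (e / (2 * F)) * \<bar>f y\<bar>)"
          using intf by simp
        show "integrable lborel (\<lambda>y. f y *\<^sub>R D (z - y) - f y *\<^sub>R D (x - y))"
          by (intro Bochner_Integration.integrable_diff intD)
        fix y
        have "dist (z - y) (x - y) < d" using z by (simp add: dist_norm)
        then have "norm (D (z - y) - D (x - y)) \<le> e / (2 * F)"
          using d(2)[of "z - y" "x - y"] by (simp add: dist_norm)
        then have "norm (D (z - y) - D (x - y)) * \<bar>f y\<bar> \<le> e / (2 * F) * \<bar>f y\<bar>"
          by (rule mult_right_mono) simp
        then show "norm (f y *\<^sub>R D (z - y) - f y *\<^sub>R D (x - y)) \<le> e / (2 * F) * \<bar>f y\<bar>"
          by (simp only: scaleR_diff_right[symmetric] norm_scaleR mult.commute)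
      qed
      also have "\<dots> = e / (2 * F) * (\<integral>y. \<bar>f y\<bar> \<partial>lborel)"
        by simp
      also have "\<dots> \<le> e / (2 * F) * F"
        using \<open>0 < e\<close> F by (intro mult_left_mono) auto
      also have "\<dots> < e"
        using F(1) \<open>0 < e\<close> by simp
      finally show ?thesis .
    qed
    then show "\<exists>d>0. \<forall>z\<in>UNIV. dist z x < d \<longrightarrow>
        dist (\<integral>y. f y *\<^sub>R D (z - y) \<partial>lborel) (\<integral>y. f y *\<^sub>R D (x - y) \<partial>lborel) < e"
      using d(1) by (intro exI[of _ d]) simp
  qed
  ultimately show ?thesis
    by (simp add: C1_def)
qed

text \<open>A directional derivative of the convolution is the convolution with the corresponding
  derivative of the kernel, which is smooth with support in the same ball. The induction therefore
  generalises over the kernel.\<close>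

lemma Ck_conv:
  fixes f :: "'a::euclidean_space \<Rightarrow> real"
  assumes "\<And>j. Ck j k" "\<And>x. x \<notin> cball 0 R \<Longrightarrow> k x = 0" "integrable lborel f"
  shows "Ck j (conv k f)"
  using assms(1,2)
proof (induction j arbitrary: k)
  case 0
  have "C1c k (grad k)"
    by (rule C1cI[OF Ck_imp_C1 0(2)]) (rule 0(1))
  from C1_continuous[OF C1_conv[OF this assms(3)]] show ?case
    by simp
next
  case (Suc j)
  have k: "C1c k (grad k)"
    by (rule C1cI[OF Ck_imp_C1 Suc.prems(2)]) (rule Suc.prems(1))
  let ?G = "\<lambda>x. \<integral>y. f y *\<^sub>R grad k (x - y) \<partial>lborel"
  have G: "(conv k f has_derivative (\<lambda>h. ?G x \<bullet> h)) (at x)" for x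
    using C1_conv[OF k assms(3)] by (simp add: C1_def)
  have fd: "frechet_derivative k (at x) v = grad k x \<bullet> v" for x v
    using k frechet_derivative_at[of k "\<lambda>h. grad k x \<bullet> h" x] unfolding C1c_def C1_def by metis
  have "Ck j (\<lambda>x. frechet_derivative (conv k f) (at x) v)" for v
  proof -
    have "frechet_derivative (conv k f) (at x) v = conv (\<lambda>x. frechet_derivative k (at x) v) f x" for x
    proof -
      have "frechet_derivative (conv k f) (at x) v = ?G x \<bullet> v"
        using frechet_derivative_at[OF G, of x] by metis
      also have "\<dots> = (\<integral>y. (f y *\<^sub>R grad k (x - y)) \<bullet> v \<partial>lborel)"
        by (rule integral_inner_left[symmetric]) (rule conv_grad_integrable[OF k assms(3)])
      finally show ?thesis
        by (simp add: conv_def fd mult.commute)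
    qed
    moreover have "Ck j (conv (\<lambda>x. frechet_derivative k (at x) v) f)"
    proof (rule Suc.IH)
      show "Ck i (\<lambda>x. frechet_derivative k (at x) v)" for i
        using Suc.prems(1)[of "Suc i"] by simp
      show "frechet_derivative k (at x) v = 0" if "x \<notin> cball 0 R" for x
        using C1_zero_outside_closed[of k "grad k", OF _ closed_cball Suc.prems(2) that] k
        unfolding fd C1c_def by auto
    qed
    ultimately show ?thesis by presburger
  qed
  moreover have "conv k f differentiable (at x)" for x
    using G differentiable_def by blast
  ultimately show ?case by simp
qed

text \<open>The centre \<open>c\<close> may differ from 0: averaging against such a kernel looks at
  points near \<open>x - c\<close>, so it translates as well as smooths. Centre and radius are kept
  separate because the sum \<open>norm c + r\<close> measures the total reach.\<close>

definition kernel :: "('a::euclidean_space \<Rightarrow> real) \<Rightarrow> 'a \<Rightarrow> real \<Rightarrow> bool" where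
  "kernel \<rho> c r \<longleftrightarrow> (\<forall>j. Ck j \<rho>) \<and> (\<forall>x. 0 \<le> \<rho> x) \<and> (\<integral>x. \<rho> x \<partial>lborel) = 1 \<and>
    (\<forall>x. x \<notin> cball c r \<longrightarrow> \<rho> x = 0)"

lemma kernel_C1c: "kernel \<rho> c r \<Longrightarrow> C1c \<rho> (grad \<rho>)"
  unfolding kernel_def by (intro C1cI[of _ _ c r] Ck_imp_C1) auto

text \<open>One bump on the ball of radius \<open>r\<close> around \<open>c\<close> is rescaled.
  Centre and radius scale with \<delta>, the mass stays 1, and the L^1 norm of the gradient grows
  like \<open>1 / \<delta>\<close>, a growth that the oscillation estimates have to
  compensate.\<close>

lemma mollifier_exists:
  fixes c :: "'a::euclidean_space"
  assumes "0 < r"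
  obtains \<rho> :: "real \<Rightarrow> 'a \<Rightarrow> real" and C where "0 \<le> C"
    "\<And>\<delta>. 0 < \<delta> \<Longrightarrow> kernel (\<rho> \<delta>) (\<delta> *\<^sub>R c) (\<delta> * r)"
    "\<And>\<delta>. 0 < \<delta> \<Longrightarrow> (\<integral>x. norm (grad (\<rho> \<delta>) x) \<partial>lborel) \<le> C / \<delta>"
proof -
  define b where "b = (\<lambda>x::'a. flat 0 (r\<^sup>2 - (norm (x - c))\<^sup>2))"
  have b: "smooth_expr b"
    unfolding b_def by (rule smooth_expr_bump)
  have b0: "0 \<le> b x" for x
    by (simp add: b_def flat_nonneg)
  have bpos: "0 < b x \<longleftrightarrow> x \<in> ball c r" for x
  proof -
    have "0 < b x \<longleftrightarrow> (norm (x - c))\<^sup>2 < r\<^sup>2"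
      by (simp add: b_def flat_pos_iff)
    also have "\<dots> \<longleftrightarrow> norm (x - c) < r"
      using assms by (auto intro: power2_less_imp_less power_strict_mono)
    finally show ?thesis
      by (simp add: dist_norm norm_minus_commute)
  qed
  have bz: "b x = 0" if "x \<notin> cball c r" for x
    using bpos[of x] b0[of x] that by auto
  have bC: "C1c b (grad b)"
    by (rule C1cI[OF Ck_imp_C1[OF smooth_expr_Ck[OF b]] bz])
  note bi = C1c_integrable[OF bC] and bm = C1c_measurable[OF bC]
  define J where "J = (\<integral>x. b x \<partial>lborel)"
  have "J \<noteq> 0"
  proof
    assume "J = 0"
    then have "AE x in lborel. b x = 0"
      using integral_nonneg_eq_0_iff_AE[OF bi(1)] b0 by (simp add: J_def)
    then have "AE x in lborel. x \<notin> ball c r"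
      by eventually_elim (metis bpos less_irrefl)
    then have "ball c r \<in> null_sets lborel"
      by (simp add: AE_iff_null_sets)
    then have "measure lborel (ball c r) = 0"
      by (simp add: null_sets_def measure_def)
    then show False
      using content_ball_pos[OF assms, of c] by simp
  qed
  moreover have "0 \<le> J"
    unfolding J_def by (intro integral_nonneg_AE) (simp add: b0)
  ultimately have J: "0 < J" by simp
  define N where "N = DIM('a)"
  \<comment> \<open>\<open>J * \<delta> ^ N\<close> is the integral of the rescaled bump, by the
    change of variables.\<close>
  define \<rho> where "\<rho> = (\<lambda>\<delta> x. b ((1 / \<delta>) *\<^sub>R x) * (1 / (J * \<delta> ^ N)))"
  define C where "C = (\<integral>x. norm (grad b x) \<partial>lborel) / J"
  show ?thesis
  proof
    show "0 \<le> C"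
      using J unfolding C_def by (intro divide_nonneg_pos integral_nonneg_AE) auto
    fix \<delta> :: real assume \<delta>: "0 < \<delta>"
    show "kernel (\<rho> \<delta>) (\<delta> *\<^sub>R c) (\<delta> * r)"
      unfolding kernel_def
    proof (intro conjI allI impI)
      show "Ck j (\<rho> \<delta>)" for j
        unfolding \<rho>_def by (intro smooth_expr_Ck smooth_expr.intros smooth_expr_scaleR b)
      show "0 \<le> \<rho> \<delta> x" for x
        using b0 J \<delta> by (simp add: \<rho>_def)
      have "(\<integral>x. b (0 + (1 / \<delta>) *\<^sub>R x) \<partial>lborel) = J /\<^sub>R \<bar>1 / \<delta>\<bar> ^ N"
        unfolding J_def N_def by (rule lborel_integral_affine[OF bm(1)]) (use \<delta> in simp)
      then have "(\<integral>x. b ((1 / \<delta>) *\<^sub>R x) \<partial>lborel) = J * \<delta> ^ N"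
        using \<delta> by (simp add: power_divide)
      then show "(\<integral>x. \<rho> \<delta> x \<partial>lborel) = 1"
        using J \<delta> by (simp add: \<rho>_def)
      fix x assume x: "x \<notin> cball (\<delta> *\<^sub>R c) (\<delta> * r)"
      have "dist (\<delta> *\<^sub>R c) x = \<delta> * dist c ((1 / \<delta>) *\<^sub>R x)"
      proof -
        have "\<delta> *\<^sub>R c - x = \<delta> *\<^sub>R (c - (1 / \<delta>) *\<^sub>R x)"
          using \<delta> by (simp add: scaleR_diff_right)
        then show ?thesis
          using \<delta> by (simp add: dist_norm)
      qed
      then have "(1 / \<delta>) *\<^sub>R x \<notin> cball c r"
        using x \<delta> by simp
      then show "\<rho> \<delta> x = 0"
        by (simp add: \<rho>_def bz del: mem_cball)
    qed
    have g: "grad (\<rho> \<delta>) x = (1 / (J * \<delta> ^ N)) *\<^sub>R (1 / \<delta>) *\<^sub>R grad b ((1 / \<delta>) *\<^sub>R x)" for x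
    proof (rule has_derivative_imp_grad)
      have "(b has_derivative (\<lambda>h. grad b ((1 / \<delta>) *\<^sub>R x) \<bullet> h)) (at ((1 / \<delta>) *\<^sub>R x))"
        using bC by (simp add: C1c_def C1_def)
      then have "((\<lambda>x. b ((1 / \<delta>) *\<^sub>R x)) has_derivative
          (\<lambda>h. grad b ((1 / \<delta>) *\<^sub>R x) \<bullet> ((1 / \<delta>) *\<^sub>R h))) (at x)"
        by (rule has_derivative_compose[rotated]) (intro has_derivative_scaleR_right has_derivative_ident)
      then have "((\<lambda>x. b ((1 / \<delta>) *\<^sub>R x) * (1 / (J * \<delta> ^ N))) has_derivative
          (\<lambda>h. grad b ((1 / \<delta>) *\<^sub>R x) \<bullet> ((1 / \<delta>) *\<^sub>R h) * (1 / (J * \<delta> ^ N)))) (at x)"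
        by (rule has_derivative_mult_left)
      then show "(\<rho> \<delta> has_derivative
          (\<lambda>h. ((1 / (J * \<delta> ^ N)) *\<^sub>R (1 / \<delta>) *\<^sub>R grad b ((1 / \<delta>) *\<^sub>R x)) \<bullet> h)) (at x)"
        unfolding \<rho>_def by (simp add: mult_ac)
    qed
    have "(\<integral>x. norm (grad b (0 + (1 / \<delta>) *\<^sub>R x)) \<partial>lborel) =
        (\<integral>x. norm (grad b x) \<partial>lborel) /\<^sub>R \<bar>1 / \<delta>\<bar> ^ N"
      unfolding N_def by (rule lborel_integral_affine) (use \<delta> bm in auto)
    then have *: "(\<integral>x. norm (grad b ((1 / \<delta>) *\<^sub>R x)) \<partial>lborel) = C * J * \<delta> ^ N"
      using \<delta> J by (simp add: power_divide C_def)
    have "(\<integral>x. norm (grad (\<rho> \<delta>) x) \<partial>lborel) =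
        (\<integral>x. (1 / (J * \<delta> ^ N)) * (1 / \<delta>) * norm (grad b ((1 / \<delta>) *\<^sub>R x)) \<partial>lborel)"
      unfolding g using \<delta> J by (intro Bochner_Integration.integral_cong refl) (simp add: abs_mult)
    also have "\<dots> = (1 / (J * \<delta> ^ N)) * (1 / \<delta>) * (C * J * \<delta> ^ N)"
      by (simp only: integral_mult_right_zero *)
    also have "\<dots> = C / \<delta>"
      using J \<delta> by simp
    finally show "(\<integral>x. norm (grad (\<rho> \<delta>) x) \<partial>lborel) \<le> C / \<delta>"
      by simp
  qed
qed

text \<open>Young's inequality in L^1, by Fubini: for fixed \<open>y\<close> the integral of the
  translated kernel does not depend on \<open>y\<close>.\<close>

lemma conv_L1:
  fixes f :: "'a::euclidean_space \<Rightarrow> 'b::euclidean_space"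
  assumes k: "C1c k D" and f: "integrable lborel f"
  shows "integrable lborel (conv k f)"
    and "(\<integral>x. norm (conv k f x) \<partial>lborel) \<le> (\<integral>x. \<bar>k x\<bar> \<partial>lborel) * (\<integral>x. norm (f x) \<partial>lborel)"
proof -
  have [measurable]: "k \<in> borel_measurable borel" "f \<in> borel_measurable borel"
    using C1c_measurable[OF k] borel_measurable_integrable[OF f] by simp_all
  have ki: "integrable lborel (\<lambda>x. \<bar>k x\<bar>)"
    using C1c_integrable(1)[OF k] by (rule integrable_abs)
  have kshift: "(\<integral>x. \<bar>k (x - y)\<bar> \<partial>lborel) = (\<integral>x. \<bar>k x\<bar> \<partial>lborel)" for y
    by (rule lborel_integral_translate) measurable
  have inner: "(\<integral>x. norm (k (x - y) *\<^sub>R f y) \<partial>lborel) = (\<integral>x. \<bar>k x\<bar> \<partial>lborel) * norm (f y)" for y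
    by (simp add: kshift)
  have fub: "integrable (lborel \<Otimes>\<^sub>M lborel) (\<lambda>(y, x). k (x - y) *\<^sub>R f y)"
  proof (rule lborel_pair.Fubini_integrable)
    show "(\<lambda>(y, x). k (x - y) *\<^sub>R f y) \<in> borel_measurable (lborel \<Otimes>\<^sub>M lborel)"
      by measurable
    show "integrable lborel (\<lambda>y. \<integral>x. norm (case (y, x) of (y, x) \<Rightarrow> k (x - y) *\<^sub>R f y) \<partial>lborel)"
      using f by (simp only: prod.case inner) (intro integrable_mult_right integrable_norm)
    have "integrable lborel (\<lambda>x. k (x - y) *\<^sub>R f y)" for y
      by (intro integrable_scaleR_left lborel_integrable_translate C1c_integrable(1)[OF k])
    then show "AE y in lborel. integrable lborel (\<lambda>x. case (y, x) of (y, x) \<Rightarrow> k (x - y) *\<^sub>R f y)"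
      by simp
  qed
  have "integrable lborel (\<lambda>x. \<integral>y. k (x - y) *\<^sub>R f y \<partial>lborel)"
    by (rule lborel_pair.integrable_snd[OF fub])
  then show int: "integrable lborel (conv k f)"
    unfolding conv_def .
  have fubn: "integrable (lborel \<Otimes>\<^sub>M lborel) (\<lambda>(y, x). norm (k (x - y) *\<^sub>R f y))"
    using integrable_norm[OF fub] by (simp add: case_prod_beta')
  have "(\<integral>x. norm (conv k f x) \<partial>lborel) \<le> (\<integral>x. (\<integral>y. norm (k (x - y) *\<^sub>R f y) \<partial>lborel) \<partial>lborel)"
    unfolding conv_def
    by (intro integral_mono integrable_norm int[unfolded conv_def] lborel_pair.integrable_snd[OF fubn]
        integral_norm_bound)
  also have "\<dots> = (\<integral>y. (\<integral>x. norm (k (x - y) *\<^sub>R f y) \<partial>lborel) \<partial>lborel)"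
    by (rule lborel_pair.Fubini_integral[OF fubn])
  also have "\<dots> = (\<integral>x. \<bar>k x\<bar> \<partial>lborel) * (\<integral>x. norm (f x) \<partial>lborel)"
    by (simp only: inner integral_mult_right_zero)
  finally show "(\<integral>x. norm (conv k f x) \<partial>lborel) \<le> (\<integral>x. \<bar>k x\<bar> \<partial>lborel) * (\<integral>x. norm (f x) \<partial>lborel)" .
qed

section \<open>Density of continuous functions and L^1 convergence of mollifications\<close>

lemma AE_lborel_of_negligible:
  assumes "negligible N"
  shows "AE x in lborel. x \<notin> N"
proof -
  have "N \<in> null_sets lebesgue"
    using assms by (simp add: negligible_iff_null_sets)
  then have "AE x in lebesgue. x \<notin> N"
    by (rule AE_not_in)
  then show ?thesis
    by (simp add: AE_completion_iff)
qed

lemma norm_clamp_le: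
  fixes v :: "'b::real_normed_vector"
  assumes "0 < n"
  shows "norm ((n / max n (norm v)) *\<^sub>R v) \<le> n" "norm ((n / max n (norm v)) *\<^sub>R v) \<le> norm v"
  using assms by (auto simp: max_def divide_simps mult_left_mono mult_right_mono)

text \<open>Truncation in the domain and in the range gives a bounded function of bounded support. A
  measurable function is an almost everywhere limit of continuous ones, and the same truncation
  applied to these supplies the dominating function.\<close>

lemma L1_dense_continuous:
  fixes f :: "'a::euclidean_space \<Rightarrow> 'b::euclidean_space"
  assumes f: "integrable lborel f" and "0 < e"
  obtains g R where "continuous_on UNIV g" "\<And>x. x \<notin> cball 0 R \<Longrightarrow> g x = 0"
    "integrable lborel g" "(\<integral>x. norm (g x - f x) \<partial>lborel) < e"
proof -
  have [measurable]: "f \<in> borel_measurable borel"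
    using borel_measurable_integrable[OF f] by simp
  \<comment> \<open>\<open>cut n\<close> is 1 on the ball of radius \<open>n\<close> and 0 outside
    the ball of radius \<open>n + 1\<close>; \<open>cl n\<close> is the radial retraction onto the
    ball of radius \<open>n + 1\<close>. Both are continuous, so continuous approximants remain
    continuous.\<close>
  define cut where "cut = (\<lambda>(n::nat) (x::'a). min 1 (max 0 (real n + 1 - norm x)))"
  define cl where "cl = (\<lambda>(n::nat) (v::'b). ((real n + 1) / max (real n + 1) (norm v)) *\<^sub>R v)"
  have cut: "0 \<le> cut n x" "cut n x \<le> 1" "continuous_on UNIV (cut n)" for n x
    by (auto simp: cut_def intro!: continuous_intros)
  have cut0: "cut n x = 0" if "x \<notin> cball 0 (real n + 1)" for n x
    using that by (simp add: cut_def)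
  have cl: "norm (cl n v) \<le> real n + 1" "norm (cl n v) \<le> norm v" "continuous_on UNIV (cl n)" for n v
    using norm_clamp_le[of "real n + 1" v] by (auto simp: cl_def intro!: continuous_intros)
  have [measurable]: "cut n \<in> borel_measurable borel" "cl n \<in> borel_measurable borel" for n
    using cut(3) cl(3) by (auto intro: borel_measurable_continuous_onI)
  have scl: "norm (cut n x *\<^sub>R v) \<le> norm v" for n x and v :: 'b
    using mult_right_mono[OF cut(2)[of n x] norm_ge_zero[of v]] cut(1)[of n x] by simp
  define F where "F = (\<lambda>n x. cut n x *\<^sub>R cl n (f x))"
  have Fm[measurable]: "F n \<in> borel_measurable borel" for n
    unfolding F_def by measurable
  have Fle: "norm (F n x) \<le> norm (f x)" for n x
    unfolding F_def by (rule order_trans[OF scl cl(2)])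
  have "(\<lambda>n. \<integral>x. norm (F n x - f x) \<partial>lborel) \<longlonglongrightarrow> (\<integral>x. 0 \<partial>(lborel :: 'a measure))"
  proof (rule integral_dominated_convergence)
    show "integrable lborel (\<lambda>x. 2 * norm (f x))"
      using f by simp
    have "F n x = f x" if "nat \<lceil>max (norm x) (norm (f x))\<rceil> \<le> n" for n x
    proof -
      have n: "norm x \<le> real n" "norm (f x) \<le> real n"
        using that by linarith+
      then have "cut n x = 1" "max (real n + 1) (norm (f x)) = real n + 1"
        by (auto simp: cut_def)
      then show ?thesis
        by (simp add: F_def cl_def)
    qed
    then have "eventually (\<lambda>n. norm (F n x - f x) = 0) sequentially" for x
      by (intro eventually_sequentiallyI[of "nat \<lceil>max (norm x) (norm (f x))\<rceil>"]) simp
    then show "AE x in lborel. (\<lambda>n. norm (F n x - f x)) \<longlonglongrightarrow> 0"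
      by (auto intro!: AE_I2 tendsto_eventually)
    show "AE x in lborel. norm (norm (F n x - f x)) \<le> 2 * norm (f x)" for n
    proof (rule AE_I2)
      fix x
      show "norm (norm (F n x - f x)) \<le> 2 * norm (f x)"
        using norm_triangle_ineq4[of "F n x" "f x"] Fle[of n x] by simp
    qed
  qed measurable
  then have "eventually (\<lambda>n. (\<integral>x. norm (F n x - f x) \<partial>lborel) < e / 2) sequentially"
    using \<open>0 < e\<close> by (intro order_tendstoD(2)) auto
  then obtain n where n: "(\<integral>x. norm (F n x - f x) \<partial>lborel) < e / 2"
    by (auto simp: eventually_sequentially)
  have Fi: "integrable lborel (F n)"
    by (rule Bochner_Integration.integrable_bound[OF integrable_norm[OF f]]) (use Fle in auto)
  have "f \<in> borel_measurable lebesgue"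
    by (rule measurable_completion) simp
  then have "f measurable_on UNIV"
    by (simp add: measurable_on_iff_borel_measurable)
  then obtain N g where N: "negligible N" and g: "\<And>j. continuous_on UNIV (g j)"
    and lim: "\<And>x. x \<notin> N \<Longrightarrow> (\<lambda>j. g j x) \<longlonglongrightarrow> f x"
    unfolding measurable_on_def by auto
  define H where "H = (\<lambda>j x. cut n x *\<^sub>R cl n (g j x))"
  have Hc: "continuous_on UNIV (H j)" for j
    unfolding H_def
    by (intro continuous_intros cut continuous_on_compose2[OF cl(3) g]) auto
  have H0: "H j x = 0" if "x \<notin> cball 0 (real n + 1)" for j x
    using cut0[OF that] by (simp add: H_def)
  have F0: "F n x = 0" if "x \<notin> cball 0 (real n + 1)" for x
    using cut0[OF that] by (simp add: F_def)
  have Hi: "integrable lborel (H j)" for j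
    by (rule integrable_continuous_compact_support[OF Hc H0])
  have [measurable]: "H j \<in> borel_measurable borel" for j
    using borel_measurable_integrable[OF Hi] by simp
  have "(\<lambda>j. \<integral>x. norm (H j x - F n x) \<partial>lborel) \<longlonglongrightarrow> (\<integral>x. 0 \<partial>(lborel :: 'a measure))"
  proof (rule integral_dominated_convergence)
    show "integrable lborel (\<lambda>x. 2 * (real n + 1) * indicator (cball (0::'a) (real n + 1)) x)"
      using emeasure_compact_finite[of "cball (0::'a) (real n + 1)"] by (auto intro!: integrable_real_indicator)
    show "AE x in lborel. (\<lambda>j. norm (H j x - F n x)) \<longlonglongrightarrow> 0"
      using AE_lborel_of_negligible[OF N]
    proof eventually_elim
      fix x assume "x \<notin> N"
      then have "(\<lambda>j. cl n (g j x)) \<longlonglongrightarrow> cl n (f x)"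
        using lim cl(3) by (auto intro!: continuous_on_tendsto_compose[of UNIV "cl n"])
      then have "(\<lambda>j. H j x) \<longlonglongrightarrow> F n x"
        unfolding H_def F_def by (intro tendsto_intros)
      then show "(\<lambda>j. norm (H j x - F n x)) \<longlonglongrightarrow> 0"
        using tendsto_norm_zero LIM_zero by blast
    qed
    show "AE x in lborel. norm (norm (H j x - F n x)) \<le> 2 * (real n + 1) * indicator (cball 0 (real n + 1)) x" for j
    proof (rule AE_I2)
      fix x
      have "norm (H j x) \<le> real n + 1" "norm (F n x) \<le> real n + 1"
        unfolding H_def F_def by (rule order_trans[OF scl cl(1)])+
      then show "norm (norm (H j x - F n x)) \<le> 2 * (real n + 1) * indicator (cball 0 (real n + 1)) x"
        using norm_triangle_ineq4[of "H j x" "F n x"] H0[of x j] F0[of x]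
        by (cases "x \<in> cball 0 (real n + 1)") auto
    qed
  qed measurable
  then have "eventually (\<lambda>j. (\<integral>x. norm (H j x - F n x) \<partial>lborel) < e / 2) sequentially"
    using \<open>0 < e\<close> by (intro order_tendstoD(2)) auto
  then obtain j where j: "(\<integral>x. norm (H j x - F n x) \<partial>lborel) < e / 2"
    by (auto simp: eventually_sequentially)
  have "(\<integral>x. norm (H j x - f x) \<partial>lborel) \<le> (\<integral>x. norm (H j x - F n x) + norm (F n x - f x) \<partial>lborel)"
  proof (rule integral_mono)
    show "norm (H j x - f x) \<le> norm (H j x - F n x) + norm (F n x - f x)" for x
      using norm_triangle_ineq[of "H j x - F n x" "F n x - f x"] by simp
  qed (use Hi Fi f in auto)
  also have "\<dots> = (\<integral>x. norm (H j x - F n x) \<partial>lborel) + (\<integral>x. norm (F n x - f x) \<partial>lborel)"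
    using Hi Fi f by (intro Bochner_Integration.integral_add integrable_norm Bochner_Integration.integrable_diff)
  also have "\<dots> < e"
    using n j by simp
  finally show ?thesis
    using that[OF Hc H0 Hi] by metis
qed

section \<open>Sobolev functions on the whole space\<close>

lemma integral_norm_add_le:
  fixes f g :: "'a::euclidean_space \<Rightarrow> 'b::euclidean_space"
  assumes "integrable M f" "integrable M g"
  shows "(\<integral>x. norm (f x + g x) \<partial>M) \<le> (\<integral>x. norm (f x) \<partial>M) + (\<integral>x. norm (g x) \<partial>M)"
proof -
  have "(\<integral>x. norm (f x + g x) \<partial>M) \<le> (\<integral>x. norm (f x) + norm (g x) \<partial>M)"
    using assms by (intro integral_mono) (auto intro: norm_triangle_ineq)
  also have "\<dots> = (\<integral>x. norm (f x) \<partial>M) + (\<integral>x. norm (g x) \<partial>M)"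
    using assms by (intro Bochner_Integration.integral_add integrable_norm)
  finally show ?thesis .
qed

lemma conv_diff:
  fixes f g :: "'a::euclidean_space \<Rightarrow> 'b::euclidean_space"
  assumes "C1c k D" "integrable lborel f" "integrable lborel g"
  shows "conv k (\<lambda>x. f x - g x) x = conv k f x - conv k g x"
  unfolding conv_def scaleR_diff_right
  by (intro Bochner_Integration.integral_diff conv_integrable[OF assms(1)] assms)

lemma kernel_integral_reflect:
  assumes "kernel \<rho> c r"
  shows "(\<integral>y. \<rho> (x - y) \<partial>lborel) = 1" "integrable lborel (\<lambda>y. \<rho> (x - y))"
  using assms C1c_integrable[OF kernel_C1c[OF assms]] C1c_measurable[OF kernel_C1c[OF assms]]
  by (auto simp: kernel_def lborel_integral_reflect lborel_integrable_reflect)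

lemma kernel_support:
  assumes "kernel \<rho> c r" "\<rho> x \<noteq> 0"
  shows "norm x \<le> norm c + r"
proof -
  have "norm (c - x) \<le> r"
    using assms unfolding kernel_def by (auto simp: dist_norm)
  then show ?thesis
    using norm_triangle_sub[of x c] by (simp add: norm_minus_commute)
qed

text \<open>The threshold \<open>d\<close> depends on \<open>f\<close> and \<open>e\<close> only and
  not on the shape of the kernel, so shifted kernels are covered as well. A continuous function of
  compact support is treated through its modulus of continuity, and averaging contracts the L^1
  norm, which transfers the result to \<open>f\<close>.\<close>

lemma conv_approximates:
  fixes f :: "'a::euclidean_space \<Rightarrow> 'b::euclidean_space"
  assumes f: "integrable lborel f" and e: "0 < e"
  obtains d where "0 < d"
    "\<And>\<rho> c r. kernel \<rho> c r \<Longrightarrow> norm c + r \<le> d \<Longrightarrow> (\<integral>x. norm (conv \<rho> f x - f x) \<partial>lborel) < e"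
proof -
  \<comment> \<open>Three errors of at most \<open>e / 4\<close> each keep the final inequality
    strict.\<close>
  obtain g R where g: "continuous_on UNIV g" "\<And>x. x \<notin> cball 0 R \<Longrightarrow> g x = 0" "integrable lborel g"
    and gf: "(\<integral>x. norm (g x - f x) \<partial>lborel) < e / 4"
    using L1_dense_continuous[OF f, of "e / 4"] e by (metis divide_pos_pos zero_less_numeral)
  define V where "V = measure lborel (cball (0::'a) (R + 1)) + 1"
  have V: "0 < V" "measure lborel (cball (0::'a) (R + 1)) \<le> V"
    by (auto simp: V_def add_nonneg_pos)
  define e' where "e' = e / (4 * V)"
  have e': "0 < e'" using e V by (simp add: e'_def)
  obtain d where d: "0 < d" "\<And>x y. dist y x < d \<Longrightarrow> dist (g y) (g x) < e'"
    using uniformly_continuous_compact_support[OF g(1,2)] e' unfolding uniformly_continuous_on_def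
    by (metis UNIV_I)
  show ?thesis
  proof (rule that[of "min d 1 / 2"])
    show "0 < min d 1 / 2" using d by simp
    fix \<rho> :: "'a \<Rightarrow> real" and c r
    assume k: "kernel \<rho> c r" and cr: "norm c + r \<le> min d 1 / 2"
    note C = kernel_C1c[OF k]
    have \<rho>0: "0 \<le> \<rho> x" for x using k by (simp add: kernel_def)
    have small: "norm (x - y) < d" "norm (x - y) < 1" if "\<rho> (x - y) \<noteq> 0" for x y
      using kernel_support[OF k that] cr d(1) by auto
    note gc = conv_integrable[OF C g(3)]
    have cg: "conv \<rho> g x - g x = (\<integral>y. \<rho> (x - y) *\<^sub>R (g y - g x) \<partial>lborel)" for x
    proof -
      have "(\<integral>y. \<rho> (x - y) *\<^sub>R (g y - g x) \<partial>lborel)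
          = (\<integral>y. \<rho> (x - y) *\<^sub>R g y \<partial>lborel) - (\<integral>y. \<rho> (x - y) *\<^sub>R g x \<partial>lborel)"
        unfolding scaleR_diff_right
        by (intro Bochner_Integration.integral_diff gc integrable_scaleR_left kernel_integral_reflect(2)[OF k])
      also have "(\<integral>y. \<rho> (x - y) *\<^sub>R g x \<partial>lborel) = g x"
        using kernel_integral_reflect[OF k] by simp
      finally show ?thesis
        by (simp add: conv_def)
    qed
    have "norm (\<integral>x. norm (conv \<rho> g x - g x) \<partial>lborel) \<le> e' * measure lborel (cball (0::'a) (R + 1))"
    proof (rule abs_integral_le_of_bound)
      fix x
      have "norm (conv \<rho> g x - g x) \<le> (\<integral>y. \<rho> (x - y) * e' \<partial>lborel)"
        unfolding cg
      proof (rule Bochner_Integration.integral_norm_bound_integral)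
        show "integrable lborel (\<lambda>y. \<rho> (x - y) *\<^sub>R (g y - g x))"
          unfolding scaleR_diff_right
          by (intro Bochner_Integration.integrable_diff gc integrable_scaleR_left kernel_integral_reflect(2)[OF k])
        show "integrable lborel (\<lambda>y. \<rho> (x - y) * e')"
          by (intro integrable_mult_left kernel_integral_reflect(2)[OF k])
        fix y
        have "\<rho> (x - y) * norm (g y - g x) \<le> \<rho> (x - y) * e'"
        proof (cases "\<rho> (x - y) = 0")
          case False
          then have "norm (g y - g x) \<le> e'"
            using d(2)[of y x] small(1) by (simp add: dist_norm norm_minus_commute)
          then show ?thesis
            by (intro mult_left_mono \<rho>0)
        qed simp
        then show "norm (\<rho> (x - y) *\<^sub>R (g y - g x)) \<le> \<rho> (x - y) * e'"
          using \<rho>0 by simp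
      qed
      also have "\<dots> = e'"
        using kernel_integral_reflect[OF k] by simp
      finally show "norm (norm (conv \<rho> g x - g x)) \<le> e'"
        by simp
    next
      fix x :: 'a assume x: "x \<notin> cball 0 (R + 1)"
      have "\<rho> (x - y) *\<^sub>R g y = 0" for y
      proof (cases "\<rho> (x - y) = 0")
        case False
        then have "y \<notin> cball 0 R"
          using small(2)[of x y] x norm_triangle_sub[of x y] by auto
        then show ?thesis by (simp add: g(2) del: mem_cball)
      qed simp
      moreover have "g x = 0"
        using g(2) x by auto
      ultimately show "norm (conv \<rho> g x - g x) = 0"
        unfolding conv_def by (simp only:) simp
    qed
    also have "\<dots> \<le> e' * V"
      using V e' by (intro mult_left_mono) auto
    also have "\<dots> = e / 4"
      using V by (simp add: e'_def)
    finally have 1: "(\<integral>x. norm (conv \<rho> g x - g x) \<partial>lborel) \<le> e / 4"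
      by simp
    have gf': "(\<integral>x. norm (f x - g x) \<partial>lborel) < e / 4"
      using gf by (simp add: norm_minus_commute)
    have fg: "integrable lborel (\<lambda>x. f x - g x)"
      using f g(3) by simp
    have 2: "(\<integral>x. norm (conv \<rho> (\<lambda>x. f x - g x) x) \<partial>lborel) \<le> e / 4"
    proof -
      have "(\<integral>x. \<bar>\<rho> x\<bar> \<partial>lborel) = 1"
        using k by (simp add: kernel_def)
      then show ?thesis
        using conv_L1(2)[OF C fg] gf' by simp
    qed
    note i = conv_L1(1)[OF C fg] conv_L1(1)[OF C g(3)]
    have "(\<integral>x. norm (conv \<rho> f x - f x) \<partial>lborel) =
        (\<integral>x. norm (conv \<rho> (\<lambda>x. f x - g x) x + ((conv \<rho> g x - g x) + (g x - f x))) \<partial>lborel)"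
      by (simp add: conv_diff[OF C f g(3)])
    also have "\<dots> \<le> (\<integral>x. norm (conv \<rho> (\<lambda>x. f x - g x) x) \<partial>lborel) +
        (\<integral>x. norm ((conv \<rho> g x - g x) + (g x - f x)) \<partial>lborel)"
      using i f g(3) by (intro integral_norm_add_le) auto
    also have "\<dots> \<le> (\<integral>x. norm (conv \<rho> (\<lambda>x. f x - g x) x) \<partial>lborel) +
        ((\<integral>x. norm (conv \<rho> g x - g x) \<partial>lborel) + (\<integral>x. norm (g x - f x) \<partial>lborel))"
      using i f g(3) by (intro add_left_mono integral_norm_add_le) auto
    also have "\<dots> < e"
      using 1 2 gf e by simp
    finally show "(\<integral>x. norm (conv \<rho> f x - f x) \<partial>lborel) < e" .
  qed
qed

text \<open>\<open>W\<^sup>1\<^sup>,\<^sup>1\<close> of the whole space, as the closure of the continuously differentiable functions with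
  compact support; \<open>G\<close> is the gradient of \<open>u\<close>.\<close>

definition sob :: "('a::euclidean_space \<Rightarrow> real) \<Rightarrow> ('a \<Rightarrow> 'a) \<Rightarrow> bool" where
  "sob u G \<longleftrightarrow> integrable lborel u \<and> integrable lborel G \<and>
    (\<forall>e>0. \<exists>\<psi> D. C1c \<psi> D \<and> (\<integral>x. norm (\<psi> x - u x) \<partial>lborel) < e \<and> (\<integral>x. norm (D x - G x) \<partial>lborel) < e)"

lemma sob_integrable:
  assumes "sob u G"
  shows "integrable lborel u" "integrable lborel G"
    "u \<in> borel_measurable borel" "G \<in> borel_measurable borel"
  using assms borel_measurable_integrable[of lborel u] borel_measurable_integrable[of lborel G]
  by (auto simp: sob_def)

lemma sobE:
  assumes "sob u G" "0 < e"
  obtains \<psi> D where "C1c \<psi> D" "(\<integral>x. norm (\<psi> x - u x) \<partial>lborel) < e" "(\<integral>x. norm (D x - G x) \<partial>lborel) < e"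
  using assms unfolding sob_def by metis

lemma integral_norm_scaleR_le:
  fixes f :: "'a \<Rightarrow> 'b::euclidean_space"
  assumes "integrable M f" "k \<in> borel_measurable M" "\<And>x. \<bar>k x\<bar> \<le> B"
  shows "(\<integral>x. norm (k x *\<^sub>R f x) \<partial>M) \<le> B * (\<integral>x. norm (f x) \<partial>M)"
proof -
  have "(\<integral>x. norm (k x *\<^sub>R f x) \<partial>M) \<le> (\<integral>x. B * norm (f x) \<partial>M)"
    using assms integrable_bounded_scaleR[OF assms]
    by (intro integral_mono integrable_norm integrable_mult_right) (auto intro: mult_right_mono)
  then show ?thesis by simp
qed

lemma integral_scaleR_norm_le:
  fixes f :: "'a \<Rightarrow> 'b::euclidean_space"
  assumes "integrable M k" "f \<in> borel_measurable M" "\<And>x. norm (f x) \<le> B"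
  shows "(\<integral>x. norm (k x *\<^sub>R f x) \<partial>M) \<le> B * (\<integral>x. norm (k x) \<partial>M)"
proof -
  have "(\<integral>x. norm (k x *\<^sub>R f x) \<partial>M) \<le> (\<integral>x. norm (k x) * B \<partial>M)"
    using assms integrable_scaleR_bounded[OF assms]
    by (intro integral_mono integrable_norm integrable_mult_left) (auto intro: mult_left_mono)
  then show ?thesis by (simp add: mult.commute)
qed

text \<open>The identity for \<open>C1c\<close> functions survives the passage to the limit because
  \<eta> and \<open>E\<close> are bounded.\<close>

lemma sob_by_parts:
  assumes u: "sob u G" and \<eta>: "C1c \<eta> E"
  shows "(\<integral>x. u x *\<^sub>R E x \<partial>lborel) = - (\<integral>x. \<eta> x *\<^sub>R G x \<partial>lborel)"
proof -
  obtain B where B: "0 < B" "\<And>x. \<bar>\<eta> x\<bar> \<le> B" "\<And>x. norm (E x) \<le> B"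
    using C1c_bounded[OF \<eta>] by metis
  note m = C1c_measurable[OF \<eta>]
  define S where "S = (\<integral>x. u x *\<^sub>R E x \<partial>lborel) + (\<integral>x. \<eta> x *\<^sub>R G x \<partial>lborel)"
  have "norm S \<le> e" if "0 < e" for e
  proof -
    have "0 < e / (2 * B)" using that B(1) by simp
    then obtain \<psi> D where \<psi>: "C1c \<psi> D" "(\<integral>x. norm (\<psi> x - u x) \<partial>lborel) < e / (2 * B)"
      "(\<integral>x. norm (D x - G x) \<partial>lborel) < e / (2 * B)"
      using sobE[OF u] by metis
    note i = C1c_integrable[OF \<psi>(1)] sob_integrable[OF u]
    have d: "integrable lborel (\<lambda>x. \<psi> x - u x)" "integrable lborel (\<lambda>x. D x - G x)"
      using i by auto
    have i1: "integrable lborel (\<lambda>x. \<psi> x *\<^sub>R E x)" "integrable lborel (\<lambda>x. u x *\<^sub>R E x)"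
      by (rule integrable_scaleR_bounded[where B = B]; use i m B in simp)+
    have i2: "integrable lborel (\<lambda>x. \<eta> x *\<^sub>R D x)" "integrable lborel (\<lambda>x. \<eta> x *\<^sub>R G x)"
      by (rule integrable_bounded_scaleR[where B = B]; use i m B in simp)+
    have "- S = (\<integral>x. (\<psi> x - u x) *\<^sub>R E x \<partial>lborel) + (\<integral>x. \<eta> x *\<^sub>R (D x - G x) \<partial>lborel)"
      using C1c_by_parts[OF \<psi>(1) \<eta>] i1 i2 by (simp add: S_def scaleR_diff_left scaleR_diff_right)
    also have "norm \<dots> \<le> (\<integral>x. norm ((\<psi> x - u x) *\<^sub>R E x) \<partial>lborel) + (\<integral>x. norm (\<eta> x *\<^sub>R (D x - G x)) \<partial>lborel)"
      by (rule norm_triangle_le) (intro add_mono integral_norm_bound)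
    also have "\<dots> \<le> B * (\<integral>x. norm (\<psi> x - u x) \<partial>lborel) + B * (\<integral>x. norm (D x - G x) \<partial>lborel)"
      by (intro add_mono integral_scaleR_norm_le integral_norm_scaleR_le d) (use m B in auto)
    also have "\<dots> \<le> B * (e / (2 * B)) + B * (e / (2 * B))"
      using \<psi> B(1) by (intro add_mono mult_left_mono) auto
    also have "\<dots> = e" using B(1) by simp
    finally show ?thesis by simp
  qed
  then have "norm S \<le> 0"
    by (rule field_le_epsilon[of _ 0, simplified])
  then show ?thesis
    by (simp add: S_def eq_neg_iff_add_eq_0)
qed

lemma C1c_reflect:
  fixes k :: "'a::euclidean_space \<Rightarrow> real"
  assumes "C1c k D"
  shows "C1c (\<lambda>y. k (x - y)) (\<lambda>y. - D (x - y))"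
proof -
  have D: "continuous_on UNIV D" and k: "\<And>x. (k has_derivative (\<lambda>h. D x \<bullet> h)) (at x)"
    using assms by (auto simp: C1c_def C1_def)
  obtain R where R: "\<And>z. z \<notin> cball 0 R \<Longrightarrow> k z = 0"
    using C1cE[OF assms] by metis
  have "((\<lambda>y. k (x - y)) has_derivative (\<lambda>h. - D (x - y) \<bullet> h)) (at y)" for y
  proof -
    have "((\<lambda>y. x - y) has_derivative (\<lambda>h. - h)) (at y)"
      by (auto intro!: derivative_eq_intros)
    from has_derivative_compose[OF this k[of "x - y"]] show ?thesis
      by simp
  qed
  moreover have "continuous_on UNIV (\<lambda>y. - D (x - y))"
    by (intro continuous_intros continuous_on_compose2[OF D]) auto
  ultimately have "C1 (\<lambda>y. k (x - y)) (\<lambda>y. - D (x - y))"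
    by (simp add: C1_def)
  moreover have "k (x - y) = 0" if "y \<notin> cball x R" for y
    using that by (intro R) (simp add: dist_norm norm_minus_commute)
  ultimately show ?thesis
    by (rule C1cI)
qed

text \<open>Integration by parts against the reflected kernel: the minus sign of the formula and
  that of the reflection cancel. Mollification therefore commutes with taking the gradient.\<close>

lemma sob_conv_gradient:
  assumes "sob u G" "C1c k E"
  shows "(\<integral>y. u y *\<^sub>R E (x - y) \<partial>lborel) = conv k G x"
  using sob_by_parts[OF assms(1) C1c_reflect[OF assms(2), of x]] by (simp add: conv_def)

lemma C1_conv_sob:
  assumes "sob u G" "C1c k E"
  shows "C1 (conv k u) (conv k G)"
  using C1_conv[OF assms(2) sob_integrable(1)[OF assms(1)]] sob_conv_gradient[OF assms] by simp

lemma sob_mult: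
  assumes u: "sob u G" and \<theta>: "C1c \<theta> E"
  shows "sob (\<lambda>x. \<theta> x * u x) (\<lambda>x. \<theta> x *\<^sub>R G x + u x *\<^sub>R E x)"
  unfolding sob_def
proof (intro conjI allI impI)
  obtain B where B: "0 < B" "\<And>x. \<bar>\<theta> x\<bar> \<le> B" "\<And>x. norm (E x) \<le> B"
    using C1c_bounded[OF \<theta>] by metis
  note m = C1c_measurable[OF \<theta>] and iu = sob_integrable[OF u]
  have i\<theta>: "integrable lborel (\<lambda>x. \<theta> x *\<^sub>R f x)" if "integrable lborel f" for f :: "'a \<Rightarrow> 'c::euclidean_space"
    by (rule integrable_bounded_scaleR[where B = B]; use that m B in simp)
  have iE: "integrable lborel (\<lambda>x. f x *\<^sub>R E x)" if "integrable lborel f" for f :: "'a \<Rightarrow> real"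
    by (rule integrable_scaleR_bounded[where B = B]; use that m B in simp)
  show "integrable lborel (\<lambda>x. \<theta> x * u x)"
    using i\<theta>[OF iu(1)] by simp
  show "integrable lborel (\<lambda>x. \<theta> x *\<^sub>R G x + u x *\<^sub>R E x)"
    using i\<theta>[OF iu(2)] iE[OF iu(1)] by simp
  fix e :: real assume e: "0 < e"
  then have "0 < e / (2 * B)" using B(1) by simp
  then obtain \<psi> D where \<psi>: "C1c \<psi> D" "(\<integral>x. norm (\<psi> x - u x) \<partial>lborel) < e / (2 * B)"
    "(\<integral>x. norm (D x - G x) \<partial>lborel) < e / (2 * B)"
    using sobE[OF u] by metis
  note i = C1c_integrable[OF \<psi>(1)]
  have d: "integrable lborel (\<lambda>x. \<psi> x - u x)" "integrable lborel (\<lambda>x. D x - G x)"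
    using i iu by auto
  have \<theta>1: "C1 \<theta> E" using \<theta> by (simp add: C1c_def)
  show "\<exists>\<psi> D. C1c \<psi> D \<and> (\<integral>x. norm (\<psi> x - \<theta> x * u x) \<partial>lborel) < e \<and>
      (\<integral>x. norm (D x - (\<theta> x *\<^sub>R G x + u x *\<^sub>R E x)) \<partial>lborel) < e"
  proof (intro exI conjI)
    show "C1c (\<lambda>x. \<theta> x * \<psi> x) (\<lambda>x. \<theta> x *\<^sub>R D x + \<psi> x *\<^sub>R E x)"
      by (rule C1c_mult[OF \<theta>1 \<psi>(1)])
    have b1: "(\<integral>x. norm (\<theta> x *\<^sub>R (\<psi> x - u x)) \<partial>lborel) \<le> B * (\<integral>x. norm (\<psi> x - u x) \<partial>lborel)"
      by (rule integral_norm_scaleR_le[OF d(1)]) (use m B in auto)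
    have b2: "(\<integral>x. norm (\<theta> x *\<^sub>R (D x - G x)) \<partial>lborel) \<le> B * (\<integral>x. norm (D x - G x) \<partial>lborel)"
      by (rule integral_norm_scaleR_le[OF d(2)]) (use m B in auto)
    have b3: "(\<integral>x. norm ((\<psi> x - u x) *\<^sub>R E x) \<partial>lborel) \<le> B * (\<integral>x. norm (\<psi> x - u x) \<partial>lborel)"
      by (rule integral_scaleR_norm_le[OF d(1)]) (use m B in auto)
    have c: "B * (\<integral>x. norm (\<psi> x - u x) \<partial>lborel) < e / 2" "B * (\<integral>x. norm (D x - G x) \<partial>lborel) < e / 2"
      using \<psi>(2,3) B(1) by (simp_all add: field_simps)
    have "(\<integral>x. norm (\<theta> x * \<psi> x - \<theta> x * u x) \<partial>lborel) = (\<integral>x. norm (\<theta> x *\<^sub>R (\<psi> x - u x)) \<partial>lborel)"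
      by (simp add: right_diff_distrib)
    then show "(\<integral>x. norm (\<theta> x * \<psi> x - \<theta> x * u x) \<partial>lborel) < e"
      using b1 c e by linarith
    have "(\<integral>x. norm (\<theta> x *\<^sub>R D x + \<psi> x *\<^sub>R E x - (\<theta> x *\<^sub>R G x + u x *\<^sub>R E x)) \<partial>lborel) =
        (\<integral>x. norm (\<theta> x *\<^sub>R (D x - G x) + (\<psi> x - u x) *\<^sub>R E x) \<partial>lborel)"
      by (intro Bochner_Integration.integral_cong refl arg_cong[of _ _ norm]) (simp add: algebra_simps)
    also have "\<dots> \<le> (\<integral>x. norm (\<theta> x *\<^sub>R (D x - G x)) \<partial>lborel) + (\<integral>x. norm ((\<psi> x - u x) *\<^sub>R E x) \<partial>lborel)"
      by (intro integral_norm_add_le i\<theta> iE d)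
    also have "\<dots> < e"
      using b2 b3 c by linarith
    finally show "(\<integral>x. norm (\<theta> x *\<^sub>R D x + \<psi> x *\<^sub>R E x - (\<theta> x *\<^sub>R G x + u x *\<^sub>R E x)) \<partial>lborel) < e" .
  qed
qed

text \<open>The composed functions converge because \<open>T\<close> is Lipschitz. For the
  gradients, L^1 convergence of the approximants does not control \<open>T'\<close> along them; a
  subsequence converging almost everywhere does, by continuity of \<open>T'\<close> and domination
  by \<open>2 * B * norm (G x)\<close>.\<close>

lemma sob_chain:
  fixes T T' :: "real \<Rightarrow> real"
  assumes u: "sob u G" and T: "\<And>t. (T has_real_derivative T' t) (at t)" "continuous_on UNIV T'" "T 0 = 0"
    and B: "\<And>t. \<bar>T' t\<bar> \<le> B"
  shows "sob (\<lambda>x. T (u x)) (\<lambda>x. T' (u x) *\<^sub>R G x)"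
proof -
  note iu = sob_integrable[OF u]
  have "0 \<le> B" using B[of 0] by simp
  have lip: "\<bar>T s - T t\<bar> \<le> B * \<bar>s - t\<bar>" for s t
    using field_differentiable_bound[of UNIV T T' B s t] T(1) B by (auto intro: has_field_derivative_at_within)
  have cT: "continuous_on UNIV T"
    using T(1) by (auto intro!: continuous_at_imp_continuous_on DERIV_isCont)
  have [measurable]: "T \<in> borel_measurable borel" "T' \<in> borel_measurable borel"
    using cT T(2) by (auto intro: borel_measurable_continuous_onI)
  have [measurable]: "u \<in> borel_measurable borel" "G \<in> borel_measurable borel"
    by (rule iu(3)) (rule iu(4))
  have iT: "integrable lborel (\<lambda>x. T (u x))"
  proof (rule Bochner_Integration.integrable_bound)
    show "integrable lborel (\<lambda>x. B * \<bar>u x\<bar>)" using iu(1) by simp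
    show "AE x in lborel. norm (T (u x)) \<le> norm (B * \<bar>u x\<bar>)"
      using lip[of _ 0] T(3) by (auto intro!: AE_I2 intro: order_trans[OF _ abs_ge_self])
  qed measurable
  have iG: "integrable lborel (\<lambda>x. T' (f x) *\<^sub>R G x)" if "f \<in> borel_measurable borel" for f :: "'a \<Rightarrow> real"
    by (rule integrable_bounded_scaleR[OF iu(2), where B = B]) (use that B in auto)
  have "\<forall>n. \<exists>p. C1c (fst p) (snd p) \<and> (\<integral>x. norm (fst p x - u x) \<partial>lborel) < inverse (real (Suc n)) \<and>
      (\<integral>x. norm (snd p x - G x) \<partial>lborel) < inverse (real (Suc n))"
  proof
    fix n
    have "0 < inverse (real (Suc n))" by simp
    then obtain \<psi> D where "C1c \<psi> D" "(\<integral>x. norm (\<psi> x - u x) \<partial>lborel) < inverse (real (Suc n))"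
      "(\<integral>x. norm (D x - G x) \<partial>lborel) < inverse (real (Suc n))"
      using sobE[OF u] by metis
    then show "\<exists>p. C1c (fst p) (snd p) \<and> (\<integral>x. norm (fst p x - u x) \<partial>lborel) < inverse (real (Suc n)) \<and>
      (\<integral>x. norm (snd p x - G x) \<partial>lborel) < inverse (real (Suc n))"
      by (intro exI[of _ "(\<psi>, D)"]) simp
  qed
  from choice[OF this] obtain P where P: "\<forall>n. C1c (fst (P n)) (snd (P n)) \<and>
      (\<integral>x. norm (fst (P n) x - u x) \<partial>lborel) < inverse (real (Suc n)) \<and>
      (\<integral>x. norm (snd (P n) x - G x) \<partial>lborel) < inverse (real (Suc n))" ..
  define \<psi> D where "\<psi> n = fst (P n)" and "D n = snd (P n)" for n
  have \<psi>: "C1c (\<psi> n) (D n)" "(\<integral>x. norm (\<psi> n x - u x) \<partial>lborel) < inverse (real (Suc n))"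
    "(\<integral>x. norm (D n x - G x) \<partial>lborel) < inverse (real (Suc n))" for n
    using P[rule_format, of n] by (simp_all add: \<psi>_def D_def)
  have i\<psi>: "integrable lborel (\<psi> n)" "integrable lborel (D n)" "\<psi> n \<in> borel_measurable borel" for n
    using C1c_integrable[OF \<psi>(1)] C1c_measurable[OF \<psi>(1)] by auto
  have L1: "(\<lambda>n. \<integral>x. norm (\<psi> n x - u x) \<partial>lborel) \<longlonglongrightarrow> 0"
  proof (rule tendsto_sandwich[OF _ _ tendsto_const LIMSEQ_inverse_real_of_nat])
    show "\<forall>\<^sub>F n in sequentially. (\<integral>x. norm (\<psi> n x - u x) \<partial>lborel) \<le> inverse (real (Suc n))"
      by (rule always_eventually, rule allI, rule less_imp_le, rule \<psi>(2))
    show "\<forall>\<^sub>F n in sequentially. 0 \<le> (\<integral>x. norm (\<psi> n x - u x) \<partial>lborel)"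
      by simp
  qed
  have L2: "(\<lambda>n. \<integral>x. norm (D n x - G x) \<partial>lborel) \<longlonglongrightarrow> 0"
  proof (rule tendsto_sandwich[OF _ _ tendsto_const LIMSEQ_inverse_real_of_nat])
    show "\<forall>\<^sub>F n in sequentially. (\<integral>x. norm (D n x - G x) \<partial>lborel) \<le> inverse (real (Suc n))"
      by (rule always_eventually, rule allI, rule less_imp_le, rule \<psi>(3))
    show "\<forall>\<^sub>F n in sequentially. 0 \<le> (\<integral>x. norm (D n x - G x) \<partial>lborel)"
      by simp
  qed
  have "\<exists>r::nat\<Rightarrow>nat. strict_mono r \<and> (AE x in lborel. (\<lambda>n. \<psi> (r n) x - u x) \<longlonglongrightarrow> 0)"
    by (rule tendsto_L1_AE_subseq[OF _ L1]) (intro Bochner_Integration.integrable_diff i\<psi> iu)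
  then obtain r :: "nat \<Rightarrow> nat" where r: "strict_mono r" "AE x in lborel. (\<lambda>n. \<psi> (r n) x - u x) \<longlonglongrightarrow> 0"
    by (elim exE conjE)
  have [measurable]: "\<psi> n \<in> borel_measurable borel" for n
    by (rule i\<psi>(3))
  have L3: "(\<lambda>n. \<integral>x. norm ((T' (\<psi> (r n) x) - T' (u x)) *\<^sub>R G x) \<partial>lborel) \<longlonglongrightarrow> (\<integral>x. 0 \<partial>(lborel :: 'a measure))"
  proof (rule integral_dominated_convergence)
    show "integrable lborel (\<lambda>x. 2 * B * norm (G x))"
      using iu(2) by simp
    show "AE x in lborel. (\<lambda>n. norm ((T' (\<psi> (r n) x) - T' (u x)) *\<^sub>R G x)) \<longlonglongrightarrow> 0"
      using r(2)
    proof eventually_elim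
      fix x assume "(\<lambda>n. \<psi> (r n) x - u x) \<longlonglongrightarrow> 0"
      then have "(\<lambda>n. T' (\<psi> (r n) x)) \<longlonglongrightarrow> T' (u x)"
        by (intro continuous_on_tendsto_compose[OF T(2) LIM_zero_cancel]) auto
      then have "(\<lambda>n. norm ((T' (\<psi> (r n) x) - T' (u x)) *\<^sub>R G x)) \<longlonglongrightarrow> norm ((T' (u x) - T' (u x)) *\<^sub>R G x)"
        by (intro tendsto_intros)
      then show "(\<lambda>n. norm ((T' (\<psi> (r n) x) - T' (u x)) *\<^sub>R G x)) \<longlonglongrightarrow> 0"
        by simp
    qed
    show "AE x in lborel. norm (norm ((T' (\<psi> (r n) x) - T' (u x)) *\<^sub>R G x)) \<le> 2 * B * norm (G x)" for n
    proof (rule AE_I2)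
      fix x
      have "\<bar>T' (\<psi> (r n) x) - T' (u x)\<bar> \<le> 2 * B"
        using B[of "\<psi> (r n) x"] B[of "u x"] by linarith
      then show "norm (norm ((T' (\<psi> (r n) x) - T' (u x)) *\<^sub>R G x)) \<le> 2 * B * norm (G x)"
        by (simp add: mult_right_mono)
    qed
  qed measurable
  show ?thesis
    unfolding sob_def
  proof (intro conjI allI impI iT iG iu(3))
    fix e :: real assume e: "0 < e"
    have "(\<lambda>n. B * (\<integral>x. norm (\<psi> (r n) x - u x) \<partial>lborel)) \<longlonglongrightarrow> B * 0"
      by (intro tendsto_mult tendsto_const LIMSEQ_subseq_LIMSEQ[OF L1 r(1), unfolded o_def])
    from order_tendstoD(2)[OF this, of e] e
    have E1: "\<forall>\<^sub>F n in sequentially. B * (\<integral>x. norm (\<psi> (r n) x - u x) \<partial>lborel) < e"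
      by simp
    have "(\<lambda>n. B * (\<integral>x. norm (D (r n) x - G x) \<partial>lborel) +
        (\<integral>x. norm ((T' (\<psi> (r n) x) - T' (u x)) *\<^sub>R G x) \<partial>lborel)) \<longlonglongrightarrow> B * 0 + (\<integral>x. 0 \<partial>(lborel :: 'a measure))"
      by (intro tendsto_add tendsto_mult tendsto_const L3 LIMSEQ_subseq_LIMSEQ[OF L2 r(1), unfolded o_def])
    from order_tendstoD(2)[OF this, of e] e
    have E2: "\<forall>\<^sub>F n in sequentially. B * (\<integral>x. norm (D (r n) x - G x) \<partial>lborel) +
        (\<integral>x. norm ((T' (\<psi> (r n) x) - T' (u x)) *\<^sub>R G x) \<partial>lborel) < e"
      by simp
    from eventually_happens'[OF sequentially_bot eventually_conj[OF E1 E2]]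
    obtain n where n: "B * (\<integral>x. norm (\<psi> (r n) x - u x) \<partial>lborel) < e"
      "B * (\<integral>x. norm (D (r n) x - G x) \<partial>lborel) +
        (\<integral>x. norm ((T' (\<psi> (r n) x) - T' (u x)) *\<^sub>R G x) \<partial>lborel) < e"
      by (elim exE conjE)
    define w F where "w = \<psi> (r n)" and "F = D (r n)"
    note wi = i\<psi>[of "r n", folded w_def F_def]
    have [measurable]: "w \<in> borel_measurable borel" by (rule wi(3))
    have w: "C1c w F"
      using \<psi>(1) by (simp add: w_def F_def)
    show "\<exists>\<psi> D. C1c \<psi> D \<and> (\<integral>x. norm (\<psi> x - T (u x)) \<partial>lborel) < e \<and>
        (\<integral>x. norm (D x - T' (u x) *\<^sub>R G x) \<partial>lborel) < e"
    proof (intro exI conjI)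
      show C: "C1c (\<lambda>x. T (w x)) (\<lambda>x. T' (w x) *\<^sub>R F x)"
        by (rule C1c_compose[OF w T])
      have "(\<integral>x. norm (T (w x) - T (u x)) \<partial>lborel) \<le> (\<integral>x. B * norm (w x - u x) \<partial>lborel)"
        using C1c_integrable[OF C] iT wi iu(1) by (intro integral_mono) (auto simp: lip)
      then show "(\<integral>x. norm (T (w x) - T (u x)) \<partial>lborel) < e"
        using n(1) by (simp add: w_def)
      have iFG: "integrable lborel (\<lambda>x. F x - G x)"
        using wi iu by simp
      have "(\<integral>x. norm (T' (w x) *\<^sub>R F x - T' (u x) *\<^sub>R G x) \<partial>lborel) =
          (\<integral>x. norm (T' (w x) *\<^sub>R (F x - G x) + (T' (w x) - T' (u x)) *\<^sub>R G x) \<partial>lborel)"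
        by (simp add: algebra_simps)
      also have "\<dots> \<le> (\<integral>x. norm (T' (w x) *\<^sub>R (F x - G x)) \<partial>lborel) +
          (\<integral>x. norm ((T' (w x) - T' (u x)) *\<^sub>R G x) \<partial>lborel)"
      proof (rule integral_norm_add_le)
        show "integrable lborel (\<lambda>x. T' (w x) *\<^sub>R (F x - G x))"
          by (rule integrable_bounded_scaleR[OF iFG, where B = B]) (use B in auto)
        show "integrable lborel (\<lambda>x. (T' (w x) - T' (u x)) *\<^sub>R G x)"
          unfolding scaleR_diff_left using iG[OF wi(3)] iG[OF iu(3)] by simp
      qed
      also have "(\<integral>x. norm (T' (w x) *\<^sub>R (F x - G x)) \<partial>lborel) \<le> B * (\<integral>x. norm (F x - G x) \<partial>lborel)"
        by (rule integral_norm_scaleR_le[OF iFG]) (use B in auto)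
      finally show "(\<integral>x. norm (T' (w x) *\<^sub>R F x - T' (u x) *\<^sub>R G x) \<partial>lborel) < e"
        using n(2) by (simp add: w_def F_def)
    qed
  qed
qed

section \<open>Weak gradients\<close>

text \<open>Weak gradients are only Lebesgue measurable, while convolutions and Fubini are carried
  out with Borel functions over \<open>lborel\<close>; a change on a null set links the two. The
  representative is found coordinate by coordinate.\<close>

lemma lebesgue_borel_version:
  fixes f :: "'a::euclidean_space \<Rightarrow> 'b::euclidean_space"
  assumes "f \<in> borel_measurable lebesgue"
  obtains f' where "f' \<in> borel_measurable borel" "AE x in lborel. f x = f' x"
proof -
  have "\<exists>f'. f' \<in> borel_measurable lborel \<and> (AE x in lborel. f x \<bullet> b = f' x)" for b
    using completion_ex_borel_measurable_real[OF borel_measurable_inner[OF assms borel_measurable_const], of b]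
    by (simp add: Bex_def)
  from choice[OF allI[OF this]] obtain F where
    "\<forall>b. F b \<in> borel_measurable lborel \<and> (AE x in lborel. f x \<bullet> b = F b x)" ..
  then have F: "F b \<in> borel_measurable lborel" "AE x in lborel. f x \<bullet> b = F b x" for b
    by simp_all
  show ?thesis
  proof
    show "(\<lambda>x. \<Sum>b\<in>Basis. F b x *\<^sub>R b) \<in> borel_measurable borel"
      using F(1) by simp
    have "AE x in lborel. \<forall>b\<in>(Basis :: 'b set). f x \<bullet> b = F b x"
      using F(2) by (intro AE_finite_allI) auto
    then show "AE x in lborel. f x = (\<Sum>b\<in>Basis. F b x *\<^sub>R b)"
    proof eventually_elim
      fix x assume "\<forall>b\<in>(Basis :: 'b set). f x \<bullet> b = F b x"
      then show "f x = (\<Sum>b\<in>Basis. F b x *\<^sub>R b)"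
        by (subst euclidean_representation[symmetric]) (intro sum.cong refl, simp)
    qed
  qed
qed

lemma lebesgue_on_lborel:
  fixes f :: "'a::euclidean_space \<Rightarrow> 'b::euclidean_space"
  assumes S: "S \<in> sets lebesgue" and f: "f \<in> borel_measurable borel" and 0: "\<And>x. x \<notin> S \<Longrightarrow> f x = 0"
  shows "(\<integral>x. f x \<partial>lebesgue_on S) = (\<integral>x. f x \<partial>lborel)"
    and "integrable (lebesgue_on S) f \<longleftrightarrow> integrable lborel f"
proof -
  have eq: "(\<lambda>x. indicator S x *\<^sub>R f x) = f"
    using 0 by (auto simp: indicator_def fun_eq_iff)
  have f': "f \<in> borel_measurable lborel"
    using f by simp
  show "(\<integral>x. f x \<partial>lebesgue_on S) = (\<integral>x. f x \<partial>lborel)"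
    using S by (simp add: integral_restrict_space eq integral_completion[OF f'])
  show "integrable (lebesgue_on S) f \<longleftrightarrow> integrable lborel f"
    using S by (simp add: integrable_restrict_space eq integrable_completion[OF f'])
qed

lemma nn_integral_lebesgue_on_lborel:
  assumes S: "S \<in> sets lebesgue" and 0: "\<And>x. x \<notin> S \<Longrightarrow> f x = 0"
  shows "(\<integral>\<^sup>+x. f x \<partial>lebesgue_on S) = (\<integral>\<^sup>+x. f x \<partial>lborel)"
proof -
  have "(\<lambda>x. f x * indicator S x) = f"
    using 0 by (auto simp: indicator_def fun_eq_iff)
  then show ?thesis
    using S by (simp add: nn_integral_restrict_space nn_integral_completion)
qed

lemma AE_lebesgue_on_iff:
  assumes "S \<in> sets lebesgue"
  shows "(AE x in lebesgue_on S. P x) \<longleftrightarrow> (AE x in lborel. x \<in> S \<longrightarrow> P x)"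
  using assms by (simp add: AE_restrict_space_iff AE_completion_iff)

section \<open>Test functions, the fundamental lemma and uniqueness of weak gradients\<close>

lemma Ck_reflect:
  fixes f :: "'a::euclidean_space \<Rightarrow> real"
  assumes "Ck j f"
  shows "Ck j (\<lambda>y. f (x - y))"
  using assms
proof (induction j arbitrary: f)
  case 0
  then show ?case
    by (auto intro!: continuous_on_compose2[of UNIV f] continuous_intros)
next
  case (Suc j)
  have d: "((\<lambda>y. f (x - y)) has_derivative (\<lambda>h. frechet_derivative f (at (x - y)) (- h))) (at y)" for y
  proof -
    have "((\<lambda>y. x - y) has_derivative (\<lambda>h. - h)) (at y)"
      by (auto intro!: derivative_eq_intros)
    moreover have "(f has_derivative frechet_derivative f (at (x - y))) (at (x - y))"
      using Suc.prems by (simp add: frechet_derivative_works[symmetric])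
    ultimately show ?thesis
      by (rule has_derivative_compose)
  qed
  have "frechet_derivative (\<lambda>y. f (x - y)) (at y) = (\<lambda>h. frechet_derivative f (at (x - y)) (- h))" for y
    using frechet_derivative_at[OF d] by metis
  moreover have "(\<lambda>y. f (x - y)) differentiable (at y)" for y
    by (rule differentiableI[OF d])
  moreover have "Ck j (\<lambda>y. frechet_derivative f (at (x - y)) (- v))" for v
    using Suc.IH[of "\<lambda>z. frechet_derivative f (at z) (- v)"] Suc.prems by simp
  ultimately show ?case
    by simp
qed

text \<open>Convolution at \<open>x\<close> is the pairing with this reflected kernel, so an
  identity for all test functions can be read as an identity for mollified values.\<close>

lemma kernel_reflect_Cc_infinity:
  assumes k: "kernel \<rho> c r" and "cball (x - c) r \<subseteq> \<Omega>"
  shows "(\<lambda>y. \<rho> (x - y)) \<in> Cc_infinity \<Omega>"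
proof (rule Cc_infinityI)
  show "Ck j (\<lambda>y. \<rho> (x - y))" for j
    using k by (intro Ck_reflect) (simp add: kernel_def)
  show "\<rho> (x - y) = 0" if "y \<notin> cball (x - c) r" for y
  proof -
    have "dist c (x - y) = norm ((x - y) - c)"
      by (simp add: dist_norm norm_minus_commute)
    also have "(x - y) - c = (x - c) - y" by simp
    finally have "x - y \<notin> cball c r"
      using that by (simp add: dist_norm)
    then show ?thesis
      using k by (simp add: kernel_def)
  qed
qed (use assms in auto)

lemma Cc_infinity_support:
  assumes "\<psi> \<in> Cc_infinity \<Omega>"
  obtains K where "compact K" "K \<subseteq> \<Omega>" "\<And>x. x \<notin> K \<Longrightarrow> \<psi> x = 0" "\<And>x. x \<notin> K \<Longrightarrow> grad \<psi> x = 0"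
proof -
  define K where "K = closure {x. \<psi> x \<noteq> 0}"
  have K: "compact K" "K \<subseteq> \<Omega>" "closed K"
    using assms by (simp_all add: Cc_infinity_def K_def)
  have 0: "\<psi> x = 0" if "x \<notin> K" for x
    using that closure_subset[of "{x. \<psi> x \<noteq> 0}"] unfolding K_def by auto
  have "C1 \<psi> (grad \<psi>)"
    using Cc_infinity_C1c[OF assms] by (simp add: C1c_def)
  then have "grad \<psi> x = 0" if "x \<notin> K" for x
    by (rule C1_zero_outside_closed[OF _ K(3) 0 that])
  with K 0 that show ?thesis
    by metis
qed

lemma frechet_derivative_grad:
  assumes "\<psi> \<in> Cc_infinity \<Omega>"
  shows "frechet_derivative \<psi> (at x) v = grad \<psi> x \<bullet> v"
proof -
  have "(\<psi> has_derivative (\<lambda>h. grad \<psi> x \<bullet> h)) (at x)"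
    using Cc_infinity_C1c[OF assms] by (simp add: C1c_def C1_def)
  from frechet_derivative_at[OF this] show ?thesis
    by metis
qed

lemma integrable_test:
  fixes f \<eta> :: "'a::euclidean_space \<Rightarrow> real"
  assumes \<Omega>: "\<Omega> \<in> sets lebesgue" and f: "f absolutely_integrable_on K" and K: "K \<subseteq> \<Omega>"
    and \<eta>: "\<eta> \<in> borel_measurable borel" "\<And>x. \<bar>\<eta> x\<bar> \<le> B" "\<And>x. x \<notin> K \<Longrightarrow> \<eta> x = 0"
  shows "integrable (lebesgue_on \<Omega>) (\<lambda>x. f x * \<eta> x)"
proof -
  have "integrable lebesgue (\<lambda>x. indicator K x *\<^sub>R f x)"
    using f by (simp add: set_integrable_def)
  then have "integrable lebesgue (\<lambda>x. \<eta> x *\<^sub>R (indicator K x *\<^sub>R f x))"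
    by (rule integrable_bounded_scaleR[where B = B]) (use \<eta> in \<open>auto intro: measurable_completion\<close>)
  also have "(\<lambda>x. \<eta> x *\<^sub>R (indicator K x *\<^sub>R f x)) = (\<lambda>x. indicator \<Omega> x *\<^sub>R (f x * \<eta> x))"
  proof
    fix x
    show "\<eta> x *\<^sub>R (indicator K x *\<^sub>R f x) = indicator \<Omega> x *\<^sub>R (f x * \<eta> x)"
      using \<eta>(3)[of x] K by (cases "x \<in> K") (auto simp: mult.commute)
  qed
  finally show ?thesis
    using \<Omega> by (simp add: integrable_restrict_space)
qed

lemma absolutely_integrable_inner:
  fixes g :: "'a::euclidean_space \<Rightarrow> 'b::euclidean_space"
  assumes "g absolutely_integrable_on K"
  shows "(\<lambda>x. g x \<bullet> i) absolutely_integrable_on K"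
proof -
  have "integrable lebesgue (\<lambda>x. (indicator K x *\<^sub>R g x) \<bullet> i)"
    using assms by (intro integrable_inner_left) (simp add: set_integrable_def)
  then show ?thesis
    by (simp add: set_integrable_def)
qed

lemma has_weak_grad_test_integrable:
  fixes u :: "'a::euclidean_space \<Rightarrow> real"
  assumes \<Omega>: "open \<Omega>" and u: "has_weak_grad \<Omega> u g" and \<psi>: "\<psi> \<in> Cc_infinity \<Omega>"
  shows "integrable (lebesgue_on \<Omega>) (\<lambda>x. u x * frechet_derivative \<psi> (at x) i)"
    and "integrable (lebesgue_on \<Omega>) (\<lambda>x. (g x \<bullet> i) * \<psi> x)"
proof -
  have \<Omega>': "\<Omega> \<in> sets lebesgue"
    using \<Omega> by (simp add: lmeasurable_open)
  obtain K where K: "compact K" "K \<subseteq> \<Omega>" "\<And>x. x \<notin> K \<Longrightarrow> \<psi> x = 0" "\<And>x. x \<notin> K \<Longrightarrow> grad \<psi> x = 0"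
    using Cc_infinity_support[OF \<psi>] by metis
  note C = Cc_infinity_C1c[OF \<psi>]
  obtain B where B: "0 < B" "\<And>x. \<bar>\<psi> x\<bar> \<le> B" "\<And>x. norm (grad \<psi> x) \<le> B"
    using C1c_bounded[OF C] by metis
  have a: "u absolutely_integrable_on K" "g absolutely_integrable_on K"
    using u K unfolding has_weak_grad_def by auto
  have "\<bar>grad \<psi> x \<bullet> i\<bar> \<le> B * norm i" for x
    by (rule order_trans[OF Cauchy_Schwarz_ineq2]) (simp add: mult_right_mono B)
  then show "integrable (lebesgue_on \<Omega>) (\<lambda>x. u x * frechet_derivative \<psi> (at x) i)"
    unfolding frechet_derivative_grad[OF \<psi>]
    by (intro integrable_test[OF \<Omega>' a(1) K(2), where B = "B * norm i"])
      (use C1c_measurable[OF C] K(4) in auto)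
  show "integrable (lebesgue_on \<Omega>) (\<lambda>x. (g x \<bullet> i) * \<psi> x)"
    by (rule integrable_test[OF \<Omega>' absolutely_integrable_inner[OF a(2)] K(2) C1c_measurable(1)[OF C] B(2) K(3)])
qed

lemma has_weak_grad_diff:
  fixes u v :: "'a::euclidean_space \<Rightarrow> real"
  assumes \<Omega>: "open \<Omega>" and u: "has_weak_grad \<Omega> u g" and v: "has_weak_grad \<Omega> v k"
  shows "has_weak_grad \<Omega> (\<lambda>x. u x - v x) (\<lambda>x. g x - k x)"
  unfolding has_weak_grad_def
proof (intro conjI allI impI ballI)
  fix K assume "compact K \<and> K \<subseteq> \<Omega>"
  then show "(\<lambda>x. u x - v x) absolutely_integrable_on K" "(\<lambda>x. g x - k x) absolutely_integrable_on K"
    using u v by (auto simp: has_weak_grad_def)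
next
  fix \<psi> and i :: 'a assume \<psi>: "\<psi> \<in> Cc_infinity \<Omega>" and i: "i \<in> Basis"
  note iu = has_weak_grad_test_integrable[OF \<Omega> u \<psi>, of i]
  note iv = has_weak_grad_test_integrable[OF \<Omega> v \<psi>, of i]
  have "(\<integral>x. u x * frechet_derivative \<psi> (at x) i \<partial>lebesgue_on \<Omega>) = - (\<integral>x. (g x \<bullet> i) * \<psi> x \<partial>lebesgue_on \<Omega>)"
    "(\<integral>x. v x * frechet_derivative \<psi> (at x) i \<partial>lebesgue_on \<Omega>) = - (\<integral>x. (k x \<bullet> i) * \<psi> x \<partial>lebesgue_on \<Omega>)"
    using u v \<psi> i by (simp_all add: has_weak_grad_def)
  then show "(\<integral>x. (u x - v x) * frechet_derivative \<psi> (at x) i \<partial>lebesgue_on \<Omega>) =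
      - (\<integral>x. ((g x - k x) \<bullet> i) * \<psi> x \<partial>lebesgue_on \<Omega>)"
    using iu iv by (simp add: left_diff_distrib inner_diff_left)
qed

lemma Cc_infinity_has_weak_grad:
  fixes \<phi> :: "'a::euclidean_space \<Rightarrow> real"
  assumes \<Omega>: "open \<Omega>" and \<phi>: "\<phi> \<in> Cc_infinity \<Omega>"
  shows "has_weak_grad \<Omega> \<phi> (grad \<phi>)"
  unfolding has_weak_grad_def
proof (intro conjI allI impI ballI)
  note C = Cc_infinity_C1c[OF \<phi>]
  have i: "integrable lebesgue \<phi>" "integrable lebesgue (grad \<phi>)"
    using C1c_integrable[OF C] by (simp_all only: integrable_completion borel_measurable_integrable)
  fix K assume "compact K \<and> K \<subseteq> \<Omega>"
  then have K: "K \<in> sets lebesgue"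
    by (intro fmeasurableD lmeasurable_compact) simp
  show "\<phi> absolutely_integrable_on K" "grad \<phi> absolutely_integrable_on K"
    unfolding set_integrable_def by (rule integrable_mult_indicator[OF K i(1)], rule integrable_mult_indicator[OF K i(2)])
next
  fix \<psi> and i :: 'a assume \<psi>: "\<psi> \<in> Cc_infinity \<Omega>"
  have \<Omega>': "\<Omega> \<in> sets lebesgue"
    using \<Omega> by (simp add: lmeasurable_open)
  note C = Cc_infinity_C1c[OF \<phi>] and C' = Cc_infinity_C1c[OF \<psi>]
  note m = C1c_measurable[OF C] C1c_measurable[OF C']
  obtain B where B: "\<And>x. \<bar>\<phi> x\<bar> \<le> B"
    using C1c_bounded[OF C] by metis
  obtain B' where B': "\<And>x. \<bar>\<psi> x\<bar> \<le> B'"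
    using C1c_bounded[OF C'] by metis
  have i1: "integrable lborel (\<lambda>x. \<phi> x *\<^sub>R grad \<psi> x)"
    by (rule integrable_bounded_scaleR[OF C1c_integrable(2)[OF C'], where B = B]) (use m B in auto)
  have i2: "integrable lborel (\<lambda>x. \<psi> x *\<^sub>R grad \<phi> x)"
    by (rule integrable_bounded_scaleR[OF C1c_integrable(2)[OF C], where B = B']) (use m B' in auto)
  have "(\<integral>x. \<phi> x * frechet_derivative \<psi> (at x) i \<partial>lebesgue_on \<Omega>) = (\<integral>x. \<phi> x * (grad \<psi> x \<bullet> i) \<partial>lborel)"
    unfolding frechet_derivative_grad[OF \<psi>]
    by (rule lebesgue_on_lborel[OF \<Omega>']) (use m Cc_infinity_zero_outside[OF \<phi>] in auto)
  also have "\<dots> = (\<integral>x. \<phi> x *\<^sub>R grad \<psi> x \<partial>lborel) \<bullet> i"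
    using integral_inner_left[of i lborel "\<lambda>x. \<phi> x *\<^sub>R grad \<psi> x"] i1 by simp
  also have "\<dots> = - ((\<integral>x. \<psi> x *\<^sub>R grad \<phi> x \<partial>lborel) \<bullet> i)"
    using C1c_by_parts[OF C C'] by simp
  also have "(\<integral>x. \<psi> x *\<^sub>R grad \<phi> x \<partial>lborel) \<bullet> i = (\<integral>x. (grad \<phi> x \<bullet> i) * \<psi> x \<partial>lborel)"
    using integral_inner_left[of i lborel "\<lambda>x. \<psi> x *\<^sub>R grad \<phi> x"] i2 by (simp add: mult.commute)
  also have "\<dots> = (\<integral>x. (grad \<phi> x \<bullet> i) * \<psi> x \<partial>lebesgue_on \<Omega>)"
    by (rule lebesgue_on_lborel[OF \<Omega>', symmetric]) (use m Cc_infinity_zero_outside[OF \<psi>] in auto)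
  finally show "(\<integral>x. \<phi> x * frechet_derivative \<psi> (at x) i \<partial>lebesgue_on \<Omega>) =
      - (\<integral>x. (grad \<phi> x \<bullet> i) * \<psi> x \<partial>lebesgue_on \<Omega>)" .
qed

lemma kernel_exists:
  assumes "0 < \<delta>"
  shows "\<exists>\<rho>. kernel \<rho> (0 :: 'a::euclidean_space) \<delta>"
proof (rule mollifier_exists[OF zero_less_one])
  fix \<rho> :: "real \<Rightarrow> 'a \<Rightarrow> real" and C :: real
  assume "\<And>\<delta>. 0 < \<delta> \<Longrightarrow> kernel (\<rho> \<delta>) (\<delta> *\<^sub>R 0) (\<delta> * 1)"
  from this[OF assms] show ?thesis
    by (intro exI[of _ "\<rho> \<delta>"]) simp
qed

text \<open>The fundamental lemma of the calculus of variations. Testing with reflected kernels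
  shows that the mollifications of \<open>h\<close> at small scales vanish near a given point; as
  they converge to \<open>h\<close> locally in L^1, \<open>h\<close> vanishes almost everywhere near
  that point.\<close>

lemma AE_zero_of_test:
  fixes h :: "'a::euclidean_space \<Rightarrow> real"
  assumes \<Omega>: "open \<Omega>"
    and h: "\<And>K. compact K \<Longrightarrow> K \<subseteq> \<Omega> \<Longrightarrow> h absolutely_integrable_on K"
    and 0: "\<And>\<psi>. \<psi> \<in> Cc_infinity \<Omega> \<Longrightarrow> (\<integral>x. h x * \<psi> x \<partial>lebesgue_on \<Omega>) = 0"
  shows "AE x in lebesgue_on \<Omega>. h x = 0"
proof -
  have \<Omega>': "\<Omega> \<in> sets lebesgue"
    using \<Omega> by (simp add: lmeasurable_open)
  have "negligible {x\<in>\<Omega>. h x \<noteq> 0}"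
  proof (rule locally_negligible_alt[THEN iffD2], rule ballI)
    fix x0 assume "x0 \<in> {x\<in>\<Omega>. h x \<noteq> 0}"
    then have "x0 \<in> \<Omega>" by simp
    from \<Omega>[unfolded open_contains_cball, rule_format, OF this]
    obtain R where R: "0 < R" "cball x0 R \<subseteq> \<Omega>"
      by (elim exE conjE)
    \<comment> \<open>Half of the available radius: kernels of radius at most \<open>r\<close>
      placed in the inner ball stay inside the outer ball.\<close>
    define r where "r = R / 2"
    have r: "0 < r" "cball x0 (r + r) \<subseteq> \<Omega>"
      using R by (auto simp: r_def)
    let ?S = "cball x0 (r + r)"
    have "integrable lebesgue (\<lambda>x. indicator ?S x *\<^sub>R h x)"
      using h[OF compact_cball r(2)] by (simp add: set_integrable_def)
    note int = this
    \<comment> \<open>An integrable Borel function on the whole space that agrees with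
      \<open>h\<close> almost everywhere on the outer ball and can therefore be mollified.\<close>
    obtain f where f[measurable]: "f \<in> borel_measurable borel" and fh: "AE x in lborel. indicator ?S x *\<^sub>R h x = f x"
      by (rule lebesgue_borel_version[OF borel_measurable_integrable[OF int]])
    have fh': "AE x in lebesgue. indicator ?S x *\<^sub>R h x = f x"
      using fh by (simp add: AE_completion_iff)
    have "integrable lebesgue f"
      by (rule integrable_cong_AE_imp[OF int _ fh']) (rule measurable_completion, simp)
    then have fi: "integrable lborel f"
      by (simp add: integrable_completion)
    have conv0: "conv k f x = 0" if k: "kernel k 0 \<delta>" and \<delta>: "\<delta> \<le> r" and x: "x \<in> ball x0 r" for k \<delta> x
    proof -
      have sub: "cball (x - 0) \<delta> \<subseteq> ?S"
      proof
        fix y assume "y \<in> cball (x - 0) \<delta>"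
        then show "y \<in> ?S"
          using x \<delta> dist_triangle[of x0 y x] by simp
      qed
      note km = C1c_measurable(1)[OF kernel_C1c[OF k]]
      have k0: "k (x - y) = 0" if "y \<notin> ?S" for y
      proof -
        have "x - y \<notin> cball 0 \<delta>"
          using that sub by (auto simp: dist_norm norm_minus_commute)
        then show ?thesis using k by (simp add: kernel_def)
      qed
      have [measurable]: "k \<in> borel_measurable borel" by (rule km)
      have "conv k f x = (\<integral>y. k (x - y) *\<^sub>R f y \<partial>lebesgue)"
        unfolding conv_def by (rule integral_completion[symmetric]) measurable
      also have "\<dots> = (\<integral>y. indicator \<Omega> y *\<^sub>R (h y * k (x - y)) \<partial>lebesgue)"
      proof (rule integral_cong_AE)
        show "(\<lambda>y. k (x - y) *\<^sub>R f y) \<in> borel_measurable lebesgue"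
          by (rule measurable_completion) measurable
        have "(\<lambda>y. k (x - y) *\<^sub>R (indicator ?S y *\<^sub>R h y)) \<in> borel_measurable lebesgue"
          by (intro borel_measurable_scaleR borel_measurable_integrable[OF int] measurable_completion) measurable
        also have "(\<lambda>y. k (x - y) *\<^sub>R (indicator ?S y *\<^sub>R h y)) = (\<lambda>y. indicator \<Omega> y *\<^sub>R (h y * k (x - y)))"
          using k0 r(2) by (auto simp: fun_eq_iff indicator_def)
        finally show "(\<lambda>y. indicator \<Omega> y *\<^sub>R (h y * k (x - y))) \<in> borel_measurable lebesgue" .
        show "AE y in lebesgue. k (x - y) *\<^sub>R f y = indicator \<Omega> y *\<^sub>R (h y * k (x - y))"
          using fh'
        proof eventually_elim
          fix y assume y: "indicator ?S y *\<^sub>R h y = f y"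
          show "k (x - y) *\<^sub>R f y = indicator \<Omega> y *\<^sub>R (h y * k (x - y))"
            using k0[of y] r(2) unfolding y[symmetric] by (auto simp: indicator_def)
        qed
      qed
      also have "\<dots> = (\<integral>y. h y * k (x - y) \<partial>lebesgue_on \<Omega>)"
        using \<Omega>' by (simp add: integral_restrict_space)
      also have "\<dots> = 0"
        by (rule 0, rule kernel_reflect_Cc_infinity[OF k subset_trans[OF sub r(2)]])
      finally show ?thesis .
    qed
    have le: "(\<integral>x. indicator (ball x0 r) x * \<bar>f x\<bar> \<partial>lborel) < e" if "0 < e" for e
    proof -
      obtain d where d: "0 < d" "\<And>\<rho> c r. kernel \<rho> c r \<Longrightarrow> norm c + r \<le> d \<Longrightarrow> (\<integral>x. norm (conv \<rho> f x - f x) \<partial>lborel) < e"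
        using conv_approximates[OF fi \<open>0 < e\<close>] by metis
      define \<delta> where "\<delta> = min d r"
      have \<delta>: "0 < \<delta>" "\<delta> \<le> r" "\<delta> \<le> d" using d(1) r(1) by (auto simp: \<delta>_def)
      obtain \<rho> :: "'a \<Rightarrow> real" where k: "kernel \<rho> 0 \<delta>"
        using kernel_exists[OF \<delta>(1)] by (elim exE)
      have ci: "integrable lborel (conv \<rho> f)"
        by (rule conv_L1(1)[OF kernel_C1c[OF k] fi])
      have "(\<integral>x. indicator (ball x0 r) x * \<bar>f x\<bar> \<partial>lborel) \<le> (\<integral>x. norm (conv \<rho> f x - f x) \<partial>lborel)"
      proof (rule integral_mono)
        show "integrable lborel (\<lambda>x. indicator (ball x0 r) x * \<bar>f x\<bar>)"
          using integrable_mult_indicator[of "ball x0 r" lborel "\<lambda>x. \<bar>f x\<bar>"] fi by simp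
        show "integrable lborel (\<lambda>x. norm (conv \<rho> f x - f x))"
          using ci fi by simp
        show "indicator (ball x0 r) x * \<bar>f x\<bar> \<le> norm (conv \<rho> f x - f x)" for x
          using conv0[OF k \<delta>(2), of x] by (cases "x \<in> ball x0 r") auto
      qed
      also have "\<dots> < e"
        by (rule d(2)[OF k]) (use \<delta> in simp)
      finally show ?thesis .
    qed
    have i: "integrable lborel (\<lambda>x. indicator (ball x0 r) x * \<bar>f x\<bar>)"
      using integrable_mult_indicator[of "ball x0 r" lborel "\<lambda>x. \<bar>f x\<bar>"] fi by simp
    have "(\<integral>x. indicator (ball x0 r) x * \<bar>f x\<bar> \<partial>lborel) \<le> 0"
      by (rule field_le_epsilon) (use le in \<open>simp add: less_imp_le\<close>)
    moreover have "0 \<le> (\<integral>x. indicator (ball x0 r) x * \<bar>f x\<bar> \<partial>lborel)"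
      by (rule integral_nonneg_AE) simp
    ultimately have "AE x in lborel. indicator (ball x0 r) x * \<bar>f x\<bar> = 0"
      using integral_nonneg_eq_0_iff_AE[OF i] by simp
    then have "AE x in lborel. x \<notin> {x\<in>\<Omega>. h x \<noteq> 0} \<inter> ball x0 r"
      using fh
    proof eventually_elim
      fix x assume "indicator (ball x0 r) x * \<bar>f x\<bar> = 0" and "indicator ?S x *\<^sub>R h x = f x"
      then show "x \<notin> {x\<in>\<Omega>. h x \<noteq> 0} \<inter> ball x0 r"
        using r(1) by (auto simp: indicator_def split: if_splits)
    qed
    then have "AE x in lebesgue. x \<notin> {x\<in>\<Omega>. h x \<noteq> 0} \<inter> ball x0 r"
      by (rule AE_completion)
    moreover have "negligible N" if "AE x in lebesgue. x \<notin> N" for N :: "'a set"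
      using that by (simp add: negligible_iff_null_sets completion.AE_iff_null_sets)
    ultimately have "negligible ({x\<in>\<Omega>. h x \<noteq> 0} \<inter> ball x0 r)"
      by simp
    moreover have "openin (top_of_set {x\<in>\<Omega>. h x \<noteq> 0}) ({x\<in>\<Omega>. h x \<noteq> 0} \<inter> ball x0 r)"
      by (rule openin_open_Int) simp
    ultimately show "\<exists>U. openin (top_of_set {x\<in>\<Omega>. h x \<noteq> 0}) U \<and> x0 \<in> U \<and> negligible U"
      using \<open>x0 \<in> {x\<in>\<Omega>. h x \<noteq> 0}\<close> r(1) by (intro exI[of _ "{x\<in>\<Omega>. h x \<noteq> 0} \<inter> ball x0 r"]) simp
  qed
  from AE_lborel_of_negligible[OF this] show ?thesis
    unfolding AE_lebesgue_on_iff[OF \<Omega>'] by eventually_elim simp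
qed

lemma has_weak_grad_unique:
  fixes u :: "'a::euclidean_space \<Rightarrow> real"
  assumes \<Omega>: "open \<Omega>" and g: "has_weak_grad \<Omega> u g" and g': "has_weak_grad \<Omega> u g'"
  shows "AE x in lebesgue_on \<Omega>. g x = g' x"
proof -
  have "AE x in lebesgue_on \<Omega>. (g x - g' x) \<bullet> i = 0" if i: "i \<in> Basis" for i :: 'a
  proof (rule AE_zero_of_test[OF \<Omega>])
    fix K assume "compact K" "K \<subseteq> \<Omega>"
    then show "(\<lambda>x. (g x - g' x) \<bullet> i) absolutely_integrable_on K"
      using g g' by (intro absolutely_integrable_inner) (auto simp: has_weak_grad_def)
  next
    fix \<psi> assume \<psi>: "\<psi> \<in> Cc_infinity \<Omega>"
    have "(\<integral>x. (g x \<bullet> i) * \<psi> x \<partial>lebesgue_on \<Omega>) = (\<integral>x. (g' x \<bullet> i) * \<psi> x \<partial>lebesgue_on \<Omega>)"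
    proof -
      have "- (\<integral>x. (g x \<bullet> i) * \<psi> x \<partial>lebesgue_on \<Omega>) = - (\<integral>x. (g' x \<bullet> i) * \<psi> x \<partial>lebesgue_on \<Omega>)"
        using g g' \<psi> i unfolding has_weak_grad_def by simp
      then show ?thesis by simp
    qed
    then show "(\<integral>x. ((g x - g' x) \<bullet> i) * \<psi> x \<partial>lebesgue_on \<Omega>) = 0"
      using has_weak_grad_test_integrable(2)[OF \<Omega> g \<psi>, of i] has_weak_grad_test_integrable(2)[OF \<Omega> g' \<psi>, of i]
      by (simp add: inner_diff_left left_diff_distrib)
  qed
  then have "AE x in lebesgue_on \<Omega>. \<forall>i\<in>Basis. (g x - g' x) \<bullet> i = 0"
    by (intro AE_finite_allI) auto
  then show ?thesis
    by eventually_elim (rule euclidean_eqI, simp add: inner_diff_left)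
qed

text \<open>Links the choice operator in \<open>weak_grad\<close> with any gradient that has been
  computed explicitly.\<close>

lemma weak_grad_AE:
  assumes "open \<Omega>" "has_weak_grad \<Omega> u g"
  shows "AE x in lebesgue_on \<Omega>. weak_grad \<Omega> u x = g x"
proof -
  have "has_weak_grad \<Omega> u (weak_grad \<Omega> u)"
    unfolding weak_grad_def by (rule someI[of _ g]) (rule assms)
  then show ?thesis
    by (rule has_weak_grad_unique[OF assms(1) _ assms(2)])
qed

section \<open>The energy under mollification\<close>

lemma L1_norm_lborel:
  fixes f F :: "'a::euclidean_space \<Rightarrow> 'b::euclidean_space"
  assumes \<Omega>: "\<Omega> \<in> sets lebesgue" and f: "integrable lborel f" "\<And>x. x \<notin> \<Omega> \<Longrightarrow> f x = 0"
    and ae: "AE x in lebesgue_on \<Omega>. F x = f x"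
  shows "L1_norm \<Omega> F = ennreal (\<integral>x. norm (f x) \<partial>lborel)"
proof -
  have "L1_norm \<Omega> F = (\<integral>\<^sup>+x. ennreal (norm (f x)) \<partial>lebesgue_on \<Omega>)"
    unfolding L1_norm_def by (rule nn_integral_cong_AE) (use ae in eventually_elim, simp)
  also have "\<dots> = (\<integral>\<^sup>+x. ennreal (norm (f x)) \<partial>lborel)"
    by (rule nn_integral_lebesgue_on_lborel[OF \<Omega>]) (simp add: f(2))
  also have "\<dots> = ennreal (\<integral>x. norm (f x) \<partial>lborel)"
    by (rule nn_integral_eq_integral) (use f(1) in simp_all)
  finally show ?thesis .
qed

lemma lebesgue_on_borel_version:
  fixes g :: "'a::euclidean_space \<Rightarrow> 'b::euclidean_space"
  assumes \<Omega>: "open \<Omega>" and g: "integrable (lebesgue_on \<Omega>) g"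
  obtains G where "G \<in> borel_measurable borel" "\<And>x. x \<notin> \<Omega> \<Longrightarrow> G x = 0"
    "AE x in lebesgue_on \<Omega>. G x = g x" "integrable lborel G"
proof -
  have \<Omega>': "\<Omega> \<in> sets lebesgue" and [measurable]: "\<Omega> \<in> sets borel"
    using \<Omega> by (simp_all add: lmeasurable_open)
  have int: "integrable lebesgue (\<lambda>x. indicator \<Omega> x *\<^sub>R g x)"
    using g \<Omega>' by (simp add: integrable_restrict_space)
  show ?thesis
  proof (rule lebesgue_borel_version[OF borel_measurable_integrable[OF int]])
    fix G0 :: "'a \<Rightarrow> 'b" assume [measurable]: "G0 \<in> borel_measurable borel"
      and ae: "AE x in lborel. indicator \<Omega> x *\<^sub>R g x = G0 x"
    define G where "G x = indicator \<Omega> x *\<^sub>R G0 x" for x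
    have m: "G \<in> borel_measurable borel"
      unfolding G_def by measurable
    have z: "x \<notin> \<Omega> \<Longrightarrow> G x = 0" for x
      by (simp add: G_def)
    have ae': "AE x in lebesgue_on \<Omega>. G x = g x"
      unfolding AE_lebesgue_on_iff[OF \<Omega>'] using ae by eventually_elim (auto simp: G_def)
    have "integrable (lebesgue_on \<Omega>) G"
      by (rule integrable_cong_AE_imp[OF g])
        (use m ae' in \<open>auto intro!: measurable_restrict_space1 measurable_completion simp: eq_commute\<close>)
    then have "integrable lborel G"
      using lebesgue_on_lborel(2)[OF \<Omega>' m z] by simp
    with m z ae' show ?thesis
      by (rule that)
  qed
qed

text \<open>Test functions vanish outside \<Omega>, so their \<open>W11_norm\<close> distance to
  \<phi> on \<Omega> is a distance on the whole space to the zero extensions. From here on zero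
  boundary values are encoded in \<open>sob\<close> for the extended pair.\<close>

lemma W11_0_imp_sob:
  fixes \<phi> u :: "'a::euclidean_space \<Rightarrow> real"
  assumes \<Omega>: "open \<Omega>" and \<phi>: "\<phi> \<in> W11_0 \<Omega>" and g: "has_weak_grad \<Omega> \<phi> g"
    and G: "integrable lborel G" "\<And>x. x \<notin> \<Omega> \<Longrightarrow> G x = 0" "AE x in lebesgue_on \<Omega>. G x = g x"
    and u: "integrable lborel u" "\<And>x. x \<notin> \<Omega> \<Longrightarrow> u x = 0" "AE x in lebesgue_on \<Omega>. u x = \<phi> x"
  shows "sob u G"
  unfolding sob_def
proof (intro conjI allI impI u(1) G(1))
  have \<Omega>': "\<Omega> \<in> sets lebesgue"
    using \<Omega> by (simp add: lmeasurable_open)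
  fix e :: real assume e: "0 < e"
  obtain \<psi> :: "nat \<Rightarrow> 'a \<Rightarrow> real" where \<psi>: "\<And>k. \<psi> k \<in> Cc_infinity \<Omega>"
    and lim: "(\<lambda>k. W11_norm \<Omega> (\<lambda>x. \<psi> k x - \<phi> x)) \<longlonglongrightarrow> 0"
    using \<phi> unfolding W11_0_def by auto
  have "\<forall>\<^sub>F k in sequentially. W11_norm \<Omega> (\<lambda>x. \<psi> k x - \<phi> x) < ennreal e"
    by (rule order_tendstoD(2)[OF lim]) (use e in simp)
  then obtain k where k: "W11_norm \<Omega> (\<lambda>x. \<psi> k x - \<phi> x) < ennreal e"
    by (auto simp: eventually_sequentially)
  note C = Cc_infinity_C1c[OF \<psi>[of k]]
  note z = Cc_infinity_zero_outside[OF \<psi>[of k]]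
  have d1: "integrable lborel (\<lambda>x. \<psi> k x - u x)"
    by (intro Bochner_Integration.integrable_diff C1c_integrable(1)[OF C] u(1))
  have d2: "integrable lborel (\<lambda>x. grad (\<psi> k) x - G x)"
    by (intro Bochner_Integration.integrable_diff C1c_integrable(2)[OF C] G(1))
  have "AE x in lebesgue_on \<Omega>. \<psi> k x - \<phi> x = \<psi> k x - u x"
    using u(3) by eventually_elim simp
  then have L1: "L1_norm \<Omega> (\<lambda>x. \<psi> k x - \<phi> x) = ennreal (\<integral>x. norm (\<psi> k x - u x) \<partial>lborel)"
    by (intro L1_norm_lborel[OF \<Omega>' d1]) (simp_all add: z u(2))
  have "AE x in lebesgue_on \<Omega>. weak_grad \<Omega> (\<lambda>x. \<psi> k x - \<phi> x) x = grad (\<psi> k) x - g x"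
    by (rule weak_grad_AE[OF \<Omega> has_weak_grad_diff[OF \<Omega> Cc_infinity_has_weak_grad[OF \<Omega> \<psi>] g]])
  then have "AE x in lebesgue_on \<Omega>. weak_grad \<Omega> (\<lambda>x. \<psi> k x - \<phi> x) x = grad (\<psi> k) x - G x"
    using G(3) by eventually_elim simp
  then have L2: "L1_norm \<Omega> (weak_grad \<Omega> (\<lambda>x. \<psi> k x - \<phi> x)) = ennreal (\<integral>x. norm (grad (\<psi> k) x - G x) \<partial>lborel)"
    by (intro L1_norm_lborel[OF \<Omega>' d2]) (simp_all add: z G(2))
  have nn: "0 \<le> (\<integral>x. norm (\<psi> k x - u x) \<partial>lborel)" "0 \<le> (\<integral>x. norm (grad (\<psi> k) x - G x) \<partial>lborel)"
    by simp_all
  have "(\<integral>x. norm (\<psi> k x - u x) \<partial>lborel) + (\<integral>x. norm (grad (\<psi> k) x - G x) \<partial>lborel) < e"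
    using k e nn unfolding W11_norm_def L1 L2 by (simp add: ennreal_plus[symmetric] ennreal_less_iff del: ennreal_plus)
  with nn have "(\<integral>x. norm (\<psi> k x - u x) \<partial>lborel) < e" "(\<integral>x. norm (grad (\<psi> k) x - G x) \<partial>lborel) < e"
    by linarith+
  with C show "\<exists>\<psi> D. C1c \<psi> D \<and> (\<integral>x. norm (\<psi> x - u x) \<partial>lborel) < e \<and> (\<integral>x. norm (D x - G x) \<partial>lborel) < e"
    by (intro exI[of _ "\<psi> k"] exI[of _ "grad (\<psi> k)"] conjI)
qed

text \<open>The tangent at \<open>t0\<close> of a convex power, read off from Young's inequality
  with the conjugate exponents \<open>s\<close> and \<open>s / (s - 1)\<close>.\<close>

lemma powr_tangent_le:
  fixes s t t0 :: real
  assumes "1 < s" "0 \<le> t" "0 \<le> t0"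
  shows "t0 powr s + s * t0 powr (s - 1) * (t - t0) \<le> t powr s"
proof -
  have "t * t0 powr (s - 1) \<le> t powr s / s + (t0 powr (s - 1)) powr (s / (s - 1)) / (s / (s - 1))"
    using assms by (intro Youngs_inequality) (auto simp: field_simps)
  also have "(t0 powr (s - 1)) powr (s / (s - 1)) = t0 powr s"
    using assms by (simp add: powr_powr)
  finally have "s * (t * t0 powr (s - 1)) \<le> t powr s + (s - 1) * t0 powr s"
    using assms by (simp add: field_simps)
  moreover have "t0 powr s = t0 powr (s - 1) * t0"
    using assms powr_add[of t0 "s - 1" 1] by (cases "t0 = 0") auto
  ultimately show ?thesis
    by (simp add: algebra_simps)
qed

text \<open>Jensen's inequality for the probability density \<open>\<rho> (x - y)\<close>: the
  tangent at the mean \<open>t0\<close> of \<open>norm (G y)\<close> is integrated. The factor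
  \<open>m\<close> and the majorant \<open>h\<close> are included so that a lower bound for a
  weight, valid only on the support of the kernel, can be used.\<close>

lemma conv_jensen:
  fixes G :: "'a::euclidean_space \<Rightarrow> 'b::euclidean_space" and h :: "'a \<Rightarrow> real"
  assumes k: "kernel \<rho> c r" and G: "integrable lborel G" and h: "integrable lborel h"
    and s: "1 < s" and m: "0 \<le> m"
    and le: "AE y in lborel. \<rho> (x - y) \<noteq> 0 \<longrightarrow> m * norm (G y) powr s \<le> h y"
  shows "m * norm (conv \<rho> G x) powr s \<le> conv \<rho> h x"
proof -
  note C = kernel_C1c[OF k]
  have \<rho>0: "0 \<le> \<rho> y" for y using k by (simp add: kernel_def)
  define t0 where "t0 = (\<integral>y. \<rho> (x - y) * norm (G y) \<partial>lborel)"
  have i1: "integrable lborel (\<lambda>y. \<rho> (x - y) * norm (G y))"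
    using conv_integrable[OF C integrable_norm[OF G]] by simp
  note i0 = kernel_integral_reflect[OF k, of x]
  have nt: "norm (conv \<rho> G x) \<le> t0"
  proof -
    have "norm (conv \<rho> G x) \<le> (\<integral>y. norm (\<rho> (x - y) *\<^sub>R G y) \<partial>lborel)"
      unfolding conv_def by (rule integral_norm_bound)
    then show ?thesis
      using \<rho>0 by (simp add: t0_def)
  qed
  have t0: "0 \<le> t0"
    using nt norm_ge_zero order_trans by blast
  define b where "b = s * t0 powr (s - 1)"
  have lin: "(\<lambda>y. \<rho> (x - y) * (m * (t0 powr s + b * (norm (G y) - t0)))) =
      (\<lambda>y. (m * (t0 powr s - b * t0)) * \<rho> (x - y) + (m * b) * (\<rho> (x - y) * norm (G y)))"
    by (simp add: fun_eq_iff algebra_simps)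
  have "m * norm (conv \<rho> G x) powr s \<le> m * t0 powr s"
    using m nt s by (intro mult_left_mono powr_mono2) auto
  also have "\<dots> = (\<integral>y. \<rho> (x - y) * (m * (t0 powr s + b * (norm (G y) - t0))) \<partial>lborel)"
    unfolding lin using i0 i1 by (simp add: t0_def algebra_simps)
  also have "\<dots> \<le> (\<integral>y. \<rho> (x - y) *\<^sub>R h y \<partial>lborel)"
  proof (rule integral_mono_AE)
    show "integrable lborel (\<lambda>y. \<rho> (x - y) * (m * (t0 powr s + b * (norm (G y) - t0))))"
      unfolding lin using i0 i1 by simp
    show "integrable lborel (\<lambda>y. \<rho> (x - y) *\<^sub>R h y)"
      by (rule conv_integrable[OF C h])
    show "AE y in lborel. \<rho> (x - y) * (m * (t0 powr s + b * (norm (G y) - t0))) \<le> \<rho> (x - y) *\<^sub>R h y"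
      using le
    proof eventually_elim
      fix y assume y: "\<rho> (x - y) \<noteq> 0 \<longrightarrow> m * norm (G y) powr s \<le> h y"
      show "\<rho> (x - y) * (m * (t0 powr s + b * (norm (G y) - t0))) \<le> \<rho> (x - y) *\<^sub>R h y"
      proof (cases "\<rho> (x - y) = 0")
        case False
        have "m * (t0 powr s + b * (norm (G y) - t0)) \<le> m * norm (G y) powr s"
          unfolding b_def by (intro mult_left_mono m powr_tangent_le s t0 norm_ge_zero)
        also have "\<dots> \<le> h y" using y False by simp
        finally show ?thesis
          using \<rho>0 by (simp add: mult_left_mono)
      qed simp
    qed
  qed
  finally show ?thesis by (simp add: conv_def)
qed

text \<open>Estimates are made for this integral, which is compatible with pointwise bounds and
  limits; \<open>luxemburg_norm_le\<close> returns to the norm at the end.\<close>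

definition modular :: "'a::euclidean_space set \<Rightarrow> real \<Rightarrow> real \<Rightarrow> ('a \<Rightarrow> real) \<Rightarrow> ('a \<Rightarrow> 'a) \<Rightarrow> ennreal" where
  "modular \<Omega> p q a \<xi> = (\<integral>\<^sup>+x. ennreal (double_phase p q a x (norm (\<xi> x))) \<partial>lebesgue_on \<Omega>)"

section \<open>Pointwise estimates for the double phase integrand\<close>

lemma powr_add_le:
  fixes s t r :: real
  assumes "0 \<le> s" "0 \<le> t" "0 \<le> r"
  shows "(s + t) powr r \<le> 2 powr r * (s powr r + t powr r)"
proof -
  have "(s + t) powr r \<le> (2 * max s t) powr r"
    using assms by (intro powr_mono2) auto
  also have "\<dots> = 2 powr r * (max s t) powr r"
    using assms by (simp add: powr_mult)
  also have "\<dots> \<le> 2 powr r * (s powr r + t powr r)"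
    by (intro mult_left_mono) (auto simp: max_def)
  finally show ?thesis .
qed

lemma double_phase_nonneg: "0 \<le> a x \<Longrightarrow> 0 \<le> double_phase p q a x t"
  by (simp add: double_phase_def)

lemma double_phase_mono:
  assumes "0 \<le> a x" "0 \<le> p" "0 \<le> q" "0 \<le> s" "s \<le> t"
  shows "double_phase p q a x s \<le> double_phase p q a x t"
  unfolding double_phase_def using assms by (intro add_mono mult_left_mono powr_mono2) auto

lemma double_phase_add_le:
  assumes "0 \<le> a x" "0 \<le> p" "p \<le> q" "0 \<le> s" "0 \<le> t"
  shows "double_phase p q a x (s + t) \<le> 2 powr q * (double_phase p q a x s + double_phase p q a x t)"
proof -
  have "(s + t) powr p \<le> 2 powr p * (s powr p + t powr p)"
    using assms by (intro powr_add_le) auto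
  also have "\<dots> \<le> 2 powr q * (s powr p + t powr p)"
    using assms by (intro mult_right_mono powr_mono) auto
  finally have "(s + t) powr p \<le> 2 powr q * (s powr p + t powr p)" .
  moreover have "a x * (s + t) powr q \<le> a x * (2 powr q * (s powr q + t powr q))"
    using assms by (intro mult_left_mono powr_add_le) auto
  ultimately show ?thesis
    unfolding double_phase_def by (simp add: algebra_simps)
qed

lemma double_phase_norm_add_le:
  assumes "0 \<le> a x" "0 \<le> p" "p \<le> q"
  shows "double_phase p q a x (norm (v + w)) \<le>
    2 powr q * (double_phase p q a x (norm v) + double_phase p q a x (norm w))"
  using assms by (intro order_trans[OF double_phase_mono double_phase_add_le] norm_triangle_ineq) auto

text \<open>The gradient \<open>E\<close> of the kernel has integral zero, so the constant
  \<open>v x\<close> can be subtracted. The gradient of a mollification is thereby controlled by the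
  oscillation of \<open>v\<close> instead of its size.\<close>

lemma integral_grad_zero_conv:
  fixes v :: "'a::euclidean_space \<Rightarrow> real"
  assumes C: "C1c k E" and v: "integrable lborel v"
  shows "(\<integral>y. v y *\<^sub>R E (x - y) \<partial>lborel) = (\<integral>y. (v y - v x) *\<^sub>R E (x - y) \<partial>lborel)"
proof -
  have i: "integrable lborel (\<lambda>y. E (x - y))"
    by (rule lborel_integrable_reflect[OF C1c_integrable(2)[OF C]])
  have "(\<integral>y. (v y - v x) *\<^sub>R E (x - y) \<partial>lborel) =
      (\<integral>y. v y *\<^sub>R E (x - y) \<partial>lborel) - (\<integral>y. v x *\<^sub>R E (x - y) \<partial>lborel)"
    unfolding scaleR_diff_left
    by (intro Bochner_Integration.integral_diff conv_grad_integrable[OF C v] integrable_scaleR_right i)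
  also have "(\<integral>y. v x *\<^sub>R E (x - y) \<partial>lborel) = 0"
    using lborel_integral_reflect[OF C1c_measurable(2)[OF C], of x] C1c_integral_gradient[OF C] by simp
  finally show ?thesis by simp
qed

lemma conv_gradient_bound:
  assumes v: "sob v G" and k: "kernel \<rho> c r" and osc: "\<And>x y. dist x y \<le> norm c + r \<Longrightarrow> \<bar>v x - v y\<bar> \<le> A"
  shows "norm (conv \<rho> G x) \<le> A * (\<integral>y. norm (grad \<rho> y) \<partial>lborel)"
proof -
  note C = kernel_C1c[OF k] and iv = sob_integrable[OF v]
  \<comment> \<open>The gradient of the kernel vanishes outside the supporting ball, so only
    differences of \<open>v\<close> over the reach of the kernel occur.\<close>
  have E: "norm (x - y) \<le> norm c + r" if "grad \<rho> (x - y) \<noteq> 0" for y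
  proof -
    have "C1 \<rho> (grad \<rho>)" using C by (simp add: C1c_def)
    moreover have "\<rho> z = 0" if "z \<notin> cball c r" for z
      using k that by (simp add: kernel_def)
    ultimately have "x - y \<in> cball c r"
      using C1_zero_outside_closed[OF _ closed_cball, of \<rho> "grad \<rho>" c r "x - y"] that by metis
    then show ?thesis
      using norm_triangle_sub[of "x - y" c] by (simp add: dist_norm norm_minus_commute)
  qed
  have "conv \<rho> G x = (\<integral>y. (v y - v x) *\<^sub>R grad \<rho> (x - y) \<partial>lborel)"
    using sob_conv_gradient[OF v C, of x] integral_grad_zero_conv[OF C iv(1), of x] by simp
  also have "norm \<dots> \<le> (\<integral>y. A * norm (grad \<rho> (x - y)) \<partial>lborel)"
  proof (rule Bochner_Integration.integral_norm_bound_integral)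
    show "integrable lborel (\<lambda>y. (v y - v x) *\<^sub>R grad \<rho> (x - y))"
      unfolding scaleR_diff_left
      by (intro Bochner_Integration.integrable_diff conv_grad_integrable[OF C iv(1)] integrable_scaleR_right
          lborel_integrable_reflect[OF C1c_integrable(2)[OF C]])
    show "integrable lborel (\<lambda>y. A * norm (grad \<rho> (x - y)))"
      by (intro integrable_mult_right integrable_norm lborel_integrable_reflect[OF C1c_integrable(2)[OF C]])
    fix y
    show "norm ((v y - v x) *\<^sub>R grad \<rho> (x - y)) \<le> A * norm (grad \<rho> (x - y))"
    proof (cases "grad \<rho> (x - y) = 0")
      case False
      then have "\<bar>v y - v x\<bar> \<le> A"
        using E[of y] osc[of y x] by (simp add: dist_norm norm_minus_commute)
      then show ?thesis
        by (simp add: mult_right_mono)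
    qed simp
  qed
  also have "\<dots> = A * (\<integral>y. norm (grad \<rho> y) \<partial>lborel)"
    using lborel_integral_reflect[of "\<lambda>y. norm (grad \<rho> y)" x] C1c_measurable(2)[OF C] by simp
  finally show ?thesis .
qed

text \<open>The weight at \<open>x\<close> is split as \<open>a x \<le> Z * (m + \<epsilon>)\<close> with \<open>m \<le> a y\<close> at every point \<open>y\<close> of the
  averaging ball, so that Jensen's inequality applies to \<open>m\<close>, while \<open>\<epsilon>\<close> is absorbed by the
  gradient bound \<open>A\<close>.\<close>

lemma double_phase_conv_le:
  fixes G :: "'a::euclidean_space \<Rightarrow> 'b::euclidean_space"
  assumes k: "kernel \<rho> c r" and G: "integrable lborel G" "\<And>y. y \<notin> \<Omega> \<Longrightarrow> G y = 0"
    and h: "integrable lborel h" "AE y in lborel. h y = indicator \<Omega> y * double_phase p q a y (norm (G y))"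
    and pq: "1 < p" "p < q" and a0: "\<And>y. y \<in> \<Omega> \<Longrightarrow> 0 \<le> a y" and Z: "0 < Z" and \<epsilon>: "0 \<le> \<epsilon>"
    and a: "\<And>y. y \<in> \<Omega> \<Longrightarrow> norm (x - y) \<le> norm c + r \<Longrightarrow> a x \<le> Z * (a y + \<epsilon>)" and x: "x \<in> \<Omega>"
    and A: "norm (conv \<rho> G x) \<le> A"
  shows "double_phase p q a x (norm (conv \<rho> G x)) \<le> (1 + Z + Z * (\<epsilon> * A powr (q - p))) * conv \<rho> h x"
proof -
  define t where "t = norm (conv \<rho> G x)"
  have t: "0 \<le> t" "t \<le> A" using A by (simp_all add: t_def)
  \<comment> \<open>The lower bound for the weight on the reach of the kernel that the hypothesis
    \<open>a\<close> yields when solved for \<open>a y\<close>; the maximum keeps it nonnegative, as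
    Jensen requires.\<close>
  define m where "m = max 0 (a x / Z - \<epsilon>)"
  have m: "0 \<le> m" "a x \<le> Z * (m + \<epsilon>)"
    using Z by (auto simp: m_def max_def field_simps)
  have my: "m \<le> a y" if "y \<in> \<Omega>" "norm (x - y) \<le> norm c + r" for y
    using a[OF that] a0[OF that(1)] Z by (auto simp: m_def field_simps)
  \<comment> \<open>The first phase carries no weight, so Jensen applies with
    \<open>m = 1\<close>.\<close>
  have P: "1 * t powr p \<le> conv \<rho> h x"
    unfolding t_def
  proof (rule conv_jensen[OF k G(1) h(1) pq(1)])
    show "AE y in lborel. \<rho> (x - y) \<noteq> 0 \<longrightarrow> 1 * norm (G y) powr p \<le> h y"
      using h(2)
    proof eventually_elim
      fix y assume "h y = indicator \<Omega> y * double_phase p q a y (norm (G y))"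
      then show "\<rho> (x - y) \<noteq> 0 \<longrightarrow> 1 * norm (G y) powr p \<le> h y"
        using G(2)[of y] a0[of y] by (cases "y \<in> \<Omega>") (auto simp: double_phase_def)
    qed
  qed simp
  have Q: "m * t powr q \<le> conv \<rho> h x"
    unfolding t_def
  proof (rule conv_jensen[OF k G(1) h(1)])
    show "AE y in lborel. \<rho> (x - y) \<noteq> 0 \<longrightarrow> m * norm (G y) powr q \<le> h y"
      using h(2)
    proof eventually_elim
      fix y assume hy: "h y = indicator \<Omega> y * double_phase p q a y (norm (G y))"
      show "\<rho> (x - y) \<noteq> 0 \<longrightarrow> m * norm (G y) powr q \<le> h y"
      proof
        assume "\<rho> (x - y) \<noteq> 0"
        note n = kernel_support[OF k this]
        show "m * norm (G y) powr q \<le> h y"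
        proof (cases "y \<in> \<Omega>")
          case True
          then have "m * norm (G y) powr q \<le> a y * norm (G y) powr q"
            by (intro mult_right_mono my n) auto
          also have "\<dots> \<le> h y"
            using True by (simp add: hy double_phase_def)
          finally show ?thesis .
        qed (simp add: hy G(2))
      qed
    qed
  qed (use pq m in auto)
  \<comment> \<open>The part of the weight not covered by \<open>m\<close> is paid by the surplus
    power \<open>q - p\<close>, which the gradient bound \<open>A\<close> estimates by a
    constant.\<close>
  have "t powr q = t powr (q - p) * t powr p"
    by (simp add: powr_add[symmetric])
  also have "\<dots> \<le> A powr (q - p) * t powr p"
    using t pq by (intro mult_right_mono powr_mono2) auto
  also have "\<dots> \<le> A powr (q - p) * conv \<rho> h x"
    using P by (intro mult_left_mono) auto
  finally have R: "t powr q \<le> A powr (q - p) * conv \<rho> h x" .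
  have "a x * t powr q \<le> Z * (m + \<epsilon>) * t powr q"
    by (intro mult_right_mono m) simp
  also have "\<dots> = Z * (m * t powr q) + Z * (\<epsilon> * t powr q)"
    by (simp add: algebra_simps)
  also have "\<dots> \<le> Z * conv \<rho> h x + Z * (\<epsilon> * (A powr (q - p) * conv \<rho> h x))"
    using Z \<epsilon> Q R by (intro add_mono mult_left_mono) auto
  finally show ?thesis
    using P unfolding double_phase_def t_def[symmetric] by (simp add: algebra_simps)
qed

section \<open>Convergence of the energies of mollifications\<close>

lemma conv_sequence_tendsto:
  fixes f :: "'a::euclidean_space \<Rightarrow> 'b::euclidean_space"
  assumes K: "\<And>k. kernel (K k) (c k) (r k)" and lim: "(\<lambda>k. norm (c k) + r k) \<longlonglongrightarrow> 0"
    and f: "integrable lborel f"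
  shows "(\<lambda>k. \<integral>x. norm (conv (K k) f x - f x) \<partial>lborel) \<longlonglongrightarrow> 0"
proof (rule LIMSEQ_I)
  fix e :: real assume "0 < e"
  obtain d where d: "0 < d"
    "\<And>\<rho> c r. kernel \<rho> c r \<Longrightarrow> norm c + r \<le> d \<Longrightarrow> (\<integral>x. norm (conv \<rho> f x - f x) \<partial>lborel) < e"
    using conv_approximates[OF f \<open>0 < e\<close>] by metis
  have "\<forall>\<^sub>F k in sequentially. norm (c k) + r k < d"
    by (rule order_tendstoD(2)[OF lim d(1)])
  then obtain n0 where n0: "\<forall>k\<ge>n0. norm (c k) + r k < d"
    unfolding eventually_sequentially by (elim exE)
  have "norm ((\<integral>x. norm (conv (K k) f x - f x) \<partial>lborel) - 0) < e" if "n0 \<le> k" for k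
    using d(2)[OF K less_imp_le[OF n0[rule_format, OF that]]] by simp
  then show "\<exists>n0. \<forall>k\<ge>n0. norm ((\<integral>x. norm (conv (K k) f x - f x) \<partial>lborel) - 0) < e"
    by (intro exI[of _ n0]) simp
qed

lemma conv_nonneg:
  assumes "kernel \<rho> c r" "AE y in lborel. 0 \<le> h y"
  shows "0 \<le> conv \<rho> (h :: _ \<Rightarrow> real) x"
  unfolding conv_def
  by (rule integral_nonneg_AE) (use assms(2) in eventually_elim, use assms(1) in \<open>simp add: kernel_def\<close>)

lemma ZclassD:
  assumes "a \<in> Zclass \<kappa> \<Omega>"
  shows "a \<in> borel_measurable (lebesgue_on \<Omega>)" "\<And>x. x \<in> \<Omega> \<Longrightarrow> 0 \<le> a x"
    "\<exists>Z>0. \<forall>x\<in>\<Omega>. \<forall>y\<in>\<Omega>. a x \<le> Z * (a y + norm (x - y) powr \<kappa>)"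
  using assms by (simp_all add: Zclass_def)

lemma double_phase_measurable:
  fixes \<xi> :: "'a::euclidean_space \<Rightarrow> 'b::euclidean_space"
  assumes [measurable]: "a \<in> borel_measurable M" "\<xi> \<in> borel_measurable M"
  shows "(\<lambda>x. double_phase p q a x (norm (\<xi> x))) \<in> borel_measurable M"
  unfolding double_phase_def by measurable

lemma measurable_lebesgue_on:
  "f \<in> borel_measurable borel \<Longrightarrow> f \<in> borel_measurable (lebesgue_on \<Omega>)"
  by (intro measurable_restrict_space1 measurable_completion) simp

lemma double_phase_integrable:
  fixes \<xi> :: "'a::euclidean_space \<Rightarrow> 'a"
  assumes a: "a \<in> Zclass \<kappa> \<Omega>" and \<xi>: "\<xi> \<in> borel_measurable (lebesgue_on \<Omega>)"
    and fin: "modular \<Omega> p q a \<xi> < \<infinity>"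
  shows "integrable (lebesgue_on \<Omega>) (\<lambda>x. double_phase p q a x (norm (\<xi> x)))"
proof (rule integrableI_nonneg)
  show "(\<lambda>x. double_phase p q a x (norm (\<xi> x))) \<in> borel_measurable (lebesgue_on \<Omega>)"
    by (rule double_phase_measurable[OF ZclassD(1)[OF a] \<xi>])
  show "AE x in lebesgue_on \<Omega>. 0 \<le> double_phase p q a x (norm (\<xi> x))"
    by (rule AE_I2) (simp add: double_phase_nonneg ZclassD(2)[OF a])
qed (use fin in \<open>simp add: modular_def\<close>)

text \<open>With kernels of size \<open>\<delta>\<close> the gradient of the mollification is of order \<open>\<delta> powr (\<gamma> - 1)\<close> and the
  oscillation of the weight of order \<open>\<delta> powr \<kappa>\<close>; the balance condition keeps their
  combination bounded.\<close>

lemma exponent_balance: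
  fixes \<delta> N H C p q \<gamma> \<kappa> :: real
  assumes "0 < \<delta>" "\<delta> \<le> 1" "0 < N" "0 \<le> H" "0 \<le> C" "(q - p) * (1 - \<gamma>) \<le> \<kappa>"
  shows "(\<delta> * N) powr \<kappa> * (H * (\<delta> * N) powr \<gamma> * (C / \<delta>)) powr (q - p)
    \<le> N powr \<kappa> * (H * C * N powr \<gamma>) powr (q - p)"
proof -
  have "H * (\<delta> * N) powr \<gamma> * (C / \<delta>) = (H * C * N powr \<gamma>) * \<delta> powr (\<gamma> - 1)"
    using assms by (simp add: powr_mult powr_diff field_simps)
  then have "(\<delta> * N) powr \<kappa> * (H * (\<delta> * N) powr \<gamma> * (C / \<delta>)) powr (q - p) =
      (N powr \<kappa> * (H * C * N powr \<gamma>) powr (q - p)) * (\<delta> powr \<kappa> * \<delta> powr ((\<gamma> - 1) * (q - p)))"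
    using assms by (simp add: powr_mult powr_powr mult_ac)
  also have "\<delta> powr \<kappa> * \<delta> powr ((\<gamma> - 1) * (q - p)) = \<delta> powr (\<kappa> + (\<gamma> - 1) * (q - p))"
    by (simp add: powr_add)
  \<comment> \<open>The total exponent of \<delta> is nonnegative by the balance condition, and
    \<open>\<delta> \<le> 1\<close>.\<close>
  also have "(N powr \<kappa> * (H * C * N powr \<gamma>) powr (q - p)) * \<dots> \<le>
      (N powr \<kappa> * (H * C * N powr \<gamma>) powr (q - p)) * 1"
    using assms by (intro mult_left_mono powr_le1) (auto simp: algebra_simps)
  finally show ?thesis by simp
qed

lemma double_phase_tendsto_0:
  assumes "t \<longlonglongrightarrow> 0" "\<And>n. 0 \<le> t n" "0 < p" "0 < q"
  shows "(\<lambda>n. double_phase p q a x (t n)) \<longlonglongrightarrow> 0"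
proof -
  have "(\<lambda>n. t n powr p) \<longlonglongrightarrow> 0" "(\<lambda>n. t n powr q) \<longlonglongrightarrow> 0"
    using assms by (intro tendsto_zero_powrI[OF _ tendsto_const]; simp)+
  then have "(\<lambda>n. t n powr p + a x * t n powr q) \<longlonglongrightarrow> 0 + a x * 0"
    by (intro tendsto_add tendsto_mult tendsto_const)
  then show ?thesis
    by (simp add: double_phase_def)
qed

lemma modular_eq_lebesgue:
  assumes "\<Omega> \<in> sets lebesgue"
  shows "modular \<Omega> p q a \<xi> = (\<integral>\<^sup>+x. ennreal (indicator \<Omega> x * double_phase p q a x (norm (\<xi> x))) \<partial>lebesgue)"
proof -
  have "modular \<Omega> p q a \<xi> = (\<integral>\<^sup>+x. ennreal (double_phase p q a x (norm (\<xi> x))) * indicator \<Omega> x \<partial>lebesgue)"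
    unfolding modular_def using assms by (intro nn_integral_restrict_space) simp
  also have "\<dots> = (\<integral>\<^sup>+x. ennreal (indicator \<Omega> x * double_phase p q a x (norm (\<xi> x))) \<partial>lebesgue)"
    by (intro nn_integral_cong) (simp add: indicator_def)
  finally show ?thesis .
qed

text \<open>Dominated convergence with majorants \<open>hk n\<close> that vary but converge in L^1.
  The integrand is split into a multiple of \<open>\<bar>hk n - h\<bar>\<close>, whose integral
  tends to 0, and its minimum with a fixed multiple of \<open>h\<close>, to which ordinary dominated
  convergence applies.\<close>

lemma energy_convergence:
  fixes G :: "'a::euclidean_space \<Rightarrow> 'a"
  assumes \<Omega>: "open \<Omega>" and a: "a \<in> Zclass \<kappa> \<Omega>" and pq: "0 < p" "p \<le> q"
    and G: "integrable lborel G" and F: "\<And>n. integrable lborel (F n)"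
    and h: "integrable lborel h" "AE y in lborel. h y = indicator \<Omega> y * double_phase p q a y (norm (G y))"
    and hk: "\<And>n. integrable lborel (hk n)" "(\<lambda>n. \<integral>x. norm (hk n x - h x) \<partial>lborel) \<longlonglongrightarrow> 0"
    and lim: "AE x in lborel. (\<lambda>n. F n x - G x) \<longlonglongrightarrow> 0"
    and le: "\<And>n. AE x in lborel. x \<in> \<Omega> \<longrightarrow> double_phase p q a x (norm (F n x)) \<le> K * hk n x" and K: "0 \<le> K"
  shows "(\<lambda>n. modular \<Omega> p q a (\<lambda>x. F n x - G x)) \<longlonglongrightarrow> 0"
proof -
  have \<Omega>': "\<Omega> \<in> sets lebesgue"
    using \<Omega> by (simp add: lmeasurable_open)
  note a0 = ZclassD(2)[OF a]
  define f where "f n x = indicator \<Omega> x * double_phase p q a x (norm (F n x - G x))" for n x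
  have f0: "0 \<le> f n x" for n x
    by (cases "x \<in> \<Omega>") (simp_all add: f_def double_phase_nonneg a0)
  have meas: "G \<in> borel_measurable borel" "F n \<in> borel_measurable borel" "h \<in> borel_measurable borel"
    "hk n \<in> borel_measurable borel" for n
    using borel_measurable_integrable[OF G] borel_measurable_integrable[OF F[of n]]
      borel_measurable_integrable[OF h(1)] borel_measurable_integrable[OF hk(1)[of n]] by simp_all
  have fm: "f n \<in> borel_measurable lebesgue" for n
  proof -
    have "(\<lambda>x. double_phase p q a x (norm (F n x - G x))) \<in> borel_measurable (lebesgue_on \<Omega>)"
      by (intro double_phase_measurable ZclassD(1)[OF a] measurable_lebesgue_on borel_measurable_diff meas)
    then show ?thesis
      using \<Omega>' by (simp add: borel_measurable_restrict_space_iff f_def[abs_def])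
  qed
  \<comment> \<open>After the factor \<open>2 powr q\<close> from the triangle inequality,
    \<open>F n\<close> contributes \<open>K * hk n\<close> and \<open>G\<close> contributes
    \<open>h\<close>; their sum is \<open>K * (hk n - h) + (K + 1) * h\<close>.\<close>
  define B1 where "B1 = 2 powr q * K"
  define B2 where "B2 = 2 powr q * (K + 1)"
  have B: "0 \<le> B1" "0 \<le> B2" using K by (simp_all add: B1_def B2_def)
  have hL: "integrable lebesgue h" and hkL: "integrable lebesgue (hk n)" for n
    using h(1) hk(1) meas by (simp_all add: integrable_completion)
  have hae: "AE x in lebesgue. h x = indicator \<Omega> x * double_phase p q a x (norm (G x))"
    using h(2) by (rule AE_completion)
  have h0: "AE x in lebesgue. 0 \<le> h x"
    using hae
  proof eventually_elim
    fix x assume "h x = indicator \<Omega> x * double_phase p q a x (norm (G x))"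
    then show "0 \<le> h x"
      by (cases "x \<in> \<Omega>") (simp_all add: double_phase_nonneg a0)
  qed
  \<comment> \<open>If \<open>f n x\<close> is below \<open>B2 * h x\<close> the minimum is
    \<open>f n x\<close> itself; otherwise the excess over \<open>B2 * h x\<close> is covered by the
    first term.\<close>
  have bound: "AE x in lebesgue. f n x \<le> B1 * norm (hk n x - h x) + min (f n x) (B2 * h x)" for n
    using hae AE_completion[OF le[of n]]
  proof eventually_elim
    fix x assume hx: "h x = indicator \<Omega> x * double_phase p q a x (norm (G x))"
      and le: "x \<in> \<Omega> \<longrightarrow> double_phase p q a x (norm (F n x)) \<le> K * hk n x"
    show "f n x \<le> B1 * norm (hk n x - h x) + min (f n x) (B2 * h x)"
    proof (cases "x \<in> \<Omega>")
      case True
      have "f n x = double_phase p q a x (norm (F n x + - G x))"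
        using True by (simp add: f_def)
      also have "\<dots> \<le> 2 powr q * (double_phase p q a x (norm (F n x)) + double_phase p q a x (norm (- G x)))"
        by (rule double_phase_norm_add_le) (use True a0 pq in auto)
      also have "\<dots> \<le> 2 powr q * (K * hk n x + h x)"
        using le True by (intro mult_left_mono add_mono) (auto simp: hx)
      also have "\<dots> = B1 * (hk n x - h x) + B2 * h x"
        by (simp add: B1_def B2_def algebra_simps)
      also have "\<dots> \<le> B1 * norm (hk n x - h x) + B2 * h x"
        using B by (intro add_right_mono mult_left_mono) auto
      finally have "f n x \<le> B1 * norm (hk n x - h x) + B2 * h x" .
      moreover have "0 \<le> B1 * norm (hk n x - h x)"
        using B by simp
      ultimately show ?thesis by linarith
    next
      case False
      then have "f n x = 0" "h x = 0" by (simp_all add: f_def hx)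
      then show ?thesis using B by simp
    qed
  qed
  have mm: "(\<lambda>x. min (f n x) (B2 * h x)) \<in> borel_measurable lebesgue" for n
    by (intro borel_measurable_min fm borel_measurable_times borel_measurable_const borel_measurable_integrable[OF hL])
  have dom: "AE x in lebesgue. norm (min (f n x) (B2 * h x)) \<le> B2 * h x" for n
    using h0
  proof eventually_elim
    fix x assume "0 \<le> h x"
    then have "0 \<le> B2 * h x" using B by simp
    then show "norm (min (f n x) (B2 * h x)) \<le> B2 * h x"
      using f0[of n x] by simp
  qed
  have B2h: "integrable lebesgue (\<lambda>x. B2 * h x)"
    using hL by simp
  have flim: "AE x in lebesgue. (\<lambda>n. min (f n x) (B2 * h x)) \<longlonglongrightarrow> 0"
    using AE_completion[OF lim] h0
  proof eventually_elim
    fix x assume x: "(\<lambda>n. F n x - G x) \<longlonglongrightarrow> 0" and hx: "0 \<le> h x"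
    have "(\<lambda>n. norm (F n x - G x)) \<longlonglongrightarrow> 0"
      using x by (rule tendsto_norm_zero)
    then have "(\<lambda>n. double_phase p q a x (norm (F n x - G x))) \<longlonglongrightarrow> 0"
      by (rule double_phase_tendsto_0) (use pq in auto)
    then have "(\<lambda>n. indicator \<Omega> x * double_phase p q a x (norm (F n x - G x))) \<longlonglongrightarrow> indicator \<Omega> x * 0"
      by (intro tendsto_mult tendsto_const)
    then have "(\<lambda>n. f n x) \<longlonglongrightarrow> 0"
      by (simp add: f_def)
    from tendsto_min[OF this tendsto_const, of "B2 * h x"]
    show "(\<lambda>n. min (f n x) (B2 * h x)) \<longlonglongrightarrow> 0"
      using hx B by simp
  qed
  have minlim: "(\<lambda>n. \<integral>x. min (f n x) (B2 * h x) \<partial>lebesgue) \<longlonglongrightarrow> (\<integral>x. 0 \<partial>(lebesgue :: 'a measure))"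
    by (rule integral_dominated_convergence[OF _ mm B2h flim dom]) simp
  have mi: "integrable lebesgue (\<lambda>x. min (f n x) (B2 * h x))" for n
    by (rule Bochner_Integration.integrable_bound[OF B2h mm])
      (use dom[of n] in eventually_elim, simp)
  have ni: "integrable lebesgue (\<lambda>x. norm (hk n x - h x))" for n
    by (intro integrable_norm Bochner_Integration.integrable_diff hL hkL)
  have eqL: "(\<integral>x. norm (hk n x - h x) \<partial>lebesgue) = (\<integral>x. norm (hk n x - h x) \<partial>lborel)" for n
    using meas by (intro integral_completion) simp
  have up: "modular \<Omega> p q a (\<lambda>x. F n x - G x) \<le>
      ennreal (B1 * (\<integral>x. norm (hk n x - h x) \<partial>lborel) + (\<integral>x. min (f n x) (B2 * h x) \<partial>lebesgue))" for n
  proof -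
    have "modular \<Omega> p q a (\<lambda>x. F n x - G x) = (\<integral>\<^sup>+x. ennreal (f n x) \<partial>lebesgue)"
      unfolding f_def by (rule modular_eq_lebesgue[OF \<Omega>'])
    also have "\<dots> \<le> (\<integral>\<^sup>+x. ennreal (B1 * norm (hk n x - h x) + min (f n x) (B2 * h x)) \<partial>lebesgue)"
      by (rule nn_integral_mono_AE) (use bound[of n] in eventually_elim, simp add: ennreal_leI)
    also have "\<dots> = ennreal (\<integral>x. B1 * norm (hk n x - h x) + min (f n x) (B2 * h x) \<partial>lebesgue)"
    proof (rule nn_integral_eq_integral)
      show "integrable lebesgue (\<lambda>x. B1 * norm (hk n x - h x) + min (f n x) (B2 * h x))"
        by (intro Bochner_Integration.integrable_add integrable_mult_right ni mi)
      show "AE x in lebesgue. 0 \<le> B1 * norm (hk n x - h x) + min (f n x) (B2 * h x)"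
        using bound[of n] by eventually_elim (use f0[of n] order_trans in metis)
    qed
    also have "(\<integral>x. B1 * norm (hk n x - h x) + min (f n x) (B2 * h x) \<partial>lebesgue) =
        B1 * (\<integral>x. norm (hk n x - h x) \<partial>lborel) + (\<integral>x. min (f n x) (B2 * h x) \<partial>lebesgue)"
      by (subst Bochner_Integration.integral_add[OF integrable_mult_right[OF ni] mi]) (simp only: integral_mult_right_zero eqL)
    finally show ?thesis .
  qed
  have "(\<lambda>n. ennreal (B1 * (\<integral>x. norm (hk n x - h x) \<partial>lborel) + (\<integral>x. min (f n x) (B2 * h x) \<partial>lebesgue)))
      \<longlonglongrightarrow> ennreal (B1 * 0 + (\<integral>x. 0 \<partial>(lebesgue :: 'a measure)))"
    by (intro tendsto_ennrealI tendsto_add tendsto_mult tendsto_const hk(2) minlim)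
  then have "(\<lambda>n. ennreal (B1 * (\<integral>x. norm (hk n x - h x) \<partial>lborel) + (\<integral>x. min (f n x) (B2 * h x) \<partial>lebesgue)))
      \<longlonglongrightarrow> 0"
    by simp
  from tendsto_sandwich[OF _ _ tendsto_const this] show ?thesis
    using up by (simp add: always_eventually)
qed

text \<open>A single good scale below \<delta>0 is asserted, since convergence is obtained along a
  subsequence on which the gradients converge almost everywhere. The bound \<delta>0 will be the
  range in which the shift leads into the domain.\<close>

lemma energy_mollification:
  fixes v :: "'a::euclidean_space \<Rightarrow> real"
  assumes \<Omega>: "open \<Omega>" and a: "a \<in> Zclass \<kappa> \<Omega>" and pq: "1 < p" "p < q" and \<kappa>: "0 < \<kappa>"
    and v: "sob v G" and G0: "\<And>x. x \<notin> \<Omega> \<Longrightarrow> G x = 0" and fin: "modular \<Omega> p q a G < \<infinity>"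
    and \<gamma>: "0 \<le> \<gamma>" "(q - p) * (1 - \<gamma>) \<le> \<kappa>"
    and H: "0 \<le> H" "\<And>x y. dist x y \<le> 1 \<Longrightarrow> \<bar>v x - v y\<bar> \<le> H * dist x y powr \<gamma>"
    and r: "0 < r" and \<delta>0: "0 < \<delta>0" and e: "0 < e"
  shows "\<exists>\<rho> \<delta>. 0 < \<delta> \<and> \<delta> < \<delta>0 \<and> kernel \<rho> (\<delta> *\<^sub>R c) (\<delta> * r) \<and>
    (\<integral>x. norm (conv \<rho> v x - v x) \<partial>lborel) < e \<and> modular \<Omega> p q a (\<lambda>x. conv \<rho> G x - G x) < ennreal e"
proof (rule mollifier_exists[OF r])
  fix \<rho> :: "real \<Rightarrow> 'a \<Rightarrow> real" and C :: real
  assume C: "0 \<le> C" and \<rho>: "\<And>\<delta>. 0 < \<delta> \<Longrightarrow> kernel (\<rho> \<delta>) (\<delta> *\<^sub>R c) (\<delta> * r)"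
    and \<rho>C: "\<And>\<delta>. 0 < \<delta> \<Longrightarrow> (\<integral>x. norm (grad (\<rho> \<delta>) x) \<partial>lborel) \<le> C / \<delta>"
  note iv = sob_integrable[OF v]
  note a0 = ZclassD(2)[OF a]
  obtain Z where Z: "0 < Z" "\<forall>x\<in>\<Omega>. \<forall>y\<in>\<Omega>. a x \<le> Z * (a y + norm (x - y) powr \<kappa>)"
    using ZclassD(3)[OF a] by (elim exE conjE)
  have Mi: "integrable (lebesgue_on \<Omega>) (\<lambda>x. double_phase p q a x (norm (G x)))"
    by (rule double_phase_integrable[OF a measurable_lebesgue_on[OF iv(4)] fin])
  define N where "N = norm c + r"
  have N: "0 < N" using r by (simp add: N_def add_nonneg_pos)
  \<comment> \<open>The largest scale used: the half makes it strictly less than \<delta>0,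
    \<open>s \<le> 1\<close> is needed for \<open>exponent_balance\<close>, and
    \<open>s * N \<le> 1\<close> keeps the reach of the kernels within the range of the oscillation
    estimate.\<close>
  define s where "s = min (min \<delta>0 1) (1 / N) / 2"
  have s: "0 < s" "s < \<delta>0" "s \<le> 1" "s * N \<le> 1"
  proof -
    define b where "b = min (min \<delta>0 1) (1 / N)"
    have b: "0 < b" "b \<le> \<delta>0" "b \<le> 1" "b \<le> 1 / N" and "s = b / 2"
      using \<delta>0 N by (auto simp: b_def s_def)
    then show "0 < s" "s < \<delta>0" "s \<le> 1"
      by simp_all
    have "s \<le> 1 / N"
      using b(1,4) \<open>s = b / 2\<close> by linarith
    then show "s * N \<le> 1"
      using N by (simp add: field_simps)
  qed
  define d where "d k = s / real (Suc k)" for k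
  have d: "0 < d k" "d k \<le> s" for k
    using s by (auto simp: d_def field_simps)
  have dN: "norm (d k *\<^sub>R c) + d k * r = d k * N" for k
    using d(1)[of k] by (simp add: N_def algebra_simps)
  have dN1: "d k * N \<le> 1" for k
    using mult_right_mono[OF d(2)[of k] less_imp_le[OF N]] s(4) by (rule order_trans)
  have "(\<lambda>k. s * N * inverse (real (Suc k))) \<longlonglongrightarrow> s * N * 0"
    by (intro tendsto_mult tendsto_const LIMSEQ_inverse_real_of_nat)
  then have dlim: "(\<lambda>k. norm (d k *\<^sub>R c) + d k * r) \<longlonglongrightarrow> 0"
    unfolding dN by (simp add: d_def divide_inverse mult_ac)
  \<comment> \<open>The bound from \<open>exponent_balance\<close>, the same for all scales
    \<open>d k\<close>.\<close>
  define B0 where "B0 = N powr \<kappa> * (H * C * N powr \<gamma>) powr (q - p)"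
  have K: "kernel (\<rho> (d k)) (d k *\<^sub>R c) (d k * r)" for k
    by (rule \<rho>[OF d(1)])
  show ?thesis
  proof (rule lebesgue_on_borel_version[OF \<Omega> Mi])
    fix h :: "'a \<Rightarrow> real" assume h: "h \<in> borel_measurable borel" "\<And>x. x \<notin> \<Omega> \<Longrightarrow> h x = 0"
      "AE x in lebesgue_on \<Omega>. h x = double_phase p q a x (norm (G x))" "integrable lborel h"
    have \<Omega>': "\<Omega> \<in> sets lebesgue"
      using \<Omega> by (simp add: lmeasurable_open)
    have hae: "AE x in lborel. h x = indicator \<Omega> x * double_phase p q a x (norm (G x))"
      using h(3)[unfolded AE_lebesgue_on_iff[OF \<Omega>']]
    proof eventually_elim
      fix x assume "x \<in> \<Omega> \<longrightarrow> h x = double_phase p q a x (norm (G x))"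
      then show "h x = indicator \<Omega> x * double_phase p q a x (norm (G x))"
        using h(2)[of x] by (cases "x \<in> \<Omega>") simp_all
    qed
    have h0: "AE x in lborel. 0 \<le> h x"
      using hae
    proof eventually_elim
      fix x assume "h x = indicator \<Omega> x * double_phase p q a x (norm (G x))"
      then show "0 \<le> h x"
        by (cases "x \<in> \<Omega>") (simp_all add: double_phase_nonneg a0)
    qed
    have le: "double_phase p q a x (norm (conv (\<rho> (d k)) G x)) \<le> (1 + Z + Z * B0) * conv (\<rho> (d k)) h x"
      if x: "x \<in> \<Omega>" for x k
    proof -
      define A where "A = H * (d k * N) powr \<gamma> * (C / d k)"
      have A: "norm (conv (\<rho> (d k)) G x) \<le> A"
      proof -
        have "norm (conv (\<rho> (d k)) G x) \<le> (H * (d k * N) powr \<gamma>) * (\<integral>y. norm (grad (\<rho> (d k)) y) \<partial>lborel)"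
        proof (rule conv_gradient_bound[OF v K])
          fix x y :: 'a assume "dist x y \<le> norm (d k *\<^sub>R c) + d k * r"
          then have xy: "dist x y \<le> d k * N" unfolding dN .
          then have "\<bar>v x - v y\<bar> \<le> H * dist x y powr \<gamma>"
            using dN1[of k] by (intro H(2)) simp
          also have "\<dots> \<le> H * (d k * N) powr \<gamma>"
            using xy H(1) \<gamma>(1) by (intro mult_left_mono powr_mono2) auto
          finally show "\<bar>v x - v y\<bar> \<le> H * (d k * N) powr \<gamma>" .
        qed
        also have "\<dots> \<le> A"
          unfolding A_def using H(1) by (intro mult_left_mono \<rho>C d) simp
        finally show ?thesis .
      qed
      have "double_phase p q a x (norm (conv (\<rho> (d k)) G x)) \<le>
          (1 + Z + Z * ((d k * N) powr \<kappa> * A powr (q - p))) * conv (\<rho> (d k)) h x"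
      proof (rule double_phase_conv_le[OF K iv(2) G0 h(4) hae pq a0 Z(1) _ _ x A])
        fix y assume y: "y \<in> \<Omega>" "norm (x - y) \<le> norm (d k *\<^sub>R c) + d k * r"
        have "a x \<le> Z * (a y + norm (x - y) powr \<kappa>)"
          using Z(2) x y(1) by simp
        also have "\<dots> \<le> Z * (a y + (d k * N) powr \<kappa>)"
          using Z(1) y(2) \<kappa> unfolding dN by (intro mult_left_mono add_left_mono powr_mono2) auto
        finally show "a x \<le> Z * (a y + (d k * N) powr \<kappa>)" .
      qed simp_all
      also have "\<dots> \<le> (1 + Z + Z * B0) * conv (\<rho> (d k)) h x"
      proof (rule mult_right_mono[OF _ conv_nonneg[OF K h0]])
        have "(d k * N) powr \<kappa> * A powr (q - p) \<le> B0"
          unfolding A_def B0_def by (rule exponent_balance) (use d[of k] s N H C \<gamma> in auto)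
        then show "1 + Z + Z * ((d k * N) powr \<kappa> * A powr (q - p)) \<le> 1 + Z + Z * B0"
          using Z(1) by simp
      qed
      finally show ?thesis .
    qed
    have ci: "integrable lborel (conv (\<rho> (d k)) G)" "integrable lborel (conv (\<rho> (d k)) h)" for k
      by (rule conv_L1(1)[OF kernel_C1c[OF K] iv(2)], rule conv_L1(1)[OF kernel_C1c[OF K] h(4)])
    note lv = conv_sequence_tendsto[OF K dlim iv(1)]
    note lG = conv_sequence_tendsto[OF K dlim iv(2)]
    note lh = conv_sequence_tendsto[OF K dlim h(4)]
    \<comment> \<open>L^1 convergence of the mollified gradients gives the pointwise convergence
      required by \<open>energy_convergence\<close> only after passing to a subsequence.\<close>
    have "\<exists>j::nat\<Rightarrow>nat. strict_mono j \<and> (AE x in lborel. (\<lambda>n. conv (\<rho> (d (j n))) G x - G x) \<longlonglongrightarrow> 0)"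
      by (rule tendsto_L1_AE_subseq[OF _ lG]) (intro Bochner_Integration.integrable_diff ci iv)
    then obtain j :: "nat \<Rightarrow> nat" where j: "strict_mono j"
      "AE x in lborel. (\<lambda>n. conv (\<rho> (d (j n))) G x - G x) \<longlonglongrightarrow> 0"
      by (elim exE conjE)
    have "(\<lambda>n. modular \<Omega> p q a (\<lambda>x. conv (\<rho> (d (j n))) G x - G x)) \<longlonglongrightarrow> 0"
      by (rule energy_convergence[OF \<Omega> a _ _ iv(2) ci(1) h(4) hae ci(2)
            LIMSEQ_subseq_LIMSEQ[OF lh j(1), unfolded o_def] j(2) AE_I2[OF impI[OF le]]])
        (use pq Z(1) in \<open>auto simp: B0_def intro!: add_nonneg_nonneg mult_nonneg_nonneg\<close>)
    then have E1: "\<forall>\<^sub>F n in sequentially. modular \<Omega> p q a (\<lambda>x. conv (\<rho> (d (j n))) G x - G x) < ennreal e"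
      by (rule order_tendstoD(2)) (use e in simp)
    have E2: "\<forall>\<^sub>F n in sequentially. (\<integral>x. norm (conv (\<rho> (d (j n))) v x - v x) \<partial>lborel) < e"
      by (rule order_tendstoD(2)[OF LIMSEQ_subseq_LIMSEQ[OF lv j(1), unfolded o_def] e])
    from eventually_happens'[OF sequentially_bot eventually_conj[OF E1 E2]]
    obtain n where n: "modular \<Omega> p q a (\<lambda>x. conv (\<rho> (d (j n))) G x - G x) < ennreal e"
      "(\<integral>x. norm (conv (\<rho> (d (j n))) v x - v x) \<partial>lborel) < e"
      by (elim exE conjE)
    have "d (j n) < \<delta>0"
      using d(2)[of "j n"] s(2) by simp
    with n d(1) K show ?thesis
      by (intro exI[of _ "\<rho> (d (j n))"] exI[of _ "d (j n)"] conjI)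
  qed
qed

section \<open>Geometry of Lipschitz domains\<close>

text \<open>The graph function is extended from the hyperplane to the whole space by composition
  with the orthogonal projection, which makes it constant along \<nu>. The Lipschitz constant is
  doubled by a crude bound for the projection.\<close>

lemma lipschitz_domain_graph:
  fixes \<Omega> :: "'a::euclidean_space set"
  assumes "lipschitz_domain \<Omega>" "z \<in> frontier \<Omega>"
  obtains \<nu> r K f where "norm \<nu> = 1" "0 < r" "0 \<le> K"
    "\<And>x y. \<bar>f x - f y\<bar> \<le> K * norm (x - y)" "\<And>x t. f (x + t *\<^sub>R \<nu>) = f x"
    "\<And>x. x \<in> ball z r \<Longrightarrow> x \<in> \<Omega> \<longleftrightarrow> f x < x \<bullet> \<nu>"
proof -
  obtain \<nu> r L h where \<nu>: "norm \<nu> = 1" and r: "0 < r" and L: "L-lipschitz_on {y. y \<bullet> \<nu> = 0} h"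
    and graph: "\<forall>x\<in>ball z r. x \<in> \<Omega> \<longleftrightarrow> h (x - (x \<bullet> \<nu>) *\<^sub>R \<nu>) < x \<bullet> \<nu>"
    using assms unfolding lipschitz_domain_def by (elim conjE) (drule bspec, assumption, elim exE conjE, rule that)
  have nn: "\<nu> \<bullet> \<nu> = 1" using \<nu> by (simp add: dot_square_norm)
  define P where "P x = x - (x \<bullet> \<nu>) *\<^sub>R \<nu>" for x :: 'a
  have P0: "P x \<in> {y. y \<bullet> \<nu> = 0}" for x
    using nn by (simp add: P_def inner_diff_left)
  have L0: "0 \<le> L" using L by (rule lipschitz_on_nonneg)
  have Pd: "norm (P x - P y) \<le> 2 * norm (x - y)" for x y
  proof -
    have "P x - P y = (x - y) - ((x - y) \<bullet> \<nu>) *\<^sub>R \<nu>"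
      by (simp add: P_def inner_diff_left scaleR_diff_left)
    also have "norm \<dots> \<le> norm (x - y) + norm (((x - y) \<bullet> \<nu>) *\<^sub>R \<nu>)"
      by (rule norm_triangle_ineq4)
    also have "norm (((x - y) \<bullet> \<nu>) *\<^sub>R \<nu>) \<le> norm (x - y)"
      using Cauchy_Schwarz_ineq2[of "x - y" \<nu>] \<nu> by simp
    finally show ?thesis by simp
  qed
  show ?thesis
  proof (rule that[of \<nu> r "2 * L" "\<lambda>x. h (P x)"])
    fix x y :: 'a
    have "dist (h (P x)) (h (P y)) \<le> L * dist (P x) (P y)"
      by (rule lipschitz_onD[OF L P0 P0])
    also have "\<dots> \<le> L * (2 * norm (x - y))"
      using Pd L0 by (intro mult_left_mono) (simp_all add: dist_norm)
    finally show "\<bar>h (P x) - h (P y)\<bar> \<le> 2 * L * norm (x - y)"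
      by (simp add: dist_real_def)
  next
    fix x t
    show "h (P (x + t *\<^sub>R \<nu>)) = h (P x)"
      using nn by (simp add: P_def inner_add_left scaleR_add_left)
  next
    fix x assume "x \<in> ball z r"
    then show "x \<in> \<Omega> \<longleftrightarrow> h (P x) < x \<bullet> \<nu>"
      using graph unfolding P_def by blast
  qed (use \<nu> r L0 in auto)
qed

text \<open>Points of the closure are limits of points strictly above the graph. Graph and height
  change by at most \<open>K + 1\<close> times the distance, so an approximating point within
  \<open>e / (K + 1)\<close> costs at most \<open>e\<close>.\<close>

lemma graph_le_closure:
  fixes \<Omega> :: "'a::euclidean_space set"
  assumes \<nu>: "norm \<nu> = 1" and K: "0 \<le> K" and lip: "\<And>x y. \<bar>f x - f y\<bar> \<le> K * norm (x - y)"
    and graph: "\<And>x. x \<in> ball z r \<Longrightarrow> x \<in> \<Omega> \<longleftrightarrow> f x < x \<bullet> \<nu>"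
    and y: "y \<in> closure \<Omega>" "y \<in> ball z r"
  shows "f y \<le> y \<bullet> \<nu>"
proof (rule field_le_epsilon)
  fix e :: real assume e: "0 < e"
  obtain d where d: "0 < d" "ball y d \<subseteq> ball z r"
    using y(2) open_ball open_contains_ball by metis
  have "0 < min d (e / (K + 1))" using d(1) e K by simp
  then obtain x where x: "x \<in> \<Omega>" "dist x y < min d (e / (K + 1))"
    using y(1) unfolding closure_approachable by metis
  have xz: "x \<in> ball z r"
    using d(2) x(2) by (auto simp: subset_iff dist_commute)
  have "dist x y * (K + 1) \<le> e"
    using x(2) K by (simp add: field_simps)
  moreover have "f x < x \<bullet> \<nu>"
    using graph[OF xz] x(1) by simp
  moreover have "(x - y) \<bullet> \<nu> \<le> norm (x - y)"
    using Cauchy_Schwarz_ineq2[of "x - y" \<nu>] \<nu> by simp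
  moreover have "\<bar>f x - f y\<bar> \<le> K * norm (x - y)"
    by (rule lip)
  ultimately show "f y \<le> y \<bullet> \<nu> + e"
    by (simp add: dist_norm inner_diff_left algebra_simps)
qed

text \<open>At an interior point no shift is necessary and \<open>c = 0\<close> serves. At a
  boundary point the shift by \<open>\<delta> *\<^sub>R \<nu>\<close> gains height \<delta>, while a
  deviation of length \<open>\<delta> * s\<close> costs at most \<open>\<delta> * s\<close> in
  height and raises the graph by at most \<open>K * (\<delta> * s)\<close>; this is the cone
  condition for a Lipschitz graph.\<close>

lemma local_shift:
  fixes \<Omega> :: "'a::euclidean_space set"
  assumes \<Omega>: "lipschitz_domain \<Omega>" and z: "z \<in> closure \<Omega>"
  shows "\<exists>R c s \<delta>0. 0 < R \<and> 0 < s \<and> 0 < \<delta>0 \<and>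
    (\<forall>y \<delta> w. y \<in> closure \<Omega> \<inter> cball z R \<longrightarrow> 0 < \<delta> \<longrightarrow> \<delta> < \<delta>0 \<longrightarrow> w \<in> cball (\<delta> *\<^sub>R c) (\<delta> * s) \<longrightarrow> y + w \<in> \<Omega>)"
proof (cases "z \<in> \<Omega>")
  case True
  have op: "open \<Omega>" using \<Omega> by (simp add: lipschitz_domain_def)
  from op[unfolded open_contains_ball, rule_format, OF True]
  obtain r where r: "0 < r" "ball z r \<subseteq> \<Omega>"
    by (elim exE conjE)
  show ?thesis
  proof (intro exI conjI allI impI)
    fix y w :: 'a and \<delta>
    assume "y \<in> closure \<Omega> \<inter> cball z (r / 2)" "0 < \<delta>" "\<delta> < r / 2" "w \<in> cball (\<delta> *\<^sub>R 0) (\<delta> * 1)"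
    then have "dist z y \<le> r / 2" "norm w < r / 2" by auto
    then have "dist z (y + w) < r"
      using dist_triangle[of z "y + w" y] by (simp add: dist_norm)
    then show "y + w \<in> \<Omega>" using r(2) by auto
  qed (use r in auto)
next
  case False
  have "open \<Omega>" using \<Omega> by (simp add: lipschitz_domain_def)
  then have zf: "z \<in> frontier \<Omega>"
    using z False by (simp add: frontier_def interior_open)
  show ?thesis
  proof (rule lipschitz_domain_graph[OF \<Omega> zf])
    fix \<nu> :: 'a and r K :: real and f :: "'a \<Rightarrow> real"
    assume \<nu>: "norm \<nu> = 1" and r: "0 < r" and K: "0 \<le> K"
      and lip: "\<And>x y. \<bar>f x - f y\<bar> \<le> K * norm (x - y)" and inv: "\<And>x t. f (x + t *\<^sub>R \<nu>) = f x"
      and graph: "\<And>x. x \<in> ball z r \<Longrightarrow> x \<in> \<Omega> \<longleftrightarrow> f x < x \<bullet> \<nu>"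
    \<comment> \<open>Chosen so that \<open>(K + 1) * s < 1\<close>, the margin in the cone
      condition; \<open>s \<le> 1 / 2\<close> keeps the shifted point inside the ball where the
      graph describes \<Omega>.\<close>
    define s where "s = 1 / (K + 2)"
    have s: "0 < s" "s \<le> 1 / 2" "K * s < 1 - s"
      using K by (auto simp: s_def field_simps)
    show ?thesis
    proof (intro exI conjI allI impI)
      fix y w :: 'a and \<delta>
      assume y: "y \<in> closure \<Omega> \<inter> cball z (r / 2)" and \<delta>: "0 < \<delta>" "\<delta> < r / 4"
        and w: "w \<in> cball (\<delta> *\<^sub>R \<nu>) (\<delta> * s)"
      define e where "e = w - \<delta> *\<^sub>R \<nu>"
      have e: "norm e \<le> \<delta> * s" and we: "w = e + \<delta> *\<^sub>R \<nu>"
        using w by (simp_all add: e_def dist_norm norm_minus_commute)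
      have "norm w \<le> \<delta> * s + \<delta>"
        unfolding we by (rule order_trans[OF norm_triangle_ineq]) (use e \<nu> \<delta> in simp)
      also have "\<dots> < r / 2"
      proof -
        have "\<delta> * s \<le> \<delta> * (1 / 2)"
          using s(2) \<delta>(1) by (intro mult_left_mono) auto
        then show ?thesis using \<delta> by linarith
      qed
      finally have wr: "norm w < r / 2" .
      have yz: "dist z y \<le> r / 2" using y by simp
      then have "dist z (y + w) < r"
        using dist_triangle[of z "y + w" y] wr by (simp add: dist_norm)
      then have in_ball: "y + w \<in> ball z r" by simp
      have "y \<in> ball z r" using yz r by simp
      then have fy: "f y \<le> y \<bullet> \<nu>"
        using graph_le_closure[OF \<nu> K lip graph] y by blast
      have "f (y + w) = f (y + e)"
        unfolding we using inv[of "y + e" \<delta>] by (simp add: add.assoc)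
      also have "\<dots> \<le> f y + K * norm e"
        using lip[of "y + e" y] by simp
      also have "K * norm e \<le> K * (\<delta> * s)"
        by (rule mult_left_mono[OF e K])
      also have "K * (\<delta> * s) = \<delta> * (K * s)"
        by simp
      also have "f y + \<delta> * (K * s) < y \<bullet> \<nu> + \<delta> * (1 - s)"
        using fy s(3) \<delta>(1) by (intro add_le_less_mono) simp_all
      also have "\<dots> \<le> (y + w) \<bullet> \<nu>"
      proof -
        have "- (e \<bullet> \<nu>) \<le> \<delta> * s"
          using Cauchy_Schwarz_ineq2[of e \<nu>] \<nu> e by simp
        moreover have "\<nu> \<bullet> \<nu> = 1" using \<nu> by (simp add: dot_square_norm)
        ultimately show ?thesis
          unfolding we by (simp add: inner_add_left algebra_simps)
      qed
      finally show "y + w \<in> \<Omega>"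
        using graph[OF in_ball] by simp
    qed (use r s in auto)
  qed
qed

text \<open>Squaring makes the positive part continuously differentiable. This regularity suffices
  for functions that act on \<open>u\<close> before mollification; smoothness then comes from the
  kernel.\<close>

lemma pos_square_derivative:
  "((\<lambda>x. (max 0 x)\<^sup>2) has_real_derivative 2 * max 0 (x::real)) (at x)"
proof -
  consider "x < 0" | "x = 0" | "0 < x" by linarith
  then show ?thesis
  proof cases
    case 1
    have "((\<lambda>x::real. 0) has_real_derivative 2 * max 0 x) (at x)"
      using 1 by simp
    then show ?thesis
      by (rule has_field_derivative_transform_within_open[where S = "{..<0}"]) (use 1 in auto)
  next
    case 2
    have "((\<lambda>h::real. (max 0 h)\<^sup>2 / h) \<longlongrightarrow> 0) (at 0)"
    proof (rule Lim_null_comparison)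
      show "\<forall>\<^sub>F h in at 0. norm ((max 0 h)\<^sup>2 / h :: real) \<le> \<bar>h\<bar>"
        by (auto intro!: always_eventually simp: max_def power2_eq_square)
      show "((\<lambda>h::real. \<bar>h\<bar>) \<longlongrightarrow> 0) (at 0)"
        using tendsto_rabs[OF tendsto_ident_at, of "0::real" UNIV] by simp
    qed
    then show ?thesis
      using 2 by (simp add: has_field_derivative_iff)
  next
    case 3
    have "((\<lambda>x::real. x\<^sup>2) has_real_derivative 2 * max 0 x) (at x)"
      using 3 by (auto intro!: derivative_eq_intros)
    then show ?thesis
      by (rule has_field_derivative_transform_within_open[where S = "{0<..}"]) (use 3 in auto)
  qed
qed

text \<open>Composing with \<open>T\<close> turns a function with a jump of size \<open>c\<close> across the boundary into an indicator
  function with vanishing gradient.\<close>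

lemma plateau_function:
  fixes c :: real
  assumes c: "0 < c"
  obtains T T' :: "real \<Rightarrow> real" and B where "\<And>t. (T has_real_derivative T' t) (at t)" "continuous_on UNIV T'"
    "T 0 = 0" "\<And>t. \<bar>T' t\<bar> \<le> B" "\<And>t. c \<le> \<bar>t\<bar> \<Longrightarrow> T t = 1" "\<And>t. c \<le> \<bar>t\<bar> \<Longrightarrow> T' t = 0"
proof -
  \<comment> \<open>The squared positive part makes the plateau fit to first order at
    \<open>\<bar>t\<bar> = c\<close>.\<close>
  define T where "T t = 1 - (max 0 (1 - (t / c)\<^sup>2))\<^sup>2" for t
  define T' where "T' t = 4 * (t / c\<^sup>2) * max 0 (1 - (t / c)\<^sup>2)" for t
  have plateau: "max 0 (1 - (t / c)\<^sup>2) = 0" if "c \<le> \<bar>t\<bar>" for t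
  proof -
    have "1 \<le> \<bar>t / c\<bar>"
      using that c by simp
    then have "1 \<le> (t / c)\<^sup>2"
      using abs_le_square_iff[of 1 "t / c"] by simp
    then show ?thesis by simp
  qed
  show ?thesis
  proof (rule that[of T T' "4 / c"])
    fix t
    have "((\<lambda>t. 1 - (t / c)\<^sup>2) has_real_derivative - (2 * t / c\<^sup>2)) (at t)"
      using c by (auto intro!: derivative_eq_intros simp: power2_eq_square)
    from DERIV_chain2[OF pos_square_derivative this]
    have "((\<lambda>t. (max 0 (1 - (t / c)\<^sup>2))\<^sup>2) has_real_derivative 2 * max 0 (1 - (t / c)\<^sup>2) * - (2 * t / c\<^sup>2)) (at t)" .
    from DERIV_diff[OF DERIV_const this, of 1] show "(T has_real_derivative T' t) (at t)"
      unfolding T_def[abs_def] T'_def by (simp add: mult_ac)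
    show "\<bar>T' t\<bar> \<le> 4 / c"
    proof (cases "c \<le> \<bar>t\<bar>")
      case True
      then show ?thesis using plateau[OF True] c by (simp add: T'_def)
    next
      case False
      have "\<bar>t\<bar> / c\<^sup>2 \<le> 1 / c"
        using False c by (simp add: power2_eq_square field_simps)
      moreover have "\<bar>max 0 (1 - (t / c)\<^sup>2)\<bar> \<le> 1"
        by simp
      ultimately have "(\<bar>t\<bar> / c\<^sup>2) * \<bar>max 0 (1 - (t / c)\<^sup>2)\<bar> \<le> (1 / c) * 1"
        by (intro mult_mono) (use c in auto)
      then show ?thesis
        by (simp add: T'_def abs_mult)
    qed
    show "c \<le> \<bar>t\<bar> \<Longrightarrow> T t = 1" "c \<le> \<bar>t\<bar> \<Longrightarrow> T' t = 0"
      using plateau[of t] by (simp_all add: T_def T'_def)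
  next
    show "continuous_on UNIV T'"
      unfolding T'_def[abs_def] using c by (intro continuous_intros) auto
    show "T 0 = 0" by (simp add: T_def)
  qed
qed

section \<open>Vanishing boundary values and the Hoelder continuity of the zero extension\<close>

lemma conv_eq_const:
  assumes k: "kernel \<rho> 0 \<sigma>" and w: "\<And>y. y \<in> cball x \<sigma> \<Longrightarrow> w y = (b :: 'b::euclidean_space)"
  shows "conv \<rho> w x = b"
proof -
  have "\<rho> (x - y) *\<^sub>R w y = \<rho> (x - y) *\<^sub>R b" for y
  proof (cases "\<rho> (x - y) = 0")
    case False
    then have "x - y \<in> cball 0 \<sigma>"
      using k unfolding kernel_def by metis
    then show ?thesis using w[of y] by (simp add: dist_norm norm_minus_commute)
  qed simp
  then have "conv \<rho> w x = (\<integral>y. \<rho> (x - y) *\<^sub>R b \<partial>lborel)"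
    unfolding conv_def by (simp only:)
  also have "\<dots> = b"
    using kernel_integral_reflect[OF k] by simp
  finally show ?thesis .
qed

text \<open>Near \<open>z\<close> the composed function \<open>w\<close> is the indicator of
  \<Omega> while its gradient \<open>F\<close> vanishes. A mollification of \<open>w\<close> has
  gradient 0 and is therefore constant near \<open>z\<close>; but it is 1 at a point above the graph
  and 0 at a point below it.\<close>

lemma zero_trace:
  fixes \<Omega> :: "'a::euclidean_space set"
  assumes \<Omega>: "lipschitz_domain \<Omega>" and u: "sob u G"
    and u0: "\<And>x. x \<notin> \<Omega> \<Longrightarrow> u x = 0" and G0: "\<And>x. x \<notin> \<Omega> \<Longrightarrow> G x = 0"
    and z: "z \<in> frontier \<Omega>" and c: "0 < c" and r': "0 < r'"
    and uc: "\<And>y. y \<in> \<Omega> \<Longrightarrow> y \<in> ball z r' \<Longrightarrow> c \<le> \<bar>u y\<bar>"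
  shows False
proof (rule lipschitz_domain_graph[OF \<Omega> z], rule plateau_function[OF c])
  fix \<nu> :: 'a and r K :: real and f :: "'a \<Rightarrow> real"
  assume \<nu>: "norm \<nu> = 1" and r: "0 < r" and K: "0 \<le> K"
    and lip: "\<And>x y. \<bar>f x - f y\<bar> \<le> K * norm (x - y)" and inv: "\<And>x t. f (x + t *\<^sub>R \<nu>) = f x"
    and graph: "\<And>x. x \<in> ball z r \<Longrightarrow> x \<in> \<Omega> \<longleftrightarrow> f x < x \<bullet> \<nu>"
  fix T T' :: "real \<Rightarrow> real" and B :: real
  assume T: "\<And>t. (T has_real_derivative T' t) (at t)" "continuous_on UNIV T'" "T 0 = 0" "\<And>t. \<bar>T' t\<bar> \<le> B"
    and T1: "\<And>t. c \<le> \<bar>t\<bar> \<Longrightarrow> T t = 1" and T'0: "\<And>t. c \<le> \<bar>t\<bar> \<Longrightarrow> T' t = 0"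
  have op: "open \<Omega>" using \<Omega> by (simp add: lipschitz_domain_def)
  have zc: "z \<in> closure \<Omega>" "z \<notin> \<Omega>"
    using z op by (auto simp: frontier_def interior_open)
  have nn: "\<nu> \<bullet> \<nu> = 1" using \<nu> by (simp add: dot_square_norm)
  have fz: "f z = z \<bullet> \<nu>"
  proof (rule antisym)
    show "f z \<le> z \<bullet> \<nu>"
      by (rule graph_le_closure[OF \<nu> K lip graph zc(1)]) (use r in auto)
    show "z \<bullet> \<nu> \<le> f z"
      using graph[of z] zc(2) r by simp
  qed
  define w where "w x = T (u x)" for x
  define F where "F x = T' (u x) *\<^sub>R G x" for x
  have wF: "sob w F"
    unfolding w_def F_def by (rule sob_chain[OF u T])
  define r0 where "r0 = min r r'"
  have r0: "0 < r0" "ball z r0 \<subseteq> ball z r" "ball z r0 \<subseteq> ball z r'"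
    using r r' by (auto simp: r0_def)
  have w1: "w x = 1" if "x \<in> \<Omega>" "x \<in> ball z r0" for x
    using that r0 by (simp add: w_def T1 uc subset_iff)
  have w0: "w x = 0" if "x \<notin> \<Omega>" for x
    using that by (simp add: w_def u0 T)
  have F0: "F x = 0" if "x \<in> ball z r0" for x
  proof (cases "x \<in> \<Omega>")
    case True
    then have "c \<le> \<bar>u x\<bar>" using uc[of x] that r0(3) by blast
    then show ?thesis by (simp add: F_def T'0)
  qed (simp add: F_def G0)
  \<comment> \<open>The points tested are \<open>z\<close> shifted by \<open>t\<close> along \<nu>
    in both directions. Since \<open>(K + 1) * \<sigma> < t\<close>, the \<sigma>-balls around them
    lie on different sides of the graph, and \<open>t + \<sigma> < r0\<close> keeps them in the ball
    where \<open>F\<close> vanishes.\<close>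
  define t where "t = r0 / 4"
  define \<sigma> where "\<sigma> = t / 2 / (K + 1)"
  have t: "0 < t" using r0 by (simp add: t_def)
  have \<sigma>: "0 < \<sigma>" "\<sigma> \<le> t" "(K + 1) * \<sigma> < t"
  proof -
    have "b * (t / 2 / b) = t / 2" if "b \<noteq> 0" for b :: real
      using that by simp
    from this[of "K + 1"] have eq: "(K + 1) * \<sigma> = t / 2"
      using K unfolding \<sigma>_def by linarith
    show "0 < \<sigma>" using t K by (simp add: \<sigma>_def)
    then have "1 * \<sigma> \<le> (K + 1) * \<sigma>"
      using K by (intro mult_right_mono) auto
    then show "\<sigma> \<le> t" "(K + 1) * \<sigma> < t"
      using eq t by simp_all
  qed
  obtain \<rho> :: "'a \<Rightarrow> real" where k: "kernel \<rho> 0 \<sigma>"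
    using kernel_exists[OF \<sigma>(1)] by (elim exE)
  have sub: "y \<in> ball z r0" if "x \<in> cball z t" "y \<in> cball x \<sigma>" for x y
    using that dist_triangle[of z y x] \<sigma>(2) t by (simp add: t_def)
  have C1: "C1 (conv \<rho> w) (conv \<rho> F)"
    by (rule C1_conv_sob[OF wF kernel_C1c[OF k]])
  have "\<exists>b. \<forall>x\<in>cball z t. conv \<rho> w x = b"
  proof (rule has_derivative_zero_constant[OF convex_cball])
    fix x assume x: "x \<in> cball z t"
    have "conv \<rho> F x = 0"
      by (rule conv_eq_const[OF k F0[OF sub[OF x]]])
    moreover have "(conv \<rho> w has_derivative (\<lambda>h. conv \<rho> F x \<bullet> h)) (at x)"
      using C1 by (simp add: C1_def)
    ultimately show "(conv \<rho> w has_derivative (\<lambda>h. 0)) (at x within cball z t)"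
      by (simp add: has_derivative_at_withinI)
  qed
  then obtain b where b: "\<forall>x\<in>cball z t. conv \<rho> w x = b" by (elim exE)
  have zt: "z + t *\<^sub>R \<nu> \<in> cball z t" "z - t *\<^sub>R \<nu> \<in> cball z t"
    using \<nu> t by (simp_all add: dist_norm)
  have dec: "\<exists>e. norm e \<le> \<sigma> \<and> y = x + e" if "y \<in> cball x \<sigma>" for x y :: 'a
    using that by (intro exI[of _ "y - x"]) (simp add: dist_norm norm_minus_commute)
  have fe: "\<bar>f (z + e + s *\<^sub>R \<nu>) - z \<bullet> \<nu>\<bar> \<le> K * \<sigma>" if "norm e \<le> \<sigma>" for e s
  proof -
    have "\<bar>f (z + e) - f z\<bar> \<le> K * norm e"
      using lip[of "z + e" z] by simp
    also have "\<dots> \<le> K * \<sigma>"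
      by (rule mult_left_mono[OF that K])
    finally show ?thesis by (simp add: inv fz)
  qed
  have ee: "\<bar>e \<bullet> \<nu>\<bar> \<le> \<sigma>" if "norm e \<le> \<sigma>" for e
    using Cauchy_Schwarz_ineq2[of e \<nu>] \<nu> that by simp
  have up: "y \<in> \<Omega>" if y: "y \<in> cball (z + t *\<^sub>R \<nu>) \<sigma>" for y
  proof -
    obtain e where e: "norm e \<le> \<sigma>" "y = z + t *\<^sub>R \<nu> + e"
      using dec[OF y] by metis
    have "f y < y \<bullet> \<nu>"
      using fe[OF e(1), of t] ee[OF e(1)] \<sigma>(3) nn unfolding e(2) by (simp add: inner_add_left algebra_simps)
    then show ?thesis
      using graph[of y] sub[OF zt(1) y] r0(2) by blast
  qed
  have down: "y \<notin> \<Omega>" if y: "y \<in> cball (z - t *\<^sub>R \<nu>) \<sigma>" for y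
  proof -
    obtain e where e: "norm e \<le> \<sigma>" "y = z - t *\<^sub>R \<nu> + e"
      using dec[OF y] by metis
    have "\<not> f y < y \<bullet> \<nu>"
      using fe[OF e(1), of "- t"] ee[OF e(1)] \<sigma>(3) nn unfolding e(2)
      by (simp add: inner_add_left inner_diff_left algebra_simps)
    then show ?thesis
      using graph[of y] sub[OF zt(2) y] r0(2) by blast
  qed
  have "conv \<rho> w (z + t *\<^sub>R \<nu>) = 1"
    by (rule conv_eq_const[OF k w1[OF up sub[OF zt(1)]]])
  moreover have "conv \<rho> w (z - t *\<^sub>R \<nu>) = 0"
    by (rule conv_eq_const[OF k w0[OF down]])
  ultimately show False
    using b zt by auto
qed

text \<open>A segment from inside to outside meets the boundary at some \<open>z\<close>. If
  \<open>\<bar>u x\<bar>\<close> exceeded \<open>H * dist x z powr \<gamma>\<close>, Hoelder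
  continuity inside \<Omega> would keep \<open>u\<close> away from 0 near \<open>z\<close>, contrary
  to \<open>zero_trace\<close>. Comparison with \<open>z\<close>, which is no farther than
  \<open>y\<close>, preserves the constant \<open>H\<close>.\<close>

lemma holder_zero_extension:
  fixes \<Omega> :: "'a::euclidean_space set"
  assumes \<Omega>: "lipschitz_domain \<Omega>" and u: "sob u G"
    and u0: "\<And>x. x \<notin> \<Omega> \<Longrightarrow> u x = 0" and G0: "\<And>x. x \<notin> \<Omega> \<Longrightarrow> G x = 0"
    and H: "0 \<le> H" and \<gamma>: "0 < \<gamma>"
    and hold: "\<And>x y. x \<in> \<Omega> \<Longrightarrow> y \<in> \<Omega> \<Longrightarrow> \<bar>u x - u y\<bar> \<le> H * dist x y powr \<gamma>"
  shows "\<bar>u x - u y\<bar> \<le> H * dist x y powr \<gamma>"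
proof -
  have main: "\<bar>u x\<bar> \<le> H * dist x y powr \<gamma>" if xy: "x \<in> \<Omega>" "y \<notin> \<Omega>" for x y
  proof -
    have "closed_segment x y \<inter> frontier \<Omega> \<noteq> {}"
      by (rule connected_Int_frontier) (use xy in auto)
    then obtain z where z: "z \<in> closed_segment x y" "z \<in> frontier \<Omega>"
      by auto
    have "open \<Omega>" using \<Omega> by (simp add: lipschitz_domain_def)
    then have xz: "x \<noteq> z"
      using z(2) xy(1) by (auto simp: frontier_def interior_open)
    have dz: "dist x z \<le> dist x y"
      using segment_bound(1)[OF z(1)] by (simp add: dist_norm norm_minus_commute)
    have "\<bar>u x\<bar> \<le> H * dist x z powr \<gamma>"
    proof (rule ccontr)
      assume "\<not> \<bar>u x\<bar> \<le> H * dist x z powr \<gamma>"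
      \<comment> \<open>One half of the gap becomes the lower bound for \<open>u\<close> near
        \<open>z\<close>; the other half absorbs the variation of the distance to \<open>x\<close>
        there.\<close>
      then have c: "0 < (\<bar>u x\<bar> - H * dist x z powr \<gamma>) / 2" (is "0 < ?c") by simp
      have "((\<lambda>y. H * dist x y powr \<gamma>) \<longlongrightarrow> H * dist x z powr \<gamma>) (nhds z)"
        using xz by (intro tendsto_intros filterlim_ident) auto
      then have "\<forall>\<^sub>F y in nhds z. H * dist x y powr \<gamma> < H * dist x z powr \<gamma> + ?c"
        by (rule order_tendstoD(2)) (use c in simp)
      then obtain r where r: "0 < r" "\<forall>y. dist y z < r \<longrightarrow> H * dist x y powr \<gamma> < H * dist x z powr \<gamma> + ?c"
        unfolding eventually_nhds_metric by (elim exE conjE)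
      show False
      proof (rule zero_trace[OF \<Omega> u u0 G0 z(2) c r(1)])
        fix y assume y: "y \<in> \<Omega>" "y \<in> ball z r"
        have "dist y z < r"
          using y(2) by (simp add: dist_commute)
        then have "H * dist x y powr \<gamma> < H * dist x z powr \<gamma> + ?c"
          by (rule r(2)[rule_format])
        then show "?c \<le> \<bar>u y\<bar>"
          using hold[OF xy(1) y(1)] by (simp add: field_simps)
      qed
    qed
    also have "\<dots> \<le> H * dist x y powr \<gamma>"
      using dz H \<gamma> by (intro mult_left_mono powr_mono2) auto
    finally show ?thesis .
  qed
  show ?thesis
  proof (cases "x \<in> \<Omega>"; cases "y \<in> \<Omega>")
    assume "x \<in> \<Omega>" "y \<in> \<Omega>"
    then show ?thesis by (rule hold)
  next
    assume "x \<in> \<Omega>" "y \<notin> \<Omega>"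
    then show ?thesis using main[of x y] u0[of y] by simp
  next
    assume "x \<notin> \<Omega>" "y \<in> \<Omega>"
    then show ?thesis using main[of y x] u0[of x] by (simp add: dist_commute)
  next
    assume "x \<notin> \<Omega>" "y \<notin> \<Omega>"
    then show ?thesis using u0[of x] u0[of y] H by simp
  qed
qed

section \<open>Partition of unity\<close>

lemma C1_sum:
  assumes "finite I" "\<And>i. i \<in> I \<Longrightarrow> C1 (f i) (D i)"
  shows "C1 (\<lambda>x. \<Sum>i\<in>I. f i x) (\<lambda>x. \<Sum>i\<in>I. D i x)"
  using assms
proof (induction I)
  case empty
  then show ?case by (simp add: C1_const)
next
  case (insert i I)
  then show ?case by (simp add: C1_add)
qed

lemma C1_inner_self: "C1 (\<lambda>x::'a::euclidean_space. r - (x - z) \<bullet> (x - z)) (\<lambda>x. - (2 *\<^sub>R (x - z)))"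
  unfolding C1_def
proof (intro conjI allI)
  fix x :: 'a
  have "((\<lambda>x. x - z) has_derivative (\<lambda>h. h)) (at x)"
    by (auto intro!: derivative_eq_intros)
  from has_derivative_diff[OF has_derivative_const has_derivative_inner[OF this this]]
  show "((\<lambda>x. r - (x - z) \<bullet> (x - z)) has_derivative (\<lambda>h. - (2 *\<^sub>R (x - z)) \<bullet> h)) (at x)"
    by (simp add: inner_commute)
qed (intro continuous_intros)

text \<open>A globally defined substitute for \<open>1 / t\<close>, equal to it for
  \<open>t \<ge> m\<close>: in \<open>t / Q t\<close> the denominator \<open>Q\<close> is
  \<open>t\<^sup>2\<close> plus a squared positive part that keeps it from vanishing. It allows a
  division by a function that may vanish somewhere.\<close>

lemma smooth_inverse:
  fixes m :: real
  assumes m: "0 < m"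
  obtains J J' :: "real \<Rightarrow> real" where "\<And>t. (J has_real_derivative J' t) (at t)" "continuous_on UNIV J'"
    "\<And>t. m \<le> t \<Longrightarrow> t * J t = 1" "\<And>t. 0 \<le> t \<Longrightarrow> 0 \<le> J t" "\<And>t. t * J t \<le> 1"
proof -
  define Q where "Q t = t\<^sup>2 + (max 0 (m - t))\<^sup>2" for t
  have Q: "0 < Q t" for t
  proof (cases "t = 0")
    case True
    then show ?thesis using m by (simp add: Q_def)
  next
    case False
    then show ?thesis by (simp add: Q_def add_pos_nonneg)
  qed
  define Q' where "Q' t = 2 * t - 2 * max 0 (m - t)" for t
  have dQ: "(Q has_real_derivative Q' t) (at t)" for t
  proof -
    have "((\<lambda>t. m - t) has_real_derivative - 1) (at t)"
      by (auto intro!: derivative_eq_intros)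
    from DERIV_chain2[OF pos_square_derivative this]
    have "((\<lambda>t. (max 0 (m - t))\<^sup>2) has_real_derivative 2 * max 0 (m - t) * - 1) (at t)" .
    from DERIV_add[OF DERIV_pow[of 2 t] this] show ?thesis
      by (simp add: Q_def[abs_def] Q'_def)
  qed
  have cQ: "continuous_on UNIV Q" "continuous_on UNIV Q'"
    unfolding Q_def[abs_def] Q'_def[abs_def] by (intro continuous_intros)+
  show ?thesis
  proof (rule that[of "\<lambda>t. t / Q t" "\<lambda>t. (1 * Q t - t * Q' t) / (Q t * Q t)"])
    fix t
    show "((\<lambda>t. t / Q t) has_real_derivative (1 * Q t - t * Q' t) / (Q t * Q t)) (at t)"
      by (rule DERIV_divide[OF DERIV_ident dQ]) (use Q[of t] in simp)
    show "m \<le> t \<Longrightarrow> t * (t / Q t) = 1"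
      using m by (simp add: Q_def power2_eq_square)
    show "0 \<le> t \<Longrightarrow> 0 \<le> t / Q t"
      using Q[of t] by simp
    have "t * t \<le> Q t" by (simp add: Q_def power2_eq_square)
    then show "t * (t / Q t) \<le> 1"
      using Q[of t] by simp
  next
    have "Q t * Q t \<noteq> 0" for t using Q[of t] by simp
    then show "continuous_on UNIV (\<lambda>t. (1 * Q t - t * Q' t) / (Q t * Q t))"
      by (intro continuous_intros cQ) auto
  qed
qed

text \<open>The bumps \<eta> are divided by their sum \<open>W\<close> through
  \<open>smooth_inverse\<close> with \<open>m\<close> a lower bound of \<open>W\<close> on the
  compact set \<open>S\<close>. The total is then \<open>W x * J (W x)\<close>, which is 1 on
  \<open>S\<close> and never exceeds 1, so each single function is at most 1 everywhere.\<close>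

lemma C1_partition_of_unity:
  fixes S :: "'a::euclidean_space set"
  assumes S: "compact S" and I: "finite I" and R: "\<And>i. i \<in> I \<Longrightarrow> 0 < R i"
    and cover: "S \<subseteq> (\<Union>i\<in>I. ball i (R i))"
  obtains \<theta> D where "\<And>i. i \<in> I \<Longrightarrow> C1c (\<theta> i) (D i)" "\<And>i x. i \<in> I \<Longrightarrow> 0 \<le> \<theta> i x"
    "\<And>i x. i \<in> I \<Longrightarrow> \<theta> i x \<le> 1" "\<And>i x. i \<in> I \<Longrightarrow> x \<notin> cball i (R i) \<Longrightarrow> \<theta> i x = 0"
    "\<And>x. x \<in> S \<Longrightarrow> (\<Sum>i\<in>I. \<theta> i x) = 1" "\<And>x. x \<in> interior S \<Longrightarrow> (\<Sum>i\<in>I. D i x) = 0"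
proof -
  \<comment> \<open>The balls are indexed by their own centres, so \<open>i\<close> is also a point
    of the space.\<close>
  define \<eta> where "\<eta> i x = (max 0 ((R i)\<^sup>2 - (x - i) \<bullet> (x - i)))\<^sup>2" for i x :: 'a
  define E where "E i x = (2 * max 0 ((R i)\<^sup>2 - (x - i) \<bullet> (x - i))) *\<^sub>R - (2 *\<^sub>R (x - i))" for i x :: 'a
  have \<eta>C: "C1 (\<eta> i) (E i)" for i
    unfolding \<eta>_def[abs_def] E_def[abs_def]
    by (rule C1_compose[OF C1_inner_self pos_square_derivative]) (intro continuous_intros)
  have \<eta>0: "0 \<le> \<eta> i x" for i x by (simp add: \<eta>_def)
  have \<eta>pos: "0 < \<eta> i x" if "i \<in> I" "x \<in> ball i (R i)" for i x
  proof -
    have "(norm (x - i))\<^sup>2 < (R i)\<^sup>2"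
      using that by (intro power_strict_mono) (auto simp: dist_norm norm_minus_commute)
    then show ?thesis by (simp add: \<eta>_def dot_square_norm)
  qed
  have \<eta>z: "\<eta> i x = 0" if "i \<in> I" "x \<notin> cball i (R i)" for i x
  proof -
    have "(R i)\<^sup>2 \<le> (norm (x - i))\<^sup>2"
      using that R[OF that(1)] by (intro power_mono) (auto simp: dist_norm norm_minus_commute)
    then show ?thesis by (simp add: \<eta>_def dot_square_norm)
  qed
  define W where "W x = (\<Sum>i\<in>I. \<eta> i x)" for x
  have WC: "C1 W (\<lambda>x. \<Sum>i\<in>I. E i x)"
    unfolding W_def[abs_def] by (rule C1_sum[OF I \<eta>C])
  have W0: "0 \<le> W x" for x
    unfolding W_def by (intro sum_nonneg \<eta>0)
  have W\<eta>: "\<eta> i x \<le> W x" if "i \<in> I" for i x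
    unfolding W_def by (rule member_le_sum[OF that _ I]) (rule \<eta>0)
  have Wpos: "0 < W x" if "x \<in> S" for x
  proof -
    have "x \<in> (\<Union>i\<in>I. ball i (R i))"
      by (rule subsetD[OF cover that])
    then obtain i where "i \<in> I" "x \<in> ball i (R i)"
      by (elim UN_E)
    then show ?thesis
      using \<eta>pos[of i x] W\<eta>[of i x] by simp
  qed
  have "\<exists>m>0. \<forall>x\<in>S. m \<le> W x"
  proof (cases "S = {}")
    case False
    have "\<exists>x\<in>S. \<forall>y\<in>S. W x \<le> W y"
      by (rule continuous_attains_inf[OF S False continuous_on_subset[OF C1_continuous[OF WC]]]) simp
    then obtain x where "x \<in> S" "\<forall>y\<in>S. W x \<le> W y" by (elim bexE)
    then show ?thesis using Wpos[of x] by (intro exI[of _ "W x"]) simp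
  qed (auto intro: exI[of _ 1])
  then obtain m where m: "0 < m" "\<forall>x\<in>S. m \<le> W x" by (elim exE conjE)
  show ?thesis
  proof (rule smooth_inverse[OF m(1)])
    fix J J' :: "real \<Rightarrow> real"
    assume J: "\<And>t. (J has_real_derivative J' t) (at t)" "continuous_on UNIV J'"
      and J1: "\<And>t. m \<le> t \<Longrightarrow> t * J t = 1" and J0: "\<And>t. 0 \<le> t \<Longrightarrow> 0 \<le> J t" and Jle: "\<And>t. t * J t \<le> 1"
    define \<theta> where "\<theta> i x = \<eta> i x * J (W x)" for i x
    define D where "D i x = \<eta> i x *\<^sub>R (J' (W x) *\<^sub>R (\<Sum>i\<in>I. E i x)) + J (W x) *\<^sub>R E i x" for i x
    have \<theta>C: "C1 (\<theta> i) (D i)" for i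
      unfolding \<theta>_def[abs_def] D_def[abs_def] by (rule C1_mult[OF \<eta>C C1_compose[OF WC J]])
    have \<theta>z: "\<theta> i x = 0" if "i \<in> I" "x \<notin> cball i (R i)" for i x
      using \<eta>z[OF that] by (simp add: \<theta>_def)
    have sum1: "(\<Sum>i\<in>I. \<theta> i x) = 1" if "x \<in> S" for x
      using J1 m(2) that by (simp add: \<theta>_def sum_distrib_right[symmetric] W_def[symmetric])
    show ?thesis
    proof (rule that[of \<theta> D])
      fix i x assume i: "i \<in> I"
      show "C1c (\<theta> i) (D i)"
        by (rule C1cI[OF \<theta>C \<theta>z[OF i]])
      show "0 \<le> \<theta> i x"
        by (simp add: \<theta>_def \<eta>0 J0 W0)
      have "\<theta> i x \<le> W x * J (W x)"
        unfolding \<theta>_def by (intro mult_right_mono W\<eta>[OF i] J0 W0)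
      then show "\<theta> i x \<le> 1"
        using Jle[of "W x"] by simp
      show "x \<notin> cball i (R i) \<Longrightarrow> \<theta> i x = 0"
        by (rule \<theta>z[OF i])
    next
      fix x assume x: "x \<in> interior S"
      \<comment> \<open>The sum is 1 on an open set, so after subtracting 1 the lemma on functions
        vanishing outside a closed set applies.\<close>
      have "C1 (\<lambda>x. (\<Sum>i\<in>I. \<theta> i x) + - 1) (\<lambda>x. (\<Sum>i\<in>I. D i x) + 0)"
        by (rule C1_add[OF C1_sum[OF I \<theta>C] C1_const])
      moreover have "closed (- interior S)"
        by (intro closed_Compl open_interior)
      moreover have "(\<Sum>i\<in>I. \<theta> i y) + - 1 = 0" if "y \<notin> - interior S" for y
        using sum1[of y] that interior_subset[of S] by auto
      moreover have "x \<notin> - interior S"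
        using x by (metis Compl_iff)
      ultimately have "(\<Sum>i\<in>I. D i x) + 0 = 0"
        by (rule C1_zero_outside_closed)
      then show "(\<Sum>i\<in>I. D i x) = 0" by simp
    next
      fix x assume "x \<in> S"
      then show "(\<Sum>i\<in>I. \<theta> i x) = 1" by (rule sum1)
    qed
  qed
qed

section \<open>The energy space\<close>

lemma Ck_add: "Ck k f \<Longrightarrow> Ck k g \<Longrightarrow> Ck k (\<lambda>x. f x + g x)"
proof (induction k arbitrary: f g)
  case 0
  then show ?case by (simp add: continuous_on_add)
next
  case (Suc k)
  have d: "((\<lambda>x. f x + g x) has_derivative
      (\<lambda>v. frechet_derivative f (at x) v + frechet_derivative g (at x) v)) (at x)" for x
    using Suc.prems by (intro has_derivative_add) (simp_all add: frechet_derivative_works[symmetric])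
  have "frechet_derivative (\<lambda>x. f x + g x) (at x) =
      (\<lambda>v. frechet_derivative f (at x) v + frechet_derivative g (at x) v)" for x
    using frechet_derivative_at[OF d] by metis
  moreover have "(\<lambda>x. f x + g x) differentiable (at x)" for x
    by (rule differentiableI[OF d])
  ultimately show ?case
    using Suc by simp
qed

lemma Cc_infinity_zero: "(\<lambda>x. 0) \<in> Cc_infinity \<Omega>"
proof (rule Cc_infinityI[where K = "{}"])
  show "Ck k (\<lambda>x. 0)" for k
    by (rule smooth_expr_Ck[OF smooth_expr.const])
qed auto

lemma Cc_infinity_add:
  assumes "f \<in> Cc_infinity \<Omega>" "g \<in> Cc_infinity \<Omega>"
  shows "(\<lambda>x. f x + g x) \<in> Cc_infinity \<Omega>"
proof -
  obtain K where K: "compact K" "K \<subseteq> \<Omega>" "\<And>x. x \<notin> K \<Longrightarrow> f x = 0"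
    using Cc_infinity_support[OF assms(1)] by metis
  obtain L where L: "compact L" "L \<subseteq> \<Omega>" "\<And>x. x \<notin> L \<Longrightarrow> g x = 0"
    using Cc_infinity_support[OF assms(2)] by metis
  show ?thesis
  proof (rule Cc_infinityI)
    show "Ck k (\<lambda>x. f x + g x)" for k
      using assms by (intro Ck_add) (auto simp: Cc_infinity_def)
    show "compact (K \<union> L)" using K L by (intro compact_Un)
    show "K \<union> L \<subseteq> \<Omega>" using K L by simp
    show "f x + g x = 0" if "x \<notin> K \<union> L" for x
      using that K(3)[of x] L(3)[of x] by simp
  qed
qed

lemma Cc_infinity_sum:
  assumes "finite I" "\<And>i. i \<in> I \<Longrightarrow> f i \<in> Cc_infinity \<Omega>"
  shows "(\<lambda>x. \<Sum>i\<in>I. f i x) \<in> Cc_infinity \<Omega>"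
  using assms by (induction I) (simp_all add: Cc_infinity_zero Cc_infinity_add)

section \<open>Modular and Luxemburg norm\<close>

lemma modular_cong_AE:
  assumes "AE x in lebesgue_on \<Omega>. \<xi> x = \<zeta> x"
  shows "modular \<Omega> p q a \<xi> = modular \<Omega> p q a \<zeta>"
  unfolding modular_def by (rule nn_integral_cong_AE) (use assms in eventually_elim, simp)

lemma modular_mono:
  assumes "a \<in> Zclass \<kappa> \<Omega>" "0 \<le> p" "0 \<le> q" "\<And>x. x \<in> \<Omega> \<Longrightarrow> norm (\<xi> x) \<le> norm (\<zeta> x)"
  shows "modular \<Omega> p q a \<xi> \<le> modular \<Omega> p q a \<zeta>"
  unfolding modular_def
proof (rule nn_integral_mono)
  fix x assume "x \<in> space (lebesgue_on \<Omega>)"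
  then have "x \<in> \<Omega>" by simp
  then show "ennreal (double_phase p q a x (norm (\<xi> x))) \<le> ennreal (double_phase p q a x (norm (\<zeta> x)))"
    using assms by (intro ennreal_leI double_phase_mono ZclassD(2)[OF assms(1)]) auto
qed

lemma modular_add_le:
  fixes \<xi> \<zeta> :: "'a::euclidean_space \<Rightarrow> 'a"
  assumes a: "a \<in> Zclass \<kappa> \<Omega>" and pq: "0 \<le> p" "p \<le> q"
    and m: "\<xi> \<in> borel_measurable (lebesgue_on \<Omega>)" "\<zeta> \<in> borel_measurable (lebesgue_on \<Omega>)"
  shows "modular \<Omega> p q a (\<lambda>x. \<xi> x + \<zeta> x) \<le> ennreal (2 powr q) * (modular \<Omega> p q a \<xi> + modular \<Omega> p q a \<zeta>)"
proof -
  have [measurable]: "(\<lambda>x. ennreal (double_phase p q a x (norm (\<xi> x)))) \<in> borel_measurable (lebesgue_on \<Omega>)"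
    "(\<lambda>x. ennreal (double_phase p q a x (norm (\<zeta> x)))) \<in> borel_measurable (lebesgue_on \<Omega>)"
    by (intro measurable_compose[OF _ measurable_ennreal] double_phase_measurable ZclassD(1)[OF a] m)+
  have "modular \<Omega> p q a (\<lambda>x. \<xi> x + \<zeta> x) \<le> (\<integral>\<^sup>+x. ennreal (2 powr q) *
      (ennreal (double_phase p q a x (norm (\<xi> x))) + ennreal (double_phase p q a x (norm (\<zeta> x)))) \<partial>lebesgue_on \<Omega>)"
    unfolding modular_def
  proof (rule nn_integral_mono)
    fix x assume "x \<in> space (lebesgue_on \<Omega>)"
    then have x: "0 \<le> a x" using ZclassD(2)[OF a] by simp
    have "ennreal (double_phase p q a x (norm (\<xi> x + \<zeta> x))) \<le>
        ennreal (2 powr q * (double_phase p q a x (norm (\<xi> x)) + double_phase p q a x (norm (\<zeta> x))))"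
      by (rule ennreal_leI, rule double_phase_norm_add_le[of a x p q, OF x pq])
    also have "\<dots> = ennreal (2 powr q) *
      (ennreal (double_phase p q a x (norm (\<xi> x))) + ennreal (double_phase p q a x (norm (\<zeta> x))))"
      using double_phase_nonneg[of a x, OF x] by (simp add: ennreal_mult ennreal_plus)
    finally show "ennreal (double_phase p q a x (norm (\<xi> x + \<zeta> x))) \<le> \<dots>" .
  qed
  also have "\<dots> = ennreal (2 powr q) * (modular \<Omega> p q a \<xi> + modular \<Omega> p q a \<zeta>)"
    unfolding modular_def by (subst nn_integral_cmult, measurable) (subst nn_integral_add, measurable)
  finally show ?thesis .
qed

lemma modular_zero: "modular \<Omega> p q a (\<lambda>x. 0) = 0"
  by (simp add: modular_def double_phase_def)

text \<open>Iterating the two-term inequality costs one factor \<open>2 powr q\<close> per summand.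
  The number of summands will be fixed by the cover, so this constant can be divided out of the
  tolerance in advance.\<close>

lemma modular_sum_le:
  fixes \<xi> :: "'i \<Rightarrow> 'a::euclidean_space \<Rightarrow> 'a"
  assumes a: "a \<in> Zclass \<kappa> \<Omega>" and pq: "0 \<le> p" "p \<le> q"
    and "finite I" "\<And>i. i \<in> I \<Longrightarrow> \<xi> i \<in> borel_measurable (lebesgue_on \<Omega>)"
  shows "modular \<Omega> p q a (\<lambda>x. \<Sum>i\<in>I. \<xi> i x) \<le> ennreal (2 powr q) ^ card I * (\<Sum>i\<in>I. modular \<Omega> p q a (\<xi> i))"
  using assms(4,5)
proof (induction I)
  case empty
  then show ?case by (simp add: modular_zero)
next
  case (insert j I)
  let ?c = "ennreal (2 powr q)"
  let ?S = "\<Sum>i\<in>I. modular \<Omega> p q a (\<xi> i)"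
  have "(1::real) \<le> 2 powr q"
    using powr_mono[of 0 q 2] pq by simp
  then have "1 \<le> ?c"
    by (metis ennreal_1 ennreal_leI)
  then have c: "1 \<le> ?c ^ card I"
    by (simp add: one_le_power)
  have "modular \<Omega> p q a (\<lambda>x. \<xi> j x + (\<Sum>i\<in>I. \<xi> i x)) \<le>
      ?c * (modular \<Omega> p q a (\<xi> j) + modular \<Omega> p q a (\<lambda>x. \<Sum>i\<in>I. \<xi> i x))"
    using insert.prems by (intro modular_add_le[OF a pq] borel_measurable_sum) auto
  also have "\<dots> \<le> ?c * (?c ^ card I * modular \<Omega> p q a (\<xi> j) + ?c ^ card I * ?S)"
  proof (intro mult_left_mono add_mono)
    show "modular \<Omega> p q a (\<xi> j) \<le> ?c ^ card I * modular \<Omega> p q a (\<xi> j)"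
      using mult_right_mono[OF c, of "modular \<Omega> p q a (\<xi> j)"] by simp
    show "modular \<Omega> p q a (\<lambda>x. \<Sum>i\<in>I. \<xi> i x) \<le> ?c ^ card I * ?S"
      using insert by simp
  qed simp
  also have "\<dots> = ?c ^ card (insert j I) * (\<Sum>i\<in>insert j I. modular \<Omega> p q a (\<xi> i))"
    using insert.hyps by (simp add: distrib_left mult.assoc)
  finally show ?case
    using insert.hyps by simp
qed

text \<open>Comparison of every point with one fixed point of \<Omega>, over a distance bounded by
  the size of \<Omega>.\<close>

lemma Zclass_bounded:
  fixes \<Omega> :: "'a::euclidean_space set"
  assumes a: "a \<in> Zclass \<kappa> \<Omega>" and \<kappa>: "0 < \<kappa>" and \<Omega>: "bounded \<Omega>"
  obtains A where "0 \<le> A" "\<And>x. x \<in> \<Omega> \<Longrightarrow> a x \<le> A"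
proof (cases "\<Omega> = {}")
  case True
  then show ?thesis using that[of 0] by simp
next
  case False
  then obtain y where y: "y \<in> \<Omega>" by auto
  obtain Z where Z: "0 < Z" "\<forall>x\<in>\<Omega>. \<forall>y\<in>\<Omega>. a x \<le> Z * (a y + norm (x - y) powr \<kappa>)"
    using ZclassD(3)[OF a] by (elim exE conjE)
  obtain B where B: "\<And>x. x \<in> \<Omega> \<Longrightarrow> norm x \<le> B"
    using \<Omega> by (auto simp: bounded_iff)
  show ?thesis
  proof (rule that)
    show "0 \<le> Z * (a y + (2 * B) powr \<kappa>)"
      using Z ZclassD(2)[OF a y] by simp
    fix x assume x: "x \<in> \<Omega>"
    have "norm (x - y) \<le> 2 * B"
      using norm_triangle_ineq4[of x y] B[OF x] B[OF y] by simp
    then have "Z * (a y + norm (x - y) powr \<kappa>) \<le> Z * (a y + (2 * B) powr \<kappa>)"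
      using Z \<kappa> by (intro mult_left_mono add_left_mono powr_mono2) auto
    then show "a x \<le> Z * (a y + (2 * B) powr \<kappa>)"
      using Z(2) x y by force
  qed
qed

lemma modular_bounded_finite:
  fixes \<Omega> :: "'a::euclidean_space set"
  assumes a: "a \<in> Zclass \<kappa> \<Omega>" and \<kappa>: "0 < \<kappa>" and \<Omega>: "bounded \<Omega>" "open \<Omega>" and pq: "0 \<le> p" "0 \<le> q"
    and \<xi>: "\<And>x. norm (\<xi> x) \<le> B"
  shows "modular \<Omega> p q a \<xi> < \<infinity>"
proof (rule Zclass_bounded[OF a \<kappa> \<Omega>(1)])
  fix A assume A: "0 \<le> A" "\<And>x. x \<in> \<Omega> \<Longrightarrow> a x \<le> A"
  have B: "0 \<le> B" using \<xi> norm_ge_zero order_trans by blast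
  have "modular \<Omega> p q a \<xi> \<le> (\<integral>\<^sup>+x. ennreal (B powr p + A * B powr q) \<partial>lebesgue_on \<Omega>)"
    unfolding modular_def
  proof (rule nn_integral_mono)
    fix x assume "x \<in> space (lebesgue_on \<Omega>)"
    then have x: "x \<in> \<Omega>" by simp
    have "double_phase p q a x (norm (\<xi> x)) \<le> B powr p + A * B powr q"
      unfolding double_phase_def
      using pq \<xi> A ZclassD(2)[OF a x] x by (intro add_mono mult_mono powr_mono2) auto
    then show "ennreal (double_phase p q a x (norm (\<xi> x))) \<le> ennreal (B powr p + A * B powr q)"
      by (rule ennreal_leI)
  qed
  also have "\<dots> = ennreal (B powr p + A * B powr q) * emeasure (lebesgue_on \<Omega>) \<Omega>"
    by simp
  also have "\<dots> < \<infinity>"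
  proof -
    have "\<Omega> \<in> lmeasurable"
      using \<Omega> by (simp add: lmeasurable_open)
    moreover from this have "emeasure (lebesgue_on \<Omega>) \<Omega> = emeasure lebesgue \<Omega>"
      by (intro emeasure_restrict_space) auto
    ultimately have "emeasure (lebesgue_on \<Omega>) \<Omega> < \<infinity>"
      using fmeasurableD2[of \<Omega> lebesgue] by (simp only: less_top infinity_ennreal_def)
    then show ?thesis
      by (simp add: ennreal_mult_less_top)
  qed
  finally show ?thesis .
qed

lemma luxemburg_norm_cong_AE:
  assumes "AE x in lebesgue_on \<Omega>. \<xi> x = \<zeta> x"
  shows "luxemburg_norm \<Omega> p q a \<xi> = luxemburg_norm \<Omega> p q a \<zeta>"
proof -
  have "(\<integral>\<^sup>+x. ennreal (double_phase p q a x (norm (\<xi> x) / l)) \<partial>lebesgue_on \<Omega>) =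
      (\<integral>\<^sup>+x. ennreal (double_phase p q a x (norm (\<zeta> x) / l)) \<partial>lebesgue_on \<Omega>)" for l
    by (rule nn_integral_cong_AE) (use assms in eventually_elim, simp)
  then show ?thesis
    by (simp add: luxemburg_norm_def)
qed

text \<open>Dividing the argument by \<open>l \<le> 1\<close> multiplies the two phases by
  \<open>1 / l powr p\<close> and \<open>1 / l powr q\<close>; the second factor is the larger one,
  so a modular of at most \<open>l powr q\<close> is enough.\<close>

lemma luxemburg_norm_le:
  fixes \<xi> :: "'a::euclidean_space \<Rightarrow> 'a"
  assumes a: "a \<in> Zclass \<kappa> \<Omega>" and pq: "0 \<le> p" "p \<le> q" and l: "0 < l" "l \<le> 1"
    and m: "\<xi> \<in> borel_measurable (lebesgue_on \<Omega>)"
    and le: "modular \<Omega> p q a \<xi> \<le> ennreal (l powr q)"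
  shows "luxemburg_norm \<Omega> p q a \<xi> \<le> ennreal l"
proof -
  have lq: "0 < l powr q" using l by simp
  have "(\<integral>\<^sup>+x. ennreal (double_phase p q a x (norm (\<xi> x) / l)) \<partial>lebesgue_on \<Omega>) \<le>
      (\<integral>\<^sup>+x. ennreal (double_phase p q a x (norm (\<xi> x))) / ennreal (l powr q) \<partial>lebesgue_on \<Omega>)"
  proof (rule nn_integral_mono)
    fix x assume "x \<in> space (lebesgue_on \<Omega>)"
    then have x: "0 \<le> a x" using ZclassD(2)[OF a] by simp
    have "(norm (\<xi> x) / l) powr p = norm (\<xi> x) powr p / l powr p"
      using l by (simp add: powr_divide)
    also have "\<dots> \<le> norm (\<xi> x) powr p / l powr q"
      using l pq by (intro divide_left_mono powr_mono') auto
    finally have 1: "(norm (\<xi> x) / l) powr p \<le> norm (\<xi> x) powr p / l powr q" .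
    have "double_phase p q a x (norm (\<xi> x) / l) \<le> double_phase p q a x (norm (\<xi> x)) / l powr q"
      using 1 l by (simp add: double_phase_def powr_divide add_divide_distrib)
    then have "ennreal (double_phase p q a x (norm (\<xi> x) / l)) \<le>
        ennreal (double_phase p q a x (norm (\<xi> x)) / l powr q)"
      by (rule ennreal_leI)
    also have "\<dots> = ennreal (double_phase p q a x (norm (\<xi> x))) / ennreal (l powr q)"
      using lq double_phase_nonneg[of a x, OF x] by (intro divide_ennreal[symmetric]) auto
    finally show "ennreal (double_phase p q a x (norm (\<xi> x) / l)) \<le>
        ennreal (double_phase p q a x (norm (\<xi> x))) / ennreal (l powr q)" .
  qed
  also have "\<dots> = (\<integral>\<^sup>+x. (1 / ennreal (l powr q)) * ennreal (double_phase p q a x (norm (\<xi> x))) \<partial>lebesgue_on \<Omega>)"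
    by (simp add: divide_ennreal_def mult.commute)
  also have "\<dots> = (1 / ennreal (l powr q)) * modular \<Omega> p q a \<xi>"
    unfolding modular_def
    by (intro nn_integral_cmult measurable_compose[OF _ measurable_ennreal] double_phase_measurable
        ZclassD(1)[OF a] m)
  also have "\<dots> \<le> (1 / ennreal (l powr q)) * ennreal (l powr q)"
    by (intro mult_left_mono le) simp
  also have "\<dots> = 1"
    using lq by (simp add: ennreal_divide_times divide_ennreal)
  finally have "ennreal l \<in> {ennreal l | l. l > 0 \<and>
      (\<integral>\<^sup>+x. ennreal (double_phase p q a x (norm (\<xi> x) / l)) \<partial>lebesgue_on \<Omega>) \<le> 1}"
    using l(1) by blast
  then show ?thesis
    unfolding luxemburg_norm_def by (rule Inf_lower)
qed

section \<open>Approximation of a localised piece\<close>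

lemma conv_abs_le:
  fixes v :: "'a::euclidean_space \<Rightarrow> real"
  assumes k: "kernel \<rho> c r" and v: "integrable lborel v" and le: "AE x in lborel. \<bar>v x\<bar> \<le> \<Lambda>"
  shows "\<bar>conv \<rho> v x\<bar> \<le> \<Lambda>"
proof -
  note C = kernel_C1c[OF k]
  have \<rho>0: "0 \<le> \<rho> y" for y using k by (simp add: kernel_def)
  have "norm (conv \<rho> v x) \<le> (\<integral>y. norm (\<rho> (x - y) *\<^sub>R v y) \<partial>lborel)"
    unfolding conv_def by (rule integral_norm_bound)
  also have "\<dots> \<le> (\<integral>y. \<rho> (x - y) * \<Lambda> \<partial>lborel)"
  proof (rule integral_mono_AE)
    show "integrable lborel (\<lambda>y. norm (\<rho> (x - y) *\<^sub>R v y))"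
      by (intro integrable_norm conv_integrable[OF C v])
    show "integrable lborel (\<lambda>y. \<rho> (x - y) * \<Lambda>)"
      by (intro integrable_mult_left kernel_integral_reflect(2)[OF k])
    show "AE y in lborel. norm (\<rho> (x - y) *\<^sub>R v y) \<le> \<rho> (x - y) * \<Lambda>"
      using le by eventually_elim (simp add: abs_mult \<rho>0 mult_left_mono)
  qed
  also have "\<dots> = \<Lambda>"
    using kernel_integral_reflect[OF k] by simp
  finally show ?thesis by simp
qed

lemma C1_lipschitz:
  assumes f: "C1 f D" and B: "\<And>x. norm (D x) \<le> B"
  shows "\<bar>f x - f y\<bar> \<le> B * norm (x - y)"
proof -
  have "norm (f x - f y) \<le> B * norm (x - y)"
  proof (rule differentiable_bound[OF convex_UNIV])
    show "(f has_derivative (\<lambda>h. D x \<bullet> h)) (at x within UNIV)" for x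
      using f by (simp add: C1_def)
    show "onorm (\<lambda>h. D x \<bullet> h) \<le> B" for x
    proof (rule onorm_le)
      fix h
      show "norm (D x \<bullet> h) \<le> B * norm h"
        using order_trans[OF Cauchy_Schwarz_ineq2 mult_right_mono[OF B[of x] norm_ge_zero[of h]]] by simp
    qed
  qed auto
  then show ?thesis by simp
qed

text \<open>The product difference splits into an oscillation of \<open>u\<close> and one of
  \<theta>. The latter is Lipschitz, and at distances up to 1 a first power is dominated by the
  power \<gamma>.\<close>

lemma localized_oscillation:
  fixes u \<theta> :: "'a::euclidean_space \<Rightarrow> real"
  assumes \<theta>: "C1 \<theta> D" "\<And>x. norm (D x) \<le> L" "\<And>x. 0 \<le> \<theta> x" "\<And>x. \<theta> x \<le> 1"
    and u: "\<And>x. \<bar>u x\<bar> \<le> B" and \<gamma>: "\<gamma> \<le> 1"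
    and osc: "\<bar>u x - u y\<bar> \<le> H * dist x y powr \<gamma>" and xy: "dist x y \<le> 1"
  shows "\<bar>\<theta> x * u x - \<theta> y * u y\<bar> \<le> (H + B * L) * dist x y powr \<gamma>"
proof -
  have B: "0 \<le> B" using u[of x] by linarith
  have L: "0 \<le> L" using \<theta>(2) norm_ge_zero order_trans by blast
  have "\<theta> x * u x - \<theta> y * u y = \<theta> x * (u x - u y) + u y * (\<theta> x - \<theta> y)"
    by (simp add: algebra_simps)
  also have "\<bar>\<dots>\<bar> \<le> \<theta> x * \<bar>u x - u y\<bar> + \<bar>u y\<bar> * \<bar>\<theta> x - \<theta> y\<bar>"
    by (rule order_trans[OF abs_triangle_ineq]) (simp add: abs_mult \<theta>(3))
  also have "\<dots> \<le> 1 * \<bar>u x - u y\<bar> + B * (L * norm (x - y))"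
    by (intro add_mono mult_mono \<theta> u C1_lipschitz[OF \<theta>(1,2)] B) auto
  also have "\<dots> \<le> H * dist x y powr \<gamma> + B * (L * dist x y powr \<gamma>)"
  proof (intro add_mono mult_left_mono)
    show "norm (x - y) \<le> dist x y powr \<gamma>"
      using powr_mono'[OF \<gamma>, of "dist x y"] xy by (simp add: dist_norm)
  qed (use osc B L in auto)
  finally show ?thesis by (simp add: algebra_simps)
qed

text \<open>On the ball around \<open>z\<close> one shift direction works throughout, which is why
  the function is localised first. The term \<open>u x *\<^sub>R D x\<close> of the product rule has
  finite energy because both factors are bounded. The final bound holds since \<theta> takes values
  between 0 and 1 and the kernel has mass 1.\<close>

lemma piece_approximation:
  fixes u :: "'a::euclidean_space \<Rightarrow> real"
  assumes \<Omega>: "open \<Omega>" "bounded \<Omega>" and a: "a \<in> Zclass \<kappa> \<Omega>" and pq: "1 < p" "p < q" and \<kappa>: "0 < \<kappa>"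
    and u: "sob u G" and u0: "\<And>x. x \<notin> \<Omega> \<Longrightarrow> u x = 0" and G0: "\<And>x. x \<notin> \<Omega> \<Longrightarrow> G x = 0"
    and fin: "modular \<Omega> p q a G < \<infinity>" and B: "\<And>x. \<bar>u x\<bar> \<le> B"
    and \<gamma>: "0 \<le> \<gamma>" "\<gamma> \<le> 1" "(q - p) * (1 - \<gamma>) \<le> \<kappa>"
    and H: "0 \<le> H" "\<And>x y. dist x y \<le> 1 \<Longrightarrow> \<bar>u x - u y\<bar> \<le> H * dist x y powr \<gamma>"
    and \<theta>: "C1c \<theta> D" "\<And>x. 0 \<le> \<theta> x" "\<And>x. \<theta> x \<le> 1" "\<And>x. x \<notin> cball z R \<Longrightarrow> \<theta> x = 0"
    and s: "0 < s" "0 < \<delta>0"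
    and shift: "\<And>y \<delta> w. y \<in> closure \<Omega> \<inter> cball z R \<Longrightarrow> 0 < \<delta> \<Longrightarrow> \<delta> < \<delta>0 \<Longrightarrow>
      w \<in> cball (\<delta> *\<^sub>R c) (\<delta> * s) \<Longrightarrow> y + w \<in> \<Omega>"
    and e: "0 < e"
  shows "\<exists>w. w \<in> Cc_infinity \<Omega> \<and> (\<integral>x. norm (w x - \<theta> x * u x) \<partial>lborel) < e \<and>
    modular \<Omega> p q a (\<lambda>x. grad w x - (\<theta> x *\<^sub>R G x + u x *\<^sub>R D x)) < ennreal e \<and>
    (\<forall>\<Lambda>. (AE x in lborel. \<bar>u x\<bar> \<le> \<Lambda>) \<longrightarrow> (\<forall>x. \<bar>w x\<bar> \<le> \<Lambda>))"
proof -
  define v where "v x = \<theta> x * u x" for x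
  define F where "F x = \<theta> x *\<^sub>R G x + u x *\<^sub>R D x" for x
  have v: "sob v F"
    unfolding v_def F_def by (rule sob_mult[OF u \<theta>(1)])
  have F0: "F x = 0" if "x \<notin> \<Omega>" for x
    using that by (simp add: F_def u0 G0)
  obtain L where L: "0 < L" "\<And>x. norm (D x) \<le> L"
    using C1c_bounded[OF \<theta>(1)] by metis
  have B0: "0 \<le> B" using B[of undefined] by linarith
  have [measurable]: "\<theta> \<in> borel_measurable borel" "D \<in> borel_measurable borel"
    "u \<in> borel_measurable borel" "G \<in> borel_measurable borel"
    using C1c_measurable[OF \<theta>(1)] sob_integrable(3,4)[OF u] by simp_all
  have "modular \<Omega> p q a F \<le> ennreal (2 powr q) *
      (modular \<Omega> p q a (\<lambda>x. \<theta> x *\<^sub>R G x) + modular \<Omega> p q a (\<lambda>x. u x *\<^sub>R D x))"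
    unfolding F_def
  proof (rule modular_add_le[OF a])
    show "(\<lambda>x. \<theta> x *\<^sub>R G x) \<in> borel_measurable (lebesgue_on \<Omega>)"
      "(\<lambda>x. u x *\<^sub>R D x) \<in> borel_measurable (lebesgue_on \<Omega>)"
      by (intro measurable_lebesgue_on; measurable)+
  qed (use pq in auto)
  also have "\<dots> < \<infinity>"
  proof -
    have "modular \<Omega> p q a (\<lambda>x. \<theta> x *\<^sub>R G x) \<le> modular \<Omega> p q a G"
      using pq \<theta>(2,3) by (intro modular_mono[OF a]) (auto intro: mult_left_le_one_le)
    then have 1: "modular \<Omega> p q a (\<lambda>x. \<theta> x *\<^sub>R G x) < \<infinity>"
      using fin by (rule le_less_trans)
    have 2: "modular \<Omega> p q a (\<lambda>x. u x *\<^sub>R D x) < \<infinity>"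
    proof (rule modular_bounded_finite[OF a \<kappa> \<Omega>(2,1)])
      show "norm (u x *\<^sub>R D x) \<le> B * L" for x
        using B L B0 by (simp add: mult_mono)
    qed (use pq in auto)
    show ?thesis
      using 1 2 by (simp add: ennreal_mult_less_top)
  qed
  finally have finF: "modular \<Omega> p q a F < \<infinity>" .
  have "\<exists>\<rho> \<delta>. 0 < \<delta> \<and> \<delta> < \<delta>0 \<and> kernel \<rho> (\<delta> *\<^sub>R c) (\<delta> * s) \<and>
      (\<integral>x. norm (conv \<rho> v x - v x) \<partial>lborel) < e \<and> modular \<Omega> p q a (\<lambda>x. conv \<rho> F x - F x) < ennreal e"
  proof (rule energy_mollification[OF \<Omega>(1) a pq \<kappa> v F0 finF \<gamma>(1,3) _ _ s e])
    show "0 \<le> H + B * L" using H B0 L by simp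
    fix x y :: 'a assume xy: "dist x y \<le> 1"
    have \<theta>1: "C1 \<theta> D" using \<theta>(1) by (simp add: C1c_def)
    show "\<bar>v x - v y\<bar> \<le> (H + B * L) * dist x y powr \<gamma>"
      unfolding v_def by (rule localized_oscillation[OF \<theta>1 L(2) \<theta>(2,3) B \<gamma>(2) H(2)[OF xy] xy])
  qed
  then obtain \<rho> \<delta> where \<delta>: "0 < \<delta>" "\<delta> < \<delta>0" and k: "kernel \<rho> (\<delta> *\<^sub>R c) (\<delta> * s)"
    and conv: "(\<integral>x. norm (conv \<rho> v x - v x) \<partial>lborel) < e" "modular \<Omega> p q a (\<lambda>x. conv \<rho> F x - F x) < ennreal e"
    by (elim exE conjE)
  note C = kernel_C1c[OF k]
  have grad: "grad (conv \<rho> v) = conv \<rho> F"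
    by (rule C1_grad[OF C1_conv_sob[OF v C]])
  have cc: "conv \<rho> v \<in> Cc_infinity \<Omega>"
  proof (rule Cc_infinityI)
    obtain r where r: "\<And>x. x \<notin> cball 0 r \<Longrightarrow> \<rho> x = 0"
      using C1cE[OF C] by metis
    show "Ck j (conv \<rho> v)" for j
      by (rule Ck_conv[OF _ r sob_integrable(1)[OF v]]) (use k in \<open>auto simp: kernel_def\<close>)
    define S where "S = closure \<Omega> \<inter> cball z R"
    define T where "T = cball (\<delta> *\<^sub>R c) (\<delta> * s)"
    have "compact S" "compact T"
      using \<Omega>(2) by (simp_all add: S_def T_def compact_closure closed_Int_compact)
    then show "compact {x + y | x y. x \<in> S \<and> y \<in> T}"
      by (rule compact_sums)
    show "{x + y | x y. x \<in> S \<and> y \<in> T} \<subseteq> \<Omega>"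
      unfolding S_def T_def using shift \<delta> by (intro subsetI, elim CollectE exE conjE) simp
    fix x assume x: "x \<notin> {x + y | x y. x \<in> S \<and> y \<in> T}"
    have "\<rho> (x - y) *\<^sub>R v y = 0" for y
    proof (rule ccontr)
      assume "\<rho> (x - y) *\<^sub>R v y \<noteq> 0"
      then have n: "\<rho> (x - y) \<noteq> 0" "\<theta> y \<noteq> 0" "u y \<noteq> 0"
        by (simp_all add: v_def)
      have "x - y \<in> T"
        using n(1) k unfolding kernel_def T_def by metis
      moreover have "y \<in> \<Omega>" "y \<in> cball z R"
        using n(2,3) u0 \<theta>(4) by metis+
      then have "y \<in> S"
        unfolding S_def using closure_subset[of \<Omega>] by auto
      moreover have "x = y + (x - y)" by simp
      ultimately show False
        using x by blast
    qed
    then show "conv \<rho> v x = 0"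
      unfolding conv_def by (simp only:) simp
  qed
  have bd: "\<bar>conv \<rho> v x\<bar> \<le> \<Lambda>" if \<Lambda>: "AE x in lborel. \<bar>u x\<bar> \<le> \<Lambda>" for \<Lambda> x
  proof (rule conv_abs_le[OF k sob_integrable(1)[OF v]])
    show "AE x in lborel. \<bar>v x\<bar> \<le> \<Lambda>"
      using \<Lambda>
    proof eventually_elim
      fix x assume "\<bar>u x\<bar> \<le> \<Lambda>"
      moreover have "\<theta> x * \<bar>u x\<bar> \<le> 1 * \<bar>u x\<bar>"
        by (intro mult_right_mono \<theta>) simp
      ultimately show "\<bar>v x\<bar> \<le> \<Lambda>"
        using \<theta>(2)[of x] by (simp add: v_def abs_mult)
    qed
  qed
  show ?thesis
    using cc conv bd unfolding grad[symmetric] F_def v_def by (intro exI[of _ "conv \<rho> v"]) (simp add: v_def[abs_def])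
qed

section \<open>Approximation\<close>

text \<open>Gathers the data that depend on \<Omega> alone. The cardinality of \<open>I\<close> can
  then be fixed before the exponents and the weight, which makes the final constant depend only on
  the domain.\<close>

definition shift_cover ::
    "'a::euclidean_space set \<Rightarrow> 'a set \<Rightarrow> ('a \<Rightarrow> real) \<Rightarrow> ('a \<Rightarrow> 'a) \<Rightarrow> ('a \<Rightarrow> real) \<Rightarrow> ('a \<Rightarrow> real) \<Rightarrow> bool" where
  "shift_cover \<Omega> I R c s \<delta>0 \<longleftrightarrow> finite I \<and> closure \<Omega> \<subseteq> (\<Union>i\<in>I. ball i (R i)) \<and>
    (\<forall>i\<in>I. 0 < R i \<and> 0 < s i \<and> 0 < \<delta>0 i \<and>
      (\<forall>y \<delta> w. y \<in> closure \<Omega> \<inter> cball i (R i) \<longrightarrow> 0 < \<delta> \<longrightarrow> \<delta> < \<delta>0 i \<longrightarrow>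
        w \<in> cball (\<delta> *\<^sub>R c i) (\<delta> * s i) \<longrightarrow> y + w \<in> \<Omega>))"

lemma shift_cover_exists:
  fixes \<Omega> :: "'a::euclidean_space set"
  assumes \<Omega>: "lipschitz_domain \<Omega>" "bounded \<Omega>"
  shows "\<exists>I R c s \<delta>0. shift_cover \<Omega> I R c s \<delta>0"
proof -
  define Q where "Q z R c s \<delta>0 \<longleftrightarrow> 0 < R \<and> 0 < s \<and> 0 < \<delta>0 \<and>
    (\<forall>y \<delta> w. y \<in> closure \<Omega> \<inter> cball z R \<longrightarrow> 0 < \<delta> \<longrightarrow> \<delta> < \<delta>0 \<longrightarrow> w \<in> cball (\<delta> *\<^sub>R c) (\<delta> * s) \<longrightarrow> y + w \<in> \<Omega>)"
    for z c :: 'a and R s \<delta>0 :: real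
  \<comment> \<open>The four local data are packed into one tuple so that a single choice function
    delivers them together.\<close>
  have "\<forall>z\<in>closure \<Omega>. \<exists>p. Q z (fst p) (fst (snd p)) (fst (snd (snd p))) (snd (snd (snd p)))"
  proof
    fix z assume "z \<in> closure \<Omega>"
    from local_shift[OF \<Omega>(1) this] obtain R c s \<delta>0 where "Q z R c s \<delta>0"
      unfolding Q_def by (elim exE)
    then show "\<exists>p. Q z (fst p) (fst (snd p)) (fst (snd (snd p))) (snd (snd (snd p)))"
      by (intro exI[of _ "(R, c, s, \<delta>0)"]) simp
  qed
  from bchoice[OF this] obtain P where
    P: "\<forall>z\<in>closure \<Omega>. Q z (fst (P z)) (fst (snd (P z))) (fst (snd (snd (P z)))) (snd (snd (snd (P z))))"
    by (elim exE)
  have cov: "closure \<Omega> \<subseteq> (\<Union>z\<in>closure \<Omega>. ball z (fst (P z)))"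
  proof
    fix z assume z: "z \<in> closure \<Omega>"
    then have "0 < fst (P z)"
      using P unfolding Q_def by blast
    then show "z \<in> (\<Union>z\<in>closure \<Omega>. ball z (fst (P z)))"
      using z by (intro UN_I[OF z]) simp
  qed
  have "compact (closure \<Omega>)"
    using \<Omega>(2) by (simp add: compact_closure)
  from compactE_image[OF this _ cov] obtain I where I: "I \<subseteq> closure \<Omega>" "finite I"
    "closure \<Omega> \<subseteq> (\<Union>z\<in>I. ball z (fst (P z)))"
    by (metis open_ball)
  have "shift_cover \<Omega> I (\<lambda>z. fst (P z)) (\<lambda>z. fst (snd (P z))) (\<lambda>z. fst (snd (snd (P z)))) (\<lambda>z. snd (snd (snd (P z))))"
    unfolding shift_cover_def
  proof (intro conjI I ballI)
    fix i assume "i \<in> I"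
    then have "Q i (fst (P i)) (fst (snd (P i))) (fst (snd (snd (P i)))) (snd (snd (snd (P i))))"
      using P I(1) by blast
    then show "0 < fst (P i)" "0 < fst (snd (snd (P i)))" "0 < snd (snd (snd (P i)))"
      "\<forall>y \<delta> w. y \<in> closure \<Omega> \<inter> cball i (fst (P i)) \<longrightarrow> 0 < \<delta> \<longrightarrow> \<delta> < snd (snd (snd (P i))) \<longrightarrow>
        w \<in> cball (\<delta> *\<^sub>R fst (snd (P i))) (\<delta> * fst (snd (snd (P i)))) \<longrightarrow> y + w \<in> \<Omega>"
      unfolding Q_def by simp_all
  qed
  then show ?thesis by (intro exI)
qed

lemma grad_sum:
  assumes "finite I" "\<And>i. i \<in> I \<Longrightarrow> w i \<in> Cc_infinity \<Omega>"
  shows "grad (\<lambda>x. \<Sum>i\<in>I. w i x) = (\<lambda>x. \<Sum>i\<in>I. grad (w i) x)"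
proof (rule C1_grad, rule C1_sum[OF assms(1)])
  show "C1 (w i) (grad (w i))" if "i \<in> I" for i
    using Cc_infinity_C1c[OF assms(2)[OF that]] by (simp add: C1c_def)
qed

text \<open>Each piece may use its own kernel and scale, because only the sum of the approximants is
  compared with \<open>u\<close>. The supremum bound adds up once per ball.\<close>

lemma bounded_approximation:
  fixes u :: "'a::euclidean_space \<Rightarrow> real"
  assumes \<Omega>: "open \<Omega>" "bounded \<Omega>" and cov: "shift_cover \<Omega> I R c s \<delta>0"
    and a: "a \<in> Zclass \<kappa> \<Omega>" and pq: "1 < p" "p < q" and \<kappa>: "0 < \<kappa>"
    and u: "sob u G" and u0: "\<And>x. x \<notin> \<Omega> \<Longrightarrow> u x = 0" and G0: "\<And>x. x \<notin> \<Omega> \<Longrightarrow> G x = 0"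
    and fin: "modular \<Omega> p q a G < \<infinity>" and B: "\<And>x. \<bar>u x\<bar> \<le> B"
    and \<gamma>: "0 \<le> \<gamma>" "\<gamma> \<le> 1" "(q - p) * (1 - \<gamma>) \<le> \<kappa>"
    and H: "0 \<le> H" "\<And>x y. dist x y \<le> 1 \<Longrightarrow> \<bar>u x - u y\<bar> \<le> H * dist x y powr \<gamma>"
    and e: "0 < e"
  shows "\<exists>w. w \<in> Cc_infinity \<Omega> \<and> (\<integral>x. norm (w x - u x) \<partial>lborel) < e \<and>
    modular \<Omega> p q a (\<lambda>x. grad w x - G x) < ennreal e \<and>
    (\<forall>\<Lambda>. (AE x in lborel. \<bar>u x\<bar> \<le> \<Lambda>) \<longrightarrow> (\<forall>x. \<bar>w x\<bar> \<le> real (card I) * \<Lambda>))"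
proof -
  have I: "finite I" "closure \<Omega> \<subseteq> (\<Union>i\<in>I. ball i (R i))"
    and Rpos: "\<And>i. i \<in> I \<Longrightarrow> 0 < R i"
    and sh: "\<And>i. i \<in> I \<Longrightarrow> 0 < s i" "\<And>i. i \<in> I \<Longrightarrow> 0 < \<delta>0 i"
    and shift: "\<And>i y \<delta> w. i \<in> I \<Longrightarrow> y \<in> closure \<Omega> \<inter> cball i (R i) \<Longrightarrow> 0 < \<delta> \<Longrightarrow> \<delta> < \<delta>0 i \<Longrightarrow>
        w \<in> cball (\<delta> *\<^sub>R c i) (\<delta> * s i) \<Longrightarrow> y + w \<in> \<Omega>"
    using cov unfolding shift_cover_def by simp_all
  have comp: "compact (closure \<Omega>)"
    using \<Omega>(2) by (simp add: compact_closure)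
  define n where "n = card I"
  define C where "C = (2 powr q) ^ n"
  have C: "1 \<le> C"
    unfolding C_def using powr_mono[of 0 q 2] pq by (intro one_le_power) simp
  \<comment> \<open>\<open>C\<close> is the loss in \<open>modular_sum_le\<close>. Dividing by
    \<open>n + 1\<close> instead of \<open>n\<close> gives strict inequalities and a positive
    divisor.\<close>
  define e' where "e' = e / (real (n + 1) * C)"
  have e': "0 < e'" using e C by (simp add: e'_def)
  have small: "C * (real n * e') < e" "real n * e' < e"
  proof -
    have eq: "C * (real (n + 1) * e') = e"
      using C by (simp add: e'_def)
    have "C * (real n * e') < C * (real (n + 1) * e')"
      using C e' by simp
    with eq show "C * (real n * e') < e" by simp
    moreover have "1 * (real n * e') \<le> C * (real n * e')"
      using C e' by (intro mult_right_mono) auto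
    ultimately show "real n * e' < e" by simp
  qed
  show ?thesis
  proof (rule C1_partition_of_unity[OF comp I(1) Rpos I(2)])
    fix \<theta> :: "'a \<Rightarrow> 'a \<Rightarrow> real" and D :: "'a \<Rightarrow> 'a \<Rightarrow> 'a"
    assume \<theta>: "\<And>i. i \<in> I \<Longrightarrow> C1c (\<theta> i) (D i)" "\<And>i x. i \<in> I \<Longrightarrow> 0 \<le> \<theta> i x"
      "\<And>i x. i \<in> I \<Longrightarrow> \<theta> i x \<le> 1" "\<And>i x. i \<in> I \<Longrightarrow> x \<notin> cball i (R i) \<Longrightarrow> \<theta> i x = 0"
      and one: "\<And>x. x \<in> closure \<Omega> \<Longrightarrow> (\<Sum>i\<in>I. \<theta> i x) = 1"
      and zero: "\<And>x. x \<in> interior (closure \<Omega>) \<Longrightarrow> (\<Sum>i\<in>I. D i x) = 0"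
    define good where "good i w \<longleftrightarrow> w \<in> Cc_infinity \<Omega> \<and> (\<integral>x. norm (w x - \<theta> i x * u x) \<partial>lborel) < e' \<and>
      modular \<Omega> p q a (\<lambda>x. grad w x - (\<theta> i x *\<^sub>R G x + u x *\<^sub>R D i x)) < ennreal e' \<and>
      (\<forall>\<Lambda>. (AE x in lborel. \<bar>u x\<bar> \<le> \<Lambda>) \<longrightarrow> (\<forall>x. \<bar>w x\<bar> \<le> \<Lambda>))" for i w
    have "\<forall>i\<in>I. \<exists>w. good i w"
      unfolding good_def
    proof
      fix i assume i: "i \<in> I"
      show "\<exists>w. w \<in> Cc_infinity \<Omega> \<and> (\<integral>x. norm (w x - \<theta> i x * u x) \<partial>lborel) < e' \<and>
        modular \<Omega> p q a (\<lambda>x. grad w x - (\<theta> i x *\<^sub>R G x + u x *\<^sub>R D i x)) < ennreal e' \<and>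
        (\<forall>\<Lambda>. (AE x in lborel. \<bar>u x\<bar> \<le> \<Lambda>) \<longrightarrow> (\<forall>x. \<bar>w x\<bar> \<le> \<Lambda>))"
        by (rule piece_approximation[OF \<Omega> a pq \<kappa> u u0 G0 fin B \<gamma> H
              \<theta>(1)[OF i] \<theta>(2)[OF i] \<theta>(3)[OF i] \<theta>(4)[OF i] sh(1)[OF i] sh(2)[OF i] shift[OF i] e'])
    qed
    from bchoice[OF this] obtain w where "\<forall>i\<in>I. good i (w i)" by (elim exE)
    then have w: "\<And>i. i \<in> I \<Longrightarrow> w i \<in> Cc_infinity \<Omega>"
      and wL: "\<And>i. i \<in> I \<Longrightarrow> (\<integral>x. norm (w i x - \<theta> i x * u x) \<partial>lborel) < e'"
      and wM: "\<And>i. i \<in> I \<Longrightarrow> modular \<Omega> p q a (\<lambda>x. grad (w i) x - (\<theta> i x *\<^sub>R G x + u x *\<^sub>R D i x)) < ennreal e'"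
      and wB: "\<And>i \<Lambda> x. i \<in> I \<Longrightarrow> AE x in lborel. \<bar>u x\<bar> \<le> \<Lambda> \<Longrightarrow> \<bar>w i x\<bar> \<le> \<Lambda>"
      unfolding good_def by simp_all
    have sumu: "(\<Sum>i\<in>I. \<theta> i x * u x) = u x" for x
    proof (cases "x \<in> \<Omega>")
      case True
      then have "x \<in> closure \<Omega>" using closure_subset by (rule subsetD[rotated])
      then show ?thesis by (simp add: sum_distrib_right[symmetric] one)
    qed (simp add: u0)
    \<comment> \<open>Since \<Omega> lies in the interior of its closure, the terms
      \<open>D i x\<close> add up to 0 on \<Omega>; outside, \<open>u\<close> and \<open>G\<close>
      vanish.\<close>
    have sumG: "(\<Sum>i\<in>I. \<theta> i x *\<^sub>R G x + u x *\<^sub>R D i x) = G x" for x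
    proof (cases "x \<in> \<Omega>")
      case True
      have "\<Omega> \<subseteq> interior (closure \<Omega>)"
        by (rule interior_maximal[OF closure_subset \<Omega>(1)])
      then have "x \<in> interior (closure \<Omega>)" "x \<in> closure \<Omega>"
        using True interior_subset[of "closure \<Omega>"] by (auto dest: subsetD)
      then show ?thesis
        by (simp add: sum.distrib scaleR_sum_left[symmetric] scaleR_sum_right[symmetric] one zero)
    qed (simp add: u0 G0)
    have iu: "integrable lborel (\<lambda>x. \<theta> i x * u x)" "integrable lborel (w i)" if i: "i \<in> I" for i
      using sob_integrable(1)[OF sob_mult[OF u \<theta>(1)[OF i]]] C1c_integrable(1)[OF Cc_infinity_C1c[OF w[OF i]]]
      by simp_all
    define W where "W x = (\<Sum>i\<in>I. w i x)" for x
    have Wc: "W \<in> Cc_infinity \<Omega>"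
      unfolding W_def by (rule Cc_infinity_sum[OF I(1) w])
    have "(\<integral>x. norm (W x - u x) \<partial>lborel) = (\<integral>x. norm (\<Sum>i\<in>I. (w i x - \<theta> i x * u x)) \<partial>lborel)"
      by (simp add: W_def sum_subtractf sumu)
    also have "\<dots> \<le> (\<integral>x. (\<Sum>i\<in>I. norm (w i x - \<theta> i x * u x)) \<partial>lborel)"
      using iu by (intro integral_mono integrable_norm Bochner_Integration.integrable_sum
          Bochner_Integration.integrable_diff norm_sum) auto
    also have "\<dots> = (\<Sum>i\<in>I. \<integral>x. norm (w i x - \<theta> i x * u x) \<partial>lborel)"
      using iu by (intro Bochner_Integration.integral_sum integrable_norm Bochner_Integration.integrable_diff) auto
    also have "\<dots> \<le> (\<Sum>i\<in>I. e')"
      by (intro sum_mono less_imp_le wL)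
    also have "\<dots> < e"
      using small(2) by (simp add: n_def)
    finally have L: "(\<integral>x. norm (W x - u x) \<partial>lborel) < e" .
    have meas: "(\<lambda>x. grad (w i) x - (\<theta> i x *\<^sub>R G x + u x *\<^sub>R D i x)) \<in> borel_measurable (lebesgue_on \<Omega>)" if i: "i \<in> I" for i
      using C1c_measurable(2)[OF Cc_infinity_C1c[OF w[OF i]]] sob_integrable(4)[OF sob_mult[OF u \<theta>(1)[OF i]]]
      by (intro measurable_lebesgue_on borel_measurable_diff)
    have "grad (\<lambda>x. \<Sum>i\<in>I. w i x) = (\<lambda>x. \<Sum>i\<in>I. grad (w i) x)"
      by (rule grad_sum[OF I(1) w])
    then have gW: "grad W x = (\<Sum>i\<in>I. grad (w i) x)" for x
      by (simp add: W_def[abs_def])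
    have "modular \<Omega> p q a (\<lambda>x. grad W x - G x) =
        modular \<Omega> p q a (\<lambda>x. \<Sum>i\<in>I. grad (w i) x - (\<theta> i x *\<^sub>R G x + u x *\<^sub>R D i x))"
      by (simp only: gW sum_subtractf sumG)
    also have "\<dots> \<le> ennreal (2 powr q) ^ n *
        (\<Sum>i\<in>I. modular \<Omega> p q a (\<lambda>x. grad (w i) x - (\<theta> i x *\<^sub>R G x + u x *\<^sub>R D i x)))"
      unfolding n_def using pq by (intro modular_sum_le[OF a _ _ I(1) meas]) auto
    also have "\<dots> \<le> ennreal (2 powr q) ^ n * (\<Sum>i\<in>I. ennreal e')"
      by (rule mult_left_mono[OF sum_mono[OF less_imp_le[OF wM]]]) simp_all
    also have "\<dots> = ennreal (C * (real n * e'))"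
      using e' C by (simp add: C_def n_def ennreal_power ennreal_mult ennreal_of_nat_eq_real_of_nat)
    also have "\<dots> < ennreal e"
      using small(1) e by (simp add: ennreal_lessI)
    finally have M: "modular \<Omega> p q a (\<lambda>x. grad W x - G x) < ennreal e" .
    have "\<bar>W x\<bar> \<le> real (card I) * \<Lambda>" if "AE x in lborel. \<bar>u x\<bar> \<le> \<Lambda>" for \<Lambda> x
    proof -
      have "\<bar>W x\<bar> \<le> (\<Sum>i\<in>I. \<bar>w i x\<bar>)"
        unfolding W_def by (rule sum_abs)
      also have "\<dots> \<le> (\<Sum>i\<in>I. \<Lambda>)"
        by (intro sum_mono wB that)
      finally show ?thesis by simp
    qed
    with Wc L M show ?thesis
      by (intro exI[of _ W]) simp
  qed
qed

text \<open>A continuously differentiable truncation, so that \<open>sob_chain\<close> applies. Its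
  derivative lies between 0 and 1, hence truncation never increases the length of the
  gradient.\<close>

lemma truncation_function:
  fixes m :: real
  assumes m: "0 < m"
  defines "T \<equiv> \<lambda>t. t / sqrt (1 + (t / m)\<^sup>2)" and "T' \<equiv> \<lambda>t. 1 / (sqrt (1 + (t / m)\<^sup>2)) ^ 3"
  shows "(T has_real_derivative T' t) (at t)" "continuous_on UNIV T'" "T 0 = 0" "0 \<le> T' t" "T' t \<le> 1"
    "\<bar>T t\<bar> \<le> \<bar>t\<bar>" "\<bar>T t\<bar> \<le> m"
proof -
  define S where "S t = sqrt (1 + (t / m)\<^sup>2)" for t
  have pos: "0 < 1 + (t / m)\<^sup>2" for t
    by (simp add: add_pos_nonneg)
  have S1: "1 \<le> S t" for t
    by (simp add: S_def)
  have S2: "S t * S t = 1 + (t / m)\<^sup>2" for t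
    using pos[of t] by (simp add: S_def)
  have tS: "T t = t / S t" "T' t = 1 / S t ^ 3" for t
    by (simp_all add: T_def T'_def S_def)
  have Spos: "0 < S t" for t
    using S1[of t] by simp
  have dS: "(S has_real_derivative (t / m\<^sup>2) / S t) (at t)" for t
  proof -
    have "((\<lambda>t. 1 + (t / m)\<^sup>2) has_real_derivative 2 * t / m\<^sup>2) (at t)"
      using m by (auto intro!: derivative_eq_intros simp: power2_eq_square)
    from DERIV_chain2[OF DERIV_real_sqrt[OF pos] this]
    show ?thesis
      unfolding S_def[abs_def] by (rule DERIV_cong) (simp add: field_simps)
  qed
  have dT: "(1 * S t - t * ((t / m\<^sup>2) / S t)) / (S t * S t) = 1 / S t ^ 3"
  proof -
    have "S t * (1 * S t - t * ((t / m\<^sup>2) / S t)) = S t * S t - t * t / m\<^sup>2"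
      using Spos[of t] by (simp add: algebra_simps)
    also have "\<dots> = 1"
      unfolding S2 by (simp add: power2_eq_square)
    finally have "1 * S t - t * ((t / m\<^sup>2) / S t) = 1 / S t"
      using Spos[of t] by (simp add: field_simps)
    then show ?thesis
      by (simp add: power3_eq_cube)
  qed
  have "((\<lambda>t. t / S t) has_real_derivative (1 * S t - t * ((t / m\<^sup>2) / S t)) / (S t * S t)) (at t)"
    by (rule DERIV_divide[OF DERIV_ident dS]) (use Spos[of t] in simp)
  then show "(T has_real_derivative T' t) (at t)"
    unfolding dT tS(2) by (simp add: tS(1)[abs_def])
  have "S t \<noteq> 0" for t using Spos[of t] by simp
  then show "continuous_on UNIV T'"
    unfolding T'_def using pos m by (intro continuous_intros) (auto simp: S_def)
  show "T 0 = 0" by (simp add: T_def)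
  show "0 \<le> T' t" using Spos[of t] by (simp add: tS)
  show "T' t \<le> 1"
    using S1[of t] by (simp add: tS one_le_power)
  have "\<bar>t\<bar> * 1 \<le> \<bar>t\<bar> * S t"
    by (intro mult_left_mono S1) simp
  then show "\<bar>T t\<bar> \<le> \<bar>t\<bar>"
    using Spos[of t] by (simp add: tS abs_divide pos_divide_le_eq)
  have "\<bar>t / m\<bar> \<le> S t"
    unfolding S_def by (rule real_le_rsqrt) (simp only: power2_abs le_add_same_cancel2 zero_le_one)
  then show "\<bar>T t\<bar> \<le> m"
    using Spos[of t] m by (simp add: tS abs_divide pos_divide_le_eq field_simps)
qed

lemma truncation_tendsto:
  fixes t :: real
  shows "(\<lambda>n. t / sqrt (1 + (t / real (Suc n))\<^sup>2)) \<longlonglongrightarrow> t"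
    and "(\<lambda>n. 1 / (sqrt (1 + (t / real (Suc n))\<^sup>2)) ^ 3) \<longlonglongrightarrow> 1"
proof -
  have "(\<lambda>n. t * inverse (real (Suc n))) \<longlonglongrightarrow> t * 0"
    by (intro tendsto_mult tendsto_const LIMSEQ_inverse_real_of_nat)
  then have "(\<lambda>n. t / real (Suc n)) \<longlonglongrightarrow> 0"
    by (simp add: divide_inverse)
  then have S: "(\<lambda>n. sqrt (1 + (t / real (Suc n))\<^sup>2)) \<longlonglongrightarrow> sqrt (1 + 0\<^sup>2)"
    by (intro tendsto_real_sqrt tendsto_add tendsto_const tendsto_power)
  have "(\<lambda>n. t / sqrt (1 + (t / real (Suc n))\<^sup>2)) \<longlonglongrightarrow> t / sqrt (1 + 0\<^sup>2)"
    by (rule tendsto_divide[OF tendsto_const S]) simp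
  then show "(\<lambda>n. t / sqrt (1 + (t / real (Suc n))\<^sup>2)) \<longlonglongrightarrow> t"
    by simp
  have "(\<lambda>n. 1 / (sqrt (1 + (t / real (Suc n))\<^sup>2)) ^ 3) \<longlonglongrightarrow> 1 / sqrt (1 + 0\<^sup>2) ^ 3"
    by (rule tendsto_divide[OF tendsto_const tendsto_power[OF S]]) simp
  then show "(\<lambda>n. 1 / (sqrt (1 + (t / real (Suc n))\<^sup>2)) ^ 3) \<longlonglongrightarrow> 1"
    by simp
qed

text \<open>The truncated gradients are pointwise shorter than \<open>G\<close>, so the energy
  density of \<open>G\<close> is a fixed majorant and \<open>energy_convergence\<close> applies with
  a constant sequence \<open>hk\<close>.\<close>

lemma energy_truncation:
  fixes u :: "'a::euclidean_space \<Rightarrow> real"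
  assumes \<Omega>: "open \<Omega>" and a: "a \<in> Zclass \<kappa> \<Omega>" and pq: "1 < p" "p < q"
    and u: "sob u G" and u0: "\<And>x. x \<notin> \<Omega> \<Longrightarrow> u x = 0" and G0: "\<And>x. x \<notin> \<Omega> \<Longrightarrow> G x = 0"
    and fin: "modular \<Omega> p q a G < \<infinity>" and e: "0 < e"
  shows "\<exists>v F B. sob v F \<and> (\<forall>x. x \<notin> \<Omega> \<longrightarrow> v x = 0 \<and> F x = 0) \<and> (\<forall>x. \<bar>v x\<bar> \<le> \<bar>u x\<bar> \<and> \<bar>v x\<bar> \<le> B) \<and>
    modular \<Omega> p q a F < \<infinity> \<and> (\<integral>x. norm (v x - u x) \<partial>lborel) < e \<and> modular \<Omega> p q a (\<lambda>x. F x - G x) < ennreal e"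
proof -
  note iu = sob_integrable[OF u]
  have \<Omega>': "\<Omega> \<in> sets lebesgue"
    using \<Omega> by (simp add: lmeasurable_open)
  note a0 = ZclassD(2)[OF a]
  define T where "T n t = t / sqrt (1 + (t / real (Suc n))\<^sup>2)" for n t
  define T' where "T' n t = 1 / (sqrt (1 + (t / real (Suc n))\<^sup>2)) ^ 3" for n t
  have m: "0 < real (Suc n)" for n by simp
  note TT = truncation_function[OF m, folded T_def T'_def]
  have absT': "\<bar>T' n t\<bar> \<le> 1" for n t
    using TT(4)[of n t] TT(5)[of n t] by simp
  define v where "v n x = T n (u x)" for n x
  define F where "F n x = T' n (u x) *\<^sub>R G x" for n x
  have v: "sob (v n) (F n)" for n
    unfolding v_def F_def using TT(1,2,3) absT' by (intro sob_chain[OF u]) auto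
  note iv = sob_integrable[OF v]
  have le: "\<bar>v n x\<bar> \<le> \<bar>u x\<bar>" "norm (F n x) \<le> norm (G x)" for n x
    using TT(6)[of n "u x"] mult_right_mono[OF absT'[of n "u x"] norm_ge_zero[of "G x"]]
    by (simp_all add: v_def F_def)
  have vlim: "(\<lambda>n. \<integral>x. norm (v n x - u x) \<partial>lborel) \<longlonglongrightarrow> (\<integral>x. 0 \<partial>(lborel :: 'a measure))"
  proof (rule integral_dominated_convergence)
    show "integrable lborel (\<lambda>x. 2 * \<bar>u x\<bar>)"
      using iu(1) by simp
    show "(\<lambda>x. norm (v n x - u x)) \<in> borel_measurable lborel" for n
      using iv(3)[of n] iu(3) by simp
    show "AE x in lborel. (\<lambda>n. norm (v n x - u x)) \<longlonglongrightarrow> 0"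
    proof (rule AE_I2)
      fix x
      have "(\<lambda>n. v n x) \<longlonglongrightarrow> u x"
        unfolding v_def T_def by (rule truncation_tendsto)
      from tendsto_norm_zero[OF LIM_zero[OF this]]
      show "(\<lambda>n. norm (v n x - u x)) \<longlonglongrightarrow> 0" .
    qed
    show "AE x in lborel. norm (norm (v n x - u x)) \<le> 2 * \<bar>u x\<bar>" for n
    proof (rule AE_I2)
      fix x
      show "norm (norm (v n x - u x)) \<le> 2 * \<bar>u x\<bar>"
        using le(1)[of n x] abs_triangle_ineq4[of "v n x" "u x"] by simp
    qed
  qed simp
  have Mi: "integrable (lebesgue_on \<Omega>) (\<lambda>x. double_phase p q a x (norm (G x)))"
    by (rule double_phase_integrable[OF a measurable_lebesgue_on[OF iu(4)] fin])
  show ?thesis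
  proof (rule lebesgue_on_borel_version[OF \<Omega> Mi])
    fix h :: "'a \<Rightarrow> real" assume h: "h \<in> borel_measurable borel" "\<And>x. x \<notin> \<Omega> \<Longrightarrow> h x = 0"
      "AE x in lebesgue_on \<Omega>. h x = double_phase p q a x (norm (G x))" "integrable lborel h"
    have hae: "AE x in lborel. h x = indicator \<Omega> x * double_phase p q a x (norm (G x))"
      using h(3)[unfolded AE_lebesgue_on_iff[OF \<Omega>']]
    proof eventually_elim
      fix x assume "x \<in> \<Omega> \<longrightarrow> h x = double_phase p q a x (norm (G x))"
      then show "h x = indicator \<Omega> x * double_phase p q a x (norm (G x))"
        using h(2)[of x] by (cases "x \<in> \<Omega>") simp_all
    qed
    have "(\<lambda>n. modular \<Omega> p q a (\<lambda>x. F n x - G x)) \<longlonglongrightarrow> 0"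
    proof (rule energy_convergence[OF \<Omega> a _ _ iu(2) iv(2) h(4) hae, where hk = "\<lambda>n. h" and K = 1])
      show "AE x in lborel. (\<lambda>n. F n x - G x) \<longlonglongrightarrow> 0"
      proof (rule AE_I2)
        fix x
        have "(\<lambda>n. T' n (u x)) \<longlonglongrightarrow> 1"
          unfolding T'_def by (rule truncation_tendsto)
        then have "(\<lambda>n. F n x - G x) \<longlonglongrightarrow> 1 *\<^sub>R G x - G x"
          unfolding F_def by (intro tendsto_diff tendsto_scaleR tendsto_const)
        then show "(\<lambda>n. F n x - G x) \<longlonglongrightarrow> 0" by simp
      qed
      show "AE x in lborel. x \<in> \<Omega> \<longrightarrow> double_phase p q a x (norm (F n x)) \<le> 1 * h x" for n
        using hae
      proof eventually_elim
        fix x assume hx: "h x = indicator \<Omega> x * double_phase p q a x (norm (G x))"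
        show "x \<in> \<Omega> \<longrightarrow> double_phase p q a x (norm (F n x)) \<le> 1 * h x"
        proof
          assume x: "x \<in> \<Omega>"
          have "double_phase p q a x (norm (F n x)) \<le> double_phase p q a x (norm (G x))"
            using pq le(2) by (intro double_phase_mono a0[OF x]) auto
          then show "double_phase p q a x (norm (F n x)) \<le> 1 * h x"
            using x by (simp add: hx)
        qed
      qed
    qed (use pq h(4) in auto)
    then have E1: "\<forall>\<^sub>F n in sequentially. modular \<Omega> p q a (\<lambda>x. F n x - G x) < ennreal e"
      by (rule order_tendstoD(2)) (use e in simp)
    have E2: "\<forall>\<^sub>F n in sequentially. (\<integral>x. norm (v n x - u x) \<partial>lborel) < e"
      by (rule order_tendstoD(2)[OF vlim]) (use e in simp)
    from eventually_happens'[OF sequentially_bot eventually_conj[OF E1 E2]]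
    obtain n where n: "modular \<Omega> p q a (\<lambda>x. F n x - G x) < ennreal e" "(\<integral>x. norm (v n x - u x) \<partial>lborel) < e"
      by (elim exE conjE)
    have "modular \<Omega> p q a (F n) \<le> modular \<Omega> p q a G"
      using pq le(2) by (intro modular_mono[OF a]) auto
    then have fF: "modular \<Omega> p q a (F n) < \<infinity>"
      using fin by (rule le_less_trans)
    have out: "v n x = 0 \<and> F n x = 0" if "x \<notin> \<Omega>" for x
      using that TT(3)[of n] by (simp add: v_def F_def u0 G0)
    have bd: "\<bar>v n x\<bar> \<le> real (Suc n)" for x
      unfolding v_def by (rule TT(7))
    show ?thesis
      using v[of n] out le(1) bd fF n by (intro exI[of _ "v n"] exI[of _ "F n"] exI[of _ "real (Suc n)"]) simp
  qed
qed

section \<open>From modular estimates to convergence in the energy space\<close>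

lemma Cc_infinity_W11_0:
  fixes \<psi> :: "'a::euclidean_space \<Rightarrow> real"
  assumes \<Omega>: "open \<Omega>" and \<psi>: "\<psi> \<in> Cc_infinity \<Omega>"
  shows "\<psi> \<in> W11_0 \<Omega>"
proof -
  have \<Omega>': "\<Omega> \<in> sets lebesgue"
    using \<Omega> by (simp add: lmeasurable_open)
  note C = Cc_infinity_C1c[OF \<psi>] and wg = Cc_infinity_has_weak_grad[OF \<Omega> \<psi>]
  have "integrable (lebesgue_on \<Omega>) \<psi>" "integrable (lebesgue_on \<Omega>) (grad \<psi>)"
    using lebesgue_on_lborel(2)[OF \<Omega>' C1c_measurable(1)[OF C] Cc_infinity_zero_outside(1)[OF \<psi>]]
      lebesgue_on_lborel(2)[OF \<Omega>' C1c_measurable(2)[OF C] Cc_infinity_zero_outside(2)[OF \<psi>]]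
      C1c_integrable[OF C] by simp_all
  then have "\<psi> \<in> W11 \<Omega>"
    unfolding W11_def using wg by (intro CollectI conjI exI[of _ "grad \<psi>"])
  moreover have "W11_norm \<Omega> (\<lambda>x. \<psi> x - \<psi> x) = 0"
  proof -
    have "AE x in lebesgue_on \<Omega>. weak_grad \<Omega> (\<lambda>x. \<psi> x - \<psi> x) x = grad \<psi> x - grad \<psi> x"
      by (rule weak_grad_AE[OF \<Omega> has_weak_grad_diff[OF \<Omega> wg wg]])
    then have "L1_norm \<Omega> (weak_grad \<Omega> (\<lambda>x. \<psi> x - \<psi> x)) = ennreal (\<integral>x. norm (0::'a) \<partial>(lborel :: 'a measure))"
      by (intro L1_norm_lborel[OF \<Omega>']) simp_all
    then show ?thesis
      by (simp add: W11_norm_def L1_norm_def)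
  qed
  ultimately show ?thesis
    unfolding W11_0_def using \<psi> by (intro CollectI conjI exI[of _ "\<lambda>k. \<psi>"]) simp_all
qed

lemma Cc_infinity_energy_space:
  fixes \<psi> :: "'a::euclidean_space \<Rightarrow> real"
  assumes \<Omega>: "open \<Omega>" "bounded \<Omega>" and \<psi>: "\<psi> \<in> Cc_infinity \<Omega>" and a: "a \<in> Zclass \<kappa> \<Omega>"
    and pq: "0 \<le> p" "0 \<le> q" and \<kappa>: "0 < \<kappa>"
  shows "\<psi> \<in> energy_space \<Omega> p q a"
proof -
  obtain B where B: "\<And>x. norm (grad \<psi> x) \<le> B"
    using C1c_bounded[OF Cc_infinity_C1c[OF \<psi>]] by metis
  have "modular \<Omega> p q a (weak_grad \<Omega> \<psi>) = modular \<Omega> p q a (grad \<psi>)"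
    by (rule modular_cong_AE[OF weak_grad_AE[OF \<Omega>(1) Cc_infinity_has_weak_grad[OF \<Omega>(1) \<psi>]]])
  also have "\<dots> < \<infinity>"
    by (rule modular_bounded_finite[OF a \<kappa> \<Omega>(2,1) pq B])
  finally show ?thesis
    unfolding energy_space_def modular_def using Cc_infinity_W11_0[OF \<Omega>(1) \<psi>] by simp
qed

lemma energy_space_gradient:
  fixes \<phi> :: "'a::euclidean_space \<Rightarrow> real"
  assumes \<Omega>: "open \<Omega>" and \<phi>: "\<phi> \<in> energy_space \<Omega> p q a"
  obtains g G where "has_weak_grad \<Omega> \<phi> g" "integrable lborel G" "\<And>x. x \<notin> \<Omega> \<Longrightarrow> G x = 0"
    "AE x in lebesgue_on \<Omega>. G x = g x" "modular \<Omega> p q a G < \<infinity>"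
    "\<phi> \<in> W11_0 \<Omega>" "integrable (lebesgue_on \<Omega>) \<phi>"
proof -
  have W: "\<phi> \<in> W11_0 \<Omega>" and fin: "modular \<Omega> p q a (weak_grad \<Omega> \<phi>) < \<infinity>"
    using \<phi> by (simp_all add: energy_space_def modular_def)
  then obtain g where i: "integrable (lebesgue_on \<Omega>) \<phi>" and g: "has_weak_grad \<Omega> \<phi> g" "integrable (lebesgue_on \<Omega>) g"
    unfolding W11_0_def W11_def by (elim CollectE conjE exE) (rule that)
  show ?thesis
  proof (rule lebesgue_on_borel_version[OF \<Omega> g(2)])
    fix G :: "'a \<Rightarrow> 'a" assume G: "\<And>x. x \<notin> \<Omega> \<Longrightarrow> G x = 0" "AE x in lebesgue_on \<Omega>. G x = g x" "integrable lborel G"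
    have "AE x in lebesgue_on \<Omega>. weak_grad \<Omega> \<phi> x = G x"
      using weak_grad_AE[OF \<Omega> g(1)] G(2) by eventually_elim simp
    from modular_cong_AE[OF this] fin have "modular \<Omega> p q a G < \<infinity>" by simp
    with g(1) G W i show ?thesis
      by (intro that[of g G]) simp_all
  qed
qed

text \<open>The last conjunct of \<open>approx\<close> is kept quantified over \<open>\<Lambda>\<close>, so that the same sequence serves
  both the bounded and the unbounded case.\<close>

lemma energy_convergence_of_approximation:
  fixes \<phi> u :: "'a::euclidean_space \<Rightarrow> real"
  assumes \<Omega>: "open \<Omega>" "bounded \<Omega>" and a: "a \<in> Zclass \<kappa> \<Omega>" and pq: "1 < p" "p < q" and \<kappa>: "0 < \<kappa>"
    and \<phi>: "\<phi> \<in> energy_space \<Omega> p q a" and g: "has_weak_grad \<Omega> \<phi> g"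
    and G: "integrable lborel G" "\<And>x. x \<notin> \<Omega> \<Longrightarrow> G x = 0" "AE x in lebesgue_on \<Omega>. G x = g x"
    and u: "integrable lborel u" "\<And>x. x \<notin> \<Omega> \<Longrightarrow> u x = 0" "AE x in lebesgue_on \<Omega>. u x = \<phi> x"
    and N: "0 \<le> N" "N \<le> c"
    and approx: "\<And>e. 0 < e \<Longrightarrow> \<exists>w. w \<in> Cc_infinity \<Omega> \<and> (\<integral>x. norm (w x - u x) \<partial>lborel) < e \<and>
      modular \<Omega> p q a (\<lambda>x. grad w x - G x) < ennreal e \<and>
      (\<forall>\<Lambda>. (AE x in lborel. \<bar>u x\<bar> \<le> \<Lambda>) \<longrightarrow> (\<forall>x. \<bar>w x\<bar> \<le> N * \<Lambda>))"
  shows "\<exists>\<Phi>. (\<forall>k. \<Phi> k \<in> Cc_infinity \<Omega>) \<and> converges_in_energy_space \<Omega> p q a \<Phi> \<phi> \<and>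
    (\<phi> \<in> Linf \<Omega> \<longrightarrow> (\<forall>k. Linf_norm \<Omega> (\<Phi> k) \<le> ennreal c * Linf_norm \<Omega> \<phi>))"
proof -
  have \<Omega>': "\<Omega> \<in> sets lebesgue"
    using \<Omega> by (simp add: lmeasurable_open)
  \<comment> \<open>The tolerance is \<open>l k powr q\<close> because
    \<open>luxemburg_norm_le\<close> turns a modular of that size into a norm of size
    \<open>l k\<close>; since \<open>q > 1\<close> and \<open>l k \<le> 1\<close>, it also bounds
    the L^1 error by \<open>l k\<close>.\<close>
  define l where "l k = inverse (real (Suc k))" for k
  have l: "0 < l k" "l k \<le> 1" for k
    by (auto simp: l_def divide_simps)
  have lq: "0 < l k powr q" "l k powr q \<le> l k" for k
    using l[of k] pq powr_mono'[of 1 q "l k"] by simp_all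
  have "\<forall>k. \<exists>w. w \<in> Cc_infinity \<Omega> \<and> (\<integral>x. norm (w x - u x) \<partial>lborel) < l k powr q \<and>
      modular \<Omega> p q a (\<lambda>x. grad w x - G x) < ennreal (l k powr q) \<and>
      (\<forall>\<Lambda>. (AE x in lborel. \<bar>u x\<bar> \<le> \<Lambda>) \<longrightarrow> (\<forall>x. \<bar>w x\<bar> \<le> N * \<Lambda>))"
    using approx lq(1) by simp
  from choice[OF this] obtain \<Phi> where
    \<Phi>: "\<forall>k. \<Phi> k \<in> Cc_infinity \<Omega> \<and> (\<integral>x. norm (\<Phi> k x - u x) \<partial>lborel) < l k powr q \<and>
      modular \<Omega> p q a (\<lambda>x. grad (\<Phi> k) x - G x) < ennreal (l k powr q) \<and>
      (\<forall>\<Lambda>. (AE x in lborel. \<bar>u x\<bar> \<le> \<Lambda>) \<longrightarrow> (\<forall>x. \<bar>\<Phi> k x\<bar> \<le> N * \<Lambda>))"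
    by (elim exE)
  have cc: "\<Phi> k \<in> Cc_infinity \<Omega>" for k
    using \<Phi> by simp
  have norm_le: "energy_norm \<Omega> p q a (\<lambda>x. \<Phi> k x - \<phi> x) \<le> ennreal (l k + l k)" for k
  proof -
    note C = Cc_infinity_C1c[OF cc[of k]]
    have d: "integrable lborel (\<lambda>x. \<Phi> k x - u x)"
      by (intro Bochner_Integration.integrable_diff C1c_integrable(1)[OF C] u(1))
    have "AE x in lebesgue_on \<Omega>. \<Phi> k x - \<phi> x = \<Phi> k x - u x"
      using u(3) by eventually_elim simp
    then have "L1_norm \<Omega> (\<lambda>x. \<Phi> k x - \<phi> x) = ennreal (\<integral>x. norm (\<Phi> k x - u x) \<partial>lborel)"
      by (intro L1_norm_lborel[OF \<Omega>' d]) (simp_all add: Cc_infinity_zero_outside(1)[OF cc] u(2))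
    also have "\<dots> \<le> ennreal (l k)"
      using \<Phi> lq(2)[of k] by (intro ennreal_leI) (meson less_imp_le order_trans)
    finally have 1: "L1_norm \<Omega> (\<lambda>x. \<Phi> k x - \<phi> x) \<le> ennreal (l k)" .
    have "AE x in lebesgue_on \<Omega>. weak_grad \<Omega> (\<lambda>x. \<Phi> k x - \<phi> x) x = grad (\<Phi> k) x - g x"
      by (rule weak_grad_AE[OF \<Omega>(1) has_weak_grad_diff[OF \<Omega>(1) Cc_infinity_has_weak_grad[OF \<Omega>(1) cc] g]])
    then have "AE x in lebesgue_on \<Omega>. weak_grad \<Omega> (\<lambda>x. \<Phi> k x - \<phi> x) x = grad (\<Phi> k) x - G x"
      using G(3) by eventually_elim simp
    from luxemburg_norm_cong_AE[OF this]
    have "luxemburg_norm \<Omega> p q a (weak_grad \<Omega> (\<lambda>x. \<Phi> k x - \<phi> x)) = luxemburg_norm \<Omega> p q a (\<lambda>x. grad (\<Phi> k) x - G x)" .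
    also have "\<dots> \<le> ennreal (l k)"
    proof (rule luxemburg_norm_le[OF a _ _ l])
      show "(\<lambda>x. grad (\<Phi> k) x - G x) \<in> borel_measurable (lebesgue_on \<Omega>)"
        using borel_measurable_integrable[OF G(1)]
        by (intro measurable_lebesgue_on borel_measurable_diff C1c_measurable(2)[OF C]) simp
      show "modular \<Omega> p q a (\<lambda>x. grad (\<Phi> k) x - G x) \<le> ennreal (l k powr q)"
        using \<Phi> by (simp add: less_imp_le)
    qed (use pq in auto)
    finally have "luxemburg_norm \<Omega> p q a (weak_grad \<Omega> (\<lambda>x. \<Phi> k x - \<phi> x)) \<le> ennreal (l k)" .
    with 1 have "energy_norm \<Omega> p q a (\<lambda>x. \<Phi> k x - \<phi> x) \<le> ennreal (l k) + ennreal (l k)"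
      unfolding energy_norm_def by (rule add_mono)
    then show ?thesis
      using l(1)[of k] by (simp only: ennreal_plus less_imp_le)
  qed
  have "(\<lambda>k. ennreal (l k + l k)) \<longlonglongrightarrow> ennreal (0 + 0)"
    unfolding l_def by (intro tendsto_ennrealI tendsto_add LIMSEQ_inverse_real_of_nat)
  then have "(\<lambda>k. ennreal (l k + l k)) \<longlonglongrightarrow> 0" by simp
  from tendsto_sandwich[OF _ _ tendsto_const this]
  have "(\<lambda>k. energy_norm \<Omega> p q a (\<lambda>x. \<Phi> k x - \<phi> x)) \<longlonglongrightarrow> 0"
    using norm_le by (simp add: always_eventually)
  moreover have "\<Phi> k \<in> energy_space \<Omega> p q a" for k
    using pq by (intro Cc_infinity_energy_space[OF \<Omega> cc a _ _ \<kappa>]) auto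
  ultimately have conv: "converges_in_energy_space \<Omega> p q a \<Phi> \<phi>"
    unfolding converges_in_energy_space_def using \<phi> by simp
  have "Linf_norm \<Omega> (\<Phi> k) \<le> ennreal c * Linf_norm \<Omega> \<phi>" if \<phi>L: "\<phi> \<in> Linf \<Omega>" for k
  proof -
    define \<Lambda> where "\<Lambda> = enn2real (Linf_norm \<Omega> \<phi>)"
    have \<Lambda>: "Linf_norm \<Omega> \<phi> = ennreal \<Lambda>" "0 \<le> \<Lambda>"
      using \<phi>L by (simp_all add: \<Lambda>_def Linf_def)
    have "AE x in lebesgue_on \<Omega>. ennreal \<bar>\<phi> x\<bar> \<le> Linf_norm \<Omega> \<phi>"
      unfolding Linf_norm_def by (rule esssup_AE)
    then have "AE x in lebesgue_on \<Omega>. \<bar>u x\<bar> \<le> \<Lambda>"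
      using u(3) by eventually_elim (simp add: \<Lambda>)
    then have "AE x in lborel. \<bar>u x\<bar> \<le> \<Lambda>"
      unfolding AE_lebesgue_on_iff[OF \<Omega>']
    proof eventually_elim
      fix x assume "x \<in> \<Omega> \<longrightarrow> \<bar>u x\<bar> \<le> \<Lambda>"
      then show "\<bar>u x\<bar> \<le> \<Lambda>"
        using u(2)[of x] \<Lambda>(2) by (cases "x \<in> \<Omega>") simp_all
    qed
    then have "\<bar>\<Phi> k x\<bar> \<le> N * \<Lambda>" for x
      using \<Phi> by simp
    then have "\<bar>\<Phi> k x\<bar> \<le> c * \<Lambda>" for x
      using mult_right_mono[OF N(2) \<Lambda>(2)] order_trans by blast
    then have "AE x in lebesgue_on \<Omega>. ennreal \<bar>\<Phi> k x\<bar> \<le> ennreal (c * \<Lambda>)"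
      by (intro AE_I2 ennreal_leI)
    moreover have "(\<lambda>x. ennreal \<bar>\<Phi> k x\<bar>) \<in> borel_measurable (lebesgue_on \<Omega>)"
      by (intro measurable_compose[OF _ measurable_ennreal] borel_measurable_abs measurable_lebesgue_on
          C1c_measurable(1)[OF Cc_infinity_C1c[OF cc]])
    ultimately have "Linf_norm \<Omega> (\<Phi> k) \<le> ennreal (c * \<Lambda>)"
      unfolding Linf_norm_def by (intro esssup_I)
    then show ?thesis
      using N \<Lambda>(2) by (simp add: \<Lambda>(1) ennreal_mult)
  qed
  with cc conv show ?thesis
    by (intro exI[of _ \<Phi>]) simp
qed

text \<open>After truncation the function is bounded by some \<open>B\<close> and satisfies the
  oscillation estimate with exponent 0 and constant \<open>2 * B\<close>; the balance condition then
  reads \<open>q - p \<le> \<kappa>\<close>. As truncation does not increase absolute values, bounds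
  for \<open>u\<close> pass to the approximant.\<close>

lemma unbounded_approximation:
  fixes u :: "'a::euclidean_space \<Rightarrow> real"
  assumes \<Omega>: "open \<Omega>" "bounded \<Omega>" and cov: "shift_cover \<Omega> I R c s \<delta>0"
    and a: "a \<in> Zclass \<kappa> \<Omega>" and pq: "1 < p" "p < q" and \<kappa>: "0 < \<kappa>" "q - p \<le> \<kappa>"
    and u: "sob u G" and u0: "\<And>x. x \<notin> \<Omega> \<Longrightarrow> u x = 0" and G0: "\<And>x. x \<notin> \<Omega> \<Longrightarrow> G x = 0"
    and fin: "modular \<Omega> p q a G < \<infinity>" and e: "0 < e"
  shows "\<exists>w. w \<in> Cc_infinity \<Omega> \<and> (\<integral>x. norm (w x - u x) \<partial>lborel) < e \<and>
    modular \<Omega> p q a (\<lambda>x. grad w x - G x) < ennreal e \<and>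
    (\<forall>\<Lambda>. (AE x in lborel. \<bar>u x\<bar> \<le> \<Lambda>) \<longrightarrow> (\<forall>x. \<bar>w x\<bar> \<le> real (card I) * \<Lambda>))"
proof -
  \<comment> \<open>Both errors are \<open>d\<close>, and adding them inside the modular costs the
    factor \<open>2 powr q\<close>.\<close>
  define d where "d = e / (2 * 2 powr q)"
  have "1 \<le> (2::real) powr q"
    using powr_mono[of 0 q 2] pq by simp
  then have d: "0 < d" "d + d \<le> e" "2 powr q * (d + d) = e"
    using e by (auto simp: d_def field_simps)
  have "\<exists>v F B. sob v F \<and> (\<forall>x. x \<notin> \<Omega> \<longrightarrow> v x = 0 \<and> F x = 0) \<and> (\<forall>x. \<bar>v x\<bar> \<le> \<bar>u x\<bar> \<and> \<bar>v x\<bar> \<le> B) \<and>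
    modular \<Omega> p q a F < \<infinity> \<and> (\<integral>x. norm (v x - u x) \<partial>lborel) < d \<and> modular \<Omega> p q a (\<lambda>x. F x - G x) < ennreal d"
    by (rule energy_truncation[OF \<Omega>(1) a pq u u0 G0 fin d(1)])
  then obtain v F B where v: "sob v F" and out: "\<forall>x. x \<notin> \<Omega> \<longrightarrow> v x = 0 \<and> F x = 0"
    and vB: "\<forall>x. \<bar>v x\<bar> \<le> \<bar>u x\<bar> \<and> \<bar>v x\<bar> \<le> B" and finF: "modular \<Omega> p q a F < \<infinity>"
    and vu: "(\<integral>x. norm (v x - u x) \<partial>lborel) < d" "modular \<Omega> p q a (\<lambda>x. F x - G x) < ennreal d"
    by (elim exE conjE)
  have B: "0 \<le> B" using vB[rule_format, of undefined] by linarith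
  have "\<exists>w. w \<in> Cc_infinity \<Omega> \<and> (\<integral>x. norm (w x - v x) \<partial>lborel) < d \<and>
    modular \<Omega> p q a (\<lambda>x. grad w x - F x) < ennreal d \<and>
    (\<forall>\<Lambda>. (AE x in lborel. \<bar>v x\<bar> \<le> \<Lambda>) \<longrightarrow> (\<forall>x. \<bar>w x\<bar> \<le> real (card I) * \<Lambda>))"
  proof (rule bounded_approximation[OF \<Omega> cov a pq \<kappa>(1) v _ _ finF, where \<gamma> = 0 and B = B and H = "2 * B"])
    fix x y :: 'a
    show "\<bar>v x - v y\<bar> \<le> 2 * B * dist x y powr 0"
    \<comment> \<open>The case distinction is due to \<open>0 powr 0 = 0\<close>: the right-hand
      side vanishes on the diagonal.\<close>
    proof (cases "x = y")
      case False
      have "\<bar>v x\<bar> \<le> B" "\<bar>v y\<bar> \<le> B"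
        using vB by simp_all
      then have "\<bar>v x - v y\<bar> \<le> 2 * B"
        by linarith
      with False show ?thesis by simp
    qed simp
  qed (use out vB B \<kappa> d in auto)
  then obtain w where w: "w \<in> Cc_infinity \<Omega>" "(\<integral>x. norm (w x - v x) \<partial>lborel) < d"
    "modular \<Omega> p q a (\<lambda>x. grad w x - F x) < ennreal d"
    "\<forall>\<Lambda>. (AE x in lborel. \<bar>v x\<bar> \<le> \<Lambda>) \<longrightarrow> (\<forall>x. \<bar>w x\<bar> \<le> real (card I) * \<Lambda>)"
    by (elim exE conjE)
  note C = Cc_infinity_C1c[OF w(1)]
  note i = C1c_integrable(1)[OF C] sob_integrable(1)[OF v] sob_integrable(1)[OF u]
  have "(\<integral>x. norm (w x - u x) \<partial>lborel) = (\<integral>x. norm ((w x - v x) + (v x - u x)) \<partial>lborel)"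
    by simp
  also have "\<dots> \<le> (\<integral>x. norm (w x - v x) \<partial>lborel) + (\<integral>x. norm (v x - u x) \<partial>lborel)"
    by (intro integral_norm_add_le Bochner_Integration.integrable_diff i)
  also have "\<dots> < e"
    using w(2) vu(1) d(2) by linarith
  finally have L: "(\<integral>x. norm (w x - u x) \<partial>lborel) < e" .
  have "modular \<Omega> p q a (\<lambda>x. grad w x - G x) = modular \<Omega> p q a (\<lambda>x. (grad w x - F x) + (F x - G x))"
    by simp
  also have "\<dots> \<le> ennreal (2 powr q) * (modular \<Omega> p q a (\<lambda>x. grad w x - F x) + modular \<Omega> p q a (\<lambda>x. F x - G x))"
    using pq by (intro modular_add_le[OF a] measurable_lebesgue_on borel_measurable_diff
        C1c_measurable(2)[OF C] sob_integrable(4)[OF v] sob_integrable(4)[OF u]) auto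
  also have "\<dots> < ennreal (2 powr q) * (ennreal d + ennreal d)"
    using w(3) vu(2) by (intro ennreal_mult_strict_left_mono add_strict_mono) auto
  also have "\<dots> = ennreal e"
    using d by (simp add: ennreal_plus[symmetric] ennreal_mult[symmetric] del: ennreal_plus)
  finally have M: "modular \<Omega> p q a (\<lambda>x. grad w x - G x) < ennreal e" .
  have "\<forall>x. \<bar>w x\<bar> \<le> real (card I) * \<Lambda>" if \<Lambda>: "AE x in lborel. \<bar>u x\<bar> \<le> \<Lambda>" for \<Lambda>
  proof (rule w(4)[rule_format, THEN allI])
    show "AE x in lborel. \<bar>v x\<bar> \<le> \<Lambda>"
      using \<Lambda> by eventually_elim (use vB order_trans in metis)
  qed
  with w(1) L M show ?thesis
    by (intro exI[of _ w]) simp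
qed

lemma energy_approximation:
  fixes \<Omega> :: "'a::euclidean_space set"
  assumes \<Omega>: "open \<Omega>" "bounded \<Omega>" and cov: "shift_cover \<Omega> I R c s \<delta>0"
    and a: "a \<in> Zclass \<kappa> \<Omega>" and pq: "1 < p" "p < q" and \<kappa>: "0 < \<kappa>" "q - p \<le> \<kappa>"
    and \<phi>: "\<phi> \<in> energy_space \<Omega> p q a"
  shows "\<exists>\<Phi>. (\<forall>k. \<Phi> k \<in> Cc_infinity \<Omega>) \<and> converges_in_energy_space \<Omega> p q a \<Phi> \<phi> \<and>
    (\<phi> \<in> Linf \<Omega> \<longrightarrow> (\<forall>k. Linf_norm \<Omega> (\<Phi> k) \<le> ennreal (real (card I) + 1) * Linf_norm \<Omega> \<phi>))"
proof (rule energy_space_gradient[OF \<Omega>(1) \<phi>])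
  fix g G :: "'a \<Rightarrow> 'a"
  assume g: "has_weak_grad \<Omega> \<phi> g" and G: "integrable lborel G" "\<And>x. x \<notin> \<Omega> \<Longrightarrow> G x = 0"
    "AE x in lebesgue_on \<Omega>. G x = g x" and fin: "modular \<Omega> p q a G < \<infinity>"
    and W: "\<phi> \<in> W11_0 \<Omega>" and i: "integrable (lebesgue_on \<Omega>) \<phi>"
  show ?thesis
  proof (rule lebesgue_on_borel_version[OF \<Omega>(1) i])
    fix u assume u: "\<And>x. x \<notin> \<Omega> \<Longrightarrow> u x = 0" "AE x in lebesgue_on \<Omega>. u x = \<phi> x" "integrable lborel u"
    have sob: "sob u G"
      by (rule W11_0_imp_sob[OF \<Omega>(1) W g G u(3,1,2)])
    show ?thesis
    proof (rule energy_convergence_of_approximation[OF \<Omega> a pq \<kappa>(1) \<phi> g G u(3,1,2)])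
      show "\<exists>w. w \<in> Cc_infinity \<Omega> \<and> (\<integral>x. norm (w x - u x) \<partial>lborel) < e \<and>
        modular \<Omega> p q a (\<lambda>x. grad w x - G x) < ennreal e \<and>
        (\<forall>\<Lambda>. (AE x in lborel. \<bar>u x\<bar> \<le> \<Lambda>) \<longrightarrow> (\<forall>x. \<bar>w x\<bar> \<le> real (card I) * \<Lambda>))" if "0 < e" for e
        by (rule unbounded_approximation[OF \<Omega> cov a pq \<kappa> sob u(1) G(2) fin that])
    qed simp_all
  qed
qed

section \<open>The Hoelder case\<close>

lemma holder_spaceD:
  assumes "f \<in> holder_space \<Omega> \<gamma>"
  obtains H where "0 \<le> H" "\<And>x y. x \<in> \<Omega> \<Longrightarrow> y \<in> \<Omega> \<Longrightarrow> \<bar>f x - f y\<bar> \<le> H * dist x y powr \<gamma>"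
proof -
  obtain M where M: "\<forall>t\<in>{\<bar>f x - f y\<bar> / norm (x - y) powr \<gamma> | x y. x \<in> \<Omega> \<and> y \<in> \<Omega> \<and> x \<noteq> y}. t \<le> M"
    using assms unfolding holder_space_def bdd_above_def by auto
  show ?thesis
  proof (rule that[of "max 0 M"])
    fix x y assume xy: "x \<in> \<Omega>" "y \<in> \<Omega>"
    show "\<bar>f x - f y\<bar> \<le> max 0 M * dist x y powr \<gamma>"
    proof (cases "x = y")
      case False
      then have "\<bar>f x - f y\<bar> / norm (x - y) powr \<gamma> \<le> M"
        using M xy by blast
      then have "\<bar>f x - f y\<bar> / norm (x - y) powr \<gamma> \<le> max 0 M"
        by simp
      moreover have "0 < norm (x - y) powr \<gamma>"
        using False by simp
      ultimately show ?thesis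
        by (simp only: dist_norm pos_divide_le_eq)
    qed simp
  qed simp
qed

lemma holder_continuous_on:
  fixes f :: "'a::metric_space \<Rightarrow> real"
  assumes \<gamma>: "0 < \<gamma>" and H: "\<And>x y. x \<in> \<Omega> \<Longrightarrow> y \<in> \<Omega> \<Longrightarrow> \<bar>f x - f y\<bar> \<le> H * dist x y powr \<gamma>"
  shows "continuous_on \<Omega> f"
  unfolding continuous_on_def
proof
  fix x assume x: "x \<in> \<Omega>"
  have "((\<lambda>y. dist y x) \<longlongrightarrow> dist x x) (at x within \<Omega>)"
    by (intro tendsto_dist tendsto_ident_at tendsto_const)
  then have "((\<lambda>y. dist y x powr \<gamma>) \<longlongrightarrow> 0) (at x within \<Omega>)"
    using \<gamma> by (intro tendsto_zero_powrI[OF _ tendsto_const]) auto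
  from tendsto_mult[OF tendsto_const this, of H]
  have lim: "((\<lambda>y. H * dist y x powr \<gamma>) \<longlongrightarrow> 0) (at x within \<Omega>)"
    by simp
  have "((\<lambda>y. f y - f x) \<longlongrightarrow> 0) (at x within \<Omega>)"
  proof (rule Lim_null_comparison[OF _ lim])
    show "\<forall>\<^sub>F y in at x within \<Omega>. norm (f y - f x) \<le> H * dist y x powr \<gamma>"
      unfolding eventually_at_filter by (rule always_eventually) (simp add: H x)
  qed
  then show "(f \<longlongrightarrow> f x) (at x within \<Omega>)"
    by (rule LIM_zero_cancel)
qed

text \<open>The extension is taken as the literal zero extension and not as a representative up to
  null sets, because the Hoelder estimate has to hold at every point. It is a Borel function since
  \<phi> is continuous on the open set \<Omega>.\<close>

lemma holder_approximation:
  fixes \<Omega> :: "'a::euclidean_space set"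
  assumes lip: "lipschitz_domain \<Omega>" and bd: "bounded \<Omega>" and cov: "shift_cover \<Omega> I R c s \<delta>0"
    and a: "a \<in> Zclass \<kappa> \<Omega>" and pq: "1 < p" "p < q" and \<kappa>: "0 < \<kappa>"
    and \<gamma>: "0 < \<gamma>" "\<gamma> \<le> 1" "(q - p) * (1 - \<gamma>) \<le> \<kappa>"
    and \<phi>: "\<phi> \<in> energy_space \<Omega> p q a" "\<phi> \<in> holder_space \<Omega> \<gamma>"
  shows "\<exists>\<Phi>. (\<forall>k. \<Phi> k \<in> Cc_infinity \<Omega>) \<and> converges_in_energy_space \<Omega> p q a \<Phi> \<phi> \<and>
    (\<phi> \<in> Linf \<Omega> \<longrightarrow> (\<forall>k. Linf_norm \<Omega> (\<Phi> k) \<le> ennreal (real (card I) + 1) * Linf_norm \<Omega> \<phi>))"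
proof (rule energy_space_gradient[OF _ \<phi>(1)], goal_cases)
  case 1
  show ?case using lip by (simp add: lipschitz_domain_def)
next
  case (2 g G)
  then have g: "has_weak_grad \<Omega> \<phi> g" and G: "integrable lborel G" "\<And>x. x \<notin> \<Omega> \<Longrightarrow> G x = 0"
    "AE x in lebesgue_on \<Omega>. G x = g x" and fin: "modular \<Omega> p q a G < \<infinity>"
    and W: "\<phi> \<in> W11_0 \<Omega>" and i: "integrable (lebesgue_on \<Omega>) \<phi>"
    by simp_all
  have op: "open \<Omega>" using lip by (simp add: lipschitz_domain_def)
  have \<Omega>': "\<Omega> \<in> sets lebesgue"
    using op by (simp add: lmeasurable_open)
  obtain H where H: "0 \<le> H" "\<And>x y. x \<in> \<Omega> \<Longrightarrow> y \<in> \<Omega> \<Longrightarrow> \<bar>\<phi> x - \<phi> y\<bar> \<le> H * dist x y powr \<gamma>"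
    using holder_spaceD[OF \<phi>(2)] by metis
  define u where "u x = indicator \<Omega> x *\<^sub>R \<phi> x" for x
  have u0: "u x = 0" if "x \<notin> \<Omega>" for x
    using that by (simp add: u_def)
  have u1: "u x = \<phi> x" if "x \<in> \<Omega>" for x
    using that by (simp add: u_def)
  have um: "u \<in> borel_measurable borel"
    unfolding u_def
    by (rule borel_measurable_continuous_on_indicator[OF _ holder_continuous_on[OF \<gamma>(1) H(2)]]) (use op in simp)
  have uae: "AE x in lebesgue_on \<Omega>. u x = \<phi> x"
    by (rule AE_I2) (simp add: u1)
  have "integrable (lebesgue_on \<Omega>) u"
    using i by (rule Bochner_Integration.integrable_cong[THEN iffD1, rotated 2]) (simp_all add: u1)
  then have ui: "integrable lborel u"
    using lebesgue_on_lborel(2)[OF \<Omega>' um u0] by simp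
  have sob: "sob u G"
    by (rule W11_0_imp_sob[OF op W g G ui u0 uae])
  have osc: "\<bar>u x - u y\<bar> \<le> H * dist x y powr \<gamma>" for x y
  proof (rule holder_zero_extension[OF lip sob u0 G(2) H(1) \<gamma>(1)])
    show "\<bar>u x - u y\<bar> \<le> H * dist x y powr \<gamma>" if "x \<in> \<Omega>" "y \<in> \<Omega>" for x y
      using H(2)[OF that] that by (simp add: u1)
  qed
  obtain b where b: "\<forall>x\<in>\<Omega>. norm x < b"
    using bd bounded_pos_less by metis
  \<comment> \<open>A point outside \<Omega> at controlled distance, where \<open>u\<close>
    vanishes; the Hoelder estimate of the extension between \<open>x\<close> and \<open>y\<close>
    bounds \<open>u\<close>.\<close>
  obtain y :: 'a where y: "norm y = \<bar>b\<bar>"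
    using vector_choose_size[of "\<bar>b\<bar>"] by auto
  have ub: "\<bar>u x\<bar> \<le> H * (2 * \<bar>b\<bar>) powr \<gamma>" for x
  proof (cases "x \<in> \<Omega>")
    case True
    have "y \<notin> \<Omega>" using b y by force
    have "norm x < b" using b True by simp
    then have "dist x y \<le> 2 * \<bar>b\<bar>"
      using norm_triangle_ineq4[of x y] y by (simp add: dist_norm)
    then have "H * dist x y powr \<gamma> \<le> H * (2 * \<bar>b\<bar>) powr \<gamma>"
      using H(1) \<gamma>(1) by (intro mult_left_mono powr_mono2) auto
    then show ?thesis
      using osc[of x y] u0[OF \<open>y \<notin> \<Omega>\<close>] by simp
  qed (use H(1) in \<open>simp add: u0\<close>)
  show ?case
  proof (rule energy_convergence_of_approximation[OF op bd a pq \<kappa> \<phi>(1) g G ui u0 uae])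
    show "\<exists>w. w \<in> Cc_infinity \<Omega> \<and> (\<integral>x. norm (w x - u x) \<partial>lborel) < e \<and>
      modular \<Omega> p q a (\<lambda>x. grad w x - G x) < ennreal e \<and>
      (\<forall>\<Lambda>. (AE x in lborel. \<bar>u x\<bar> \<le> \<Lambda>) \<longrightarrow> (\<forall>x. \<bar>w x\<bar> \<le> real (card I) * \<Lambda>))" if "0 < e" for e
      by (rule bounded_approximation[OF op bd cov a pq \<kappa> sob u0 G(2) fin ub less_imp_le[OF \<gamma>(1)] \<gamma>(2,3) H(1) osc that])
  qed simp_all
qed

theorem theorem3:
  fixes \<Omega> :: "(real ^ 'n) set"
  assumes "CARD('n) \<ge> 2"
    and "bounded \<Omega>"
    and "lipschitz_domain \<Omega>"
  shows "\<exists>c>0. \<forall>(p::real) (q::real) (\<kappa>::real) (a :: real ^ 'n \<Rightarrow> real).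
    1 < p \<and> p < q \<and> 0 < \<kappa> \<and> a \<in> Zclass \<kappa> \<Omega> \<longrightarrow>
      (\<kappa> \<ge> q - p \<longrightarrow>
        (\<forall>\<phi> \<in> energy_space \<Omega> p q a. \<exists>\<Phi> :: nat \<Rightarrow> real ^ 'n \<Rightarrow> real.
          (\<forall>k. \<Phi> k \<in> Cc_infinity \<Omega>) \<and>
          converges_in_energy_space \<Omega> p q a \<Phi> \<phi> \<and>
          (\<phi> \<in> Linf \<Omega> \<longrightarrow> (\<forall>k. Linf_norm \<Omega> (\<Phi> k) \<le> ennreal c * Linf_norm \<Omega> \<phi>)))) \<and>
      (\<forall>\<gamma>::real. 0 < \<gamma> \<and> \<gamma> \<le> 1 \<and> \<kappa> \<ge> (q - p) * (1 - \<gamma>) \<longrightarrow>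
        (\<forall>\<phi> \<in> energy_space \<Omega> p q a \<inter> holder_space \<Omega> \<gamma>. \<exists>\<Phi> :: nat \<Rightarrow> real ^ 'n \<Rightarrow> real.
          (\<forall>k. \<Phi> k \<in> Cc_infinity \<Omega>) \<and>
          converges_in_energy_space \<Omega> p q a \<Phi> \<phi> \<and>
          (\<phi> \<in> Linf \<Omega> \<longrightarrow> (\<forall>k. Linf_norm \<Omega> (\<Phi> k) \<le> ennreal c * Linf_norm \<Omega> \<phi>))))"
proof -
  have op: "open \<Omega>"
    using assms(3) by (simp add: lipschitz_domain_def)
  obtain I R s \<delta>0 and c :: "real ^ 'n \<Rightarrow> real ^ 'n" where cov: "shift_cover \<Omega> I R c s \<delta>0"
    using shift_cover_exists[OF assms(3,2)] by (elim exE)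
  \<comment> \<open>The witness is the number of balls plus 1: the cover is fixed before the
    exponents, the weight and the function are introduced, and the added 1 gives positivity.\<close>
  show ?thesis
  proof (intro exI[of _ "real (card I) + 1"] conjI allI impI ballI, goal_cases)
    case 1
    show ?case by simp
  next
    case (2 p q \<kappa> a \<phi>)
    then show ?case
      by (intro energy_approximation[OF op assms(2) cov, where \<kappa> = \<kappa>]) simp_all
  next
    case (3 p q \<kappa> a \<gamma> \<phi>)
    then show ?case
      by (intro holder_approximation[OF assms(3,2) cov, where \<kappa> = \<kappa> and \<gamma> = \<gamma>]) simp_all
  qed
qed

end
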